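(* Let $\boldsymbol{d}=\boldsymbol{d}(n)\in\{0,\ldots,n-1\}^n$ be a sequence of degree sequences (each realisable, i.e. $\mathcal{G}(n,\boldsymbol{d})\neq\emptyset$) which is near-regular and dense. Then there exist $p_1=(1-o(1))\Delta(\boldsymbol{d})/n$ and $p_2=(1+o(1))\Delta(\boldsymbol{d})/n$ and a coupling $(G^L,G,G^U)$ such that $G^L\sim\mathcal{G}(n,p_1)$, $G^U\sim\mathcal{G}(n,p_2)$, $G\sim\mathcal{G}(n,\boldsymbol{d})$ and $\mathbb{P}(G^L\subseteq G\subseteq G^U)=1-o(1)$.
   Context: All asymptotics are as $n\to\infty$. $\mathcal{G}(n,p)$ is the binomial random graph on vertex set $[n]$ in which each of the $\binom n2$ possible edges is present independently with probability $p$. For a vector $\boldsymbol{d}=(d_1,\ldots,d_n)$ of nonnegative integers with even sum, $\mathcal{G}(n,\boldsymbol{d})$ is the uniformly random simple graph on $[n]$ in which vertex $j$ has degree $d_j$ for every $j$. $\Delta(\boldsymbol{d})=\max_j d_j$ and $\mathrm{range}(\boldsymbol{d})=\max_j d_j-\min_j d_j$. The sequence $\boldsymbol{d}(n)$ is near-regular if $\mathrm{range}(\boldsymbol{d})=o(\Delta(\boldsymbol{d}))$ and $\mathrm{range}(\boldsymbol{d})=o(n-\Delta(\boldsymbol{d}))$; it is dense if $\min\{\Delta(\boldsymbol{d}),n-\Delta(\boldsymbol{d})\}=\Theta(n)$. A coupling of random graphs $Z_1,\ldots,Z_k$ is a random tuple whose marginal distributions coincide with those of $Z_1,\ldots,Z_k$;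 graphs on $[n]$ are compared via their edge sets. *)

theory Defs
  imports
    "HOL-Probability.Probability"
    "HOL-Probability.Product_PMF"
    "HOL-Library.Landau_Symbols"
begin

text \<open>A simple graph on \<open>[n] = {1..n}\<close> is represented by its edge set, a set of
  two-element subsets of \<open>{1..n}\<close>; thus \<open>\<subseteq>\<close> is the subgraph order.\<close>

type_synonym graph = "nat set set"

definition all_edges :: "nat \<Rightarrow> nat set set" where
  "all_edges n = {e. e \<subseteq> {1..n} \<and> card e = 2}"

definition vertex_degree :: "graph \<Rightarrow> nat \<Rightarrow> nat" where
  "vertex_degree E j = card {e \<in> E. j \<in> e}"

definition graphs_with_degrees :: "nat \<Rightarrow> (nat \<Rightarrow> nat) \<Rightarrow> graph set" where
  "graphs_with_degrees n d =
     {E. E \<subseteq> all_edges n \<and> (\<forall>j\<in>{1..n}. vertex_degree E j = d j)}"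

text \<open>As \<^const>\<open>pmf_of_set\<close> is specified for finite nonempty sets only, this is meaningful
  when the degree sequence is realisable.\<close>

definition degree_random_graph :: "nat \<Rightarrow> (nat \<Rightarrow> nat) \<Rightarrow> graph pmf" where
  "degree_random_graph n d = pmf_of_set (graphs_with_degrees n d)"

text \<open>Meaningful for \<open>0 \<le> p \<le> 1\<close>, like \<^const>\<open>bernoulli_pmf\<close>.\<close>

definition binomial_random_graph :: "nat \<Rightarrow> real \<Rightarrow> graph pmf" where
  "binomial_random_graph n p =
     map_pmf (\<lambda>X. {e \<in> all_edges n. X e})
       (Pi_pmf (all_edges n) False (\<lambda>_. bernoulli_pmf p))"

text \<open>\<open>d j\<close> is the degree of vertex \<open>j\<close>; values outside \<open>{1..n}\<close> play no role. For
  \<open>n = 0\<close> the maximum and minimum are unspecified, which is harmless for asymptotics.\<close>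

definition max_degree :: "nat \<Rightarrow> (nat \<Rightarrow> nat) \<Rightarrow> nat" where
  "max_degree n d = Max (d ` {1..n})"

definition min_degree :: "nat \<Rightarrow> (nat \<Rightarrow> nat) \<Rightarrow> nat" where
  "min_degree n d = Min (d ` {1..n})"

definition degree_range :: "nat \<Rightarrow> (nat \<Rightarrow> nat) \<Rightarrow> real" where
  "degree_range n d = real (max_degree n d) - real (min_degree n d)"

definition near_regular :: "(nat \<Rightarrow> nat \<Rightarrow> nat) \<Rightarrow> bool" where
  "near_regular d \<longleftrightarrow>
     (\<lambda>n. degree_range n (d n)) \<in> o(\<lambda>n. real (max_degree n (d n))) \<and>
     (\<lambda>n. degree_range n (d n)) \<in> o(\<lambda>n. real n - real (max_degree n (d n)))"

definition dense_degrees :: "(nat \<Rightarrow> nat \<Rightarrow> nat) \<Rightarrow> bool" where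
  "dense_degrees d \<longleftrightarrow>
     (\<lambda>n. min (real (max_degree n (d n))) (real n - real (max_degree n (d n))))
       \<in> \<Theta>(\<lambda>n. real n)"

text \<open>A coupling, given by its joint distribution. There are only finitely many graphs on
  \<open>[n]\<close>, so joint distributions of random graphs are always discrete.\<close>

definition is_coupling3 ::
  "('a \<times> 'b \<times> 'c) pmf \<Rightarrow> 'a pmf \<Rightarrow> 'b pmf \<Rightarrow> 'c pmf \<Rightarrow> bool" where
  "is_coupling3 C P Q R \<longleftrightarrow>
     map_pmf (\<lambda>(x, y, z). x) C = P \<and>
     map_pmf (\<lambda>(x, y, z). y) C = Q \<and>
     map_pmf (\<lambda>(x, y, z). z) C = R"

end

theory Submission
  imports Defs "HOL-Probability.Hoeffding" "HOL-Real_Asymp.Real_Asymp"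
begin

text \<open>
  Put \<open>p = \<Delta>/n\<close>, give the pairs independent uniform labels in \<open>{0..<K\<^sup>2}\<close> and expose the status of
  the pairs in the uniform random graph \<open>G\<close> with degrees \<open>d\<close> in the order of their labels. As long
  as the labels are below \<open>K\<^sup>2 - K\<close>, the conditional probability that the next pair is an edge is
  \<open>p + o(1)\<close>, so that its status can be coupled monotonically with Bernoulli variables of
  parameters \<open>p - \<theta>\<close> and \<open>p + \<theta>\<close>. The remaining pairs, a random set of density \<open>1/K\<close> which is
  independent of \<open>G\<close>, are left out of \<open>G\<^sup>L\<close> and put into \<open>G\<^sup>U\<close>; averaged over the labels, \<open>G\<^sup>L\<close> and
  \<open>G\<^sup>U\<close> are exactly binomial.

  The conditional probability is estimated by switching along 4-cycles \<open>j k v u\<close> of unexposed pairs.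
  The numbers of switchings are determined up to a factor \<open>1 + o(1)\<close> if \<open>G\<close> and the unexposed
  pairs are cut-quasirandom. For \<open>G(n,p)\<close>, Hoeffding's inequality and a union bound over \<open>4\<^sup>n\<close> pairs of
  vertex sets give this up to probability \<open>exp(-\<Omega>(n\<^sup>2))\<close>. It carries over to \<open>G\<close> because \<open>G(n,p)\<close> has
  degree sequence \<open>d\<close> with probability \<open>exp(-o(n\<^sup>2))\<close>: every cut-quasirandom graph is within \<open>o(n\<^sup>2)\<close>
  edge changes of a graph with degrees \<open>d\<close>.
\<close>

section \<open>Random subsets\<close>

definition random_subset :: "'e set \<Rightarrow> ('e \<Rightarrow> real) \<Rightarrow> 'e set pmf" where
  "random_subset A q = map_pmf (\<lambda>f. {e \<in> A. f e}) (Pi_pmf A False (\<lambda>e. bernoulli_pmf (q e)))"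

lemma binomial_random_graph_eq_random_subset:
  "binomial_random_graph n p = random_subset (all_edges n) (\<lambda>_. p)"
  by (simp add: binomial_random_graph_def random_subset_def)

lemma set_pmf_random_subset: "R \<in> set_pmf (random_subset A q) \<Longrightarrow> R \<subseteq> A"
  by (auto simp: random_subset_def)

lemma random_subset_empty [simp]: "random_subset {} q = return_pmf {}"
  by (simp add: random_subset_def)

lemma random_subset_insert:
  assumes "finite A" "e \<notin> A"
  shows "random_subset (insert e A) q =
    do {x \<leftarrow> bernoulli_pmf (q e);
        map_pmf (\<lambda>X. if x then insert e X else X) (random_subset A q)}"
  unfolding random_subset_def using assms
  by (auto simp: Pi_pmf_insert' map_bind_pmf pmf.map_comp map_pmf_def[symmetric] o_def
      intro!: bind_pmf_cong pmf.map_cong split: if_splits)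

lemma bernoulli_pmf_of_bool: "bernoulli_pmf (of_bool b) = return_pmf b"
proof (rule pmf_eqI)
  show "pmf (bernoulli_pmf (of_bool b)) x = pmf (return_pmf b) x" for x
    by (cases b; cases x) (auto simp: indicator_def)
qed

lemma random_subset_of_bool:
  assumes "finite A"
  shows "random_subset A (\<lambda>e. of_bool (P e)) = return_pmf {e \<in> A. P e}"
  using assms by (simp add: random_subset_def bernoulli_pmf_of_bool cong: conj_cong)

lemma pmf_random_subset:
  assumes A: "finite A" and q: "\<And>e. e \<in> A \<Longrightarrow> q e \<in> {0..1}" and R: "R \<subseteq> A"
  shows "pmf (random_subset A q) R = (\<Prod>e\<in>A. if e \<in> R then q e else 1 - q e)"
proof -
  define D where "D = Pi_pmf A False (\<lambda>e. bernoulli_pmf (q e))"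
  have "pmf (random_subset A q) R = measure_pmf.prob D ((\<lambda>X. {e \<in> A. X e}) -` {R})"
    unfolding random_subset_def D_def by (rule pmf_map)
  also have "\<dots> = measure_pmf.prob D {\<lambda>e. e \<in> R}"
  proof (rule measure_pmf.finite_measure_eq_AE)
    have "X \<in> (\<lambda>X. {e \<in> A. X e}) -` {R} \<longleftrightarrow> X \<in> {\<lambda>e. e \<in> R}" if "X \<in> set_pmf D" for X
    proof -
      have "\<forall>e. e \<notin> A \<longrightarrow> X e = False"
        using subsetD[OF set_Pi_pmf_subset[OF A] that[unfolded D_def]] by simp
      then show ?thesis using R by auto
    qed
    then show "AE X in measure_pmf D. X \<in> (\<lambda>X. {e \<in> A. X e}) -` {R} \<longleftrightarrow> X \<in> {\<lambda>e. e \<in> R}"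
      by (auto simp: AE_measure_pmf_iff)
  qed auto
  also have "\<dots> = pmf D (\<lambda>e. e \<in> R)" by (rule measure_pmf_single)
  also have "\<dots> = (\<Prod>e\<in>A. pmf (bernoulli_pmf (q e)) (e \<in> R))"
    unfolding D_def using A R by (intro pmf_Pi') auto
  also have "\<dots> = (\<Prod>e\<in>A. if e \<in> R then q e else 1 - q e)"
    using q by (intro prod.cong) auto
  finally show ?thesis .
qed

lemma pmf_random_subset_const:
  assumes A: "finite A" and p: "p \<in> {0..1}" and R: "R \<subseteq> A"
  shows "pmf (random_subset A (\<lambda>_. p)) R = p ^ card R * (1 - p) ^ (card A - card R)"
proof -
  have "(\<Prod>e\<in>A. if e \<in> R then p else 1 - p) = (\<Prod>e\<in>R. p) * (\<Prod>e\<in>A - R. 1 - p)"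
    using prod.If_cases[OF A, of "\<lambda>e. e \<in> R" "\<lambda>_. p" "\<lambda>_. 1 - p"] R
    by (simp add: Int_absorb1 Diff_eq)
  then show ?thesis
    using A p R by (simp add: pmf_random_subset card_Diff_subset finite_subset)
qed

lemma expectation_Pi_bernoulli_component:
  assumes "finite A" "e \<in> A" "q e \<in> {0..1}"
  shows "measure_pmf.expectation (Pi_pmf A False (\<lambda>e. bernoulli_pmf (q e)))
      (\<lambda>f. c * of_bool (f e)) = q e * c"
proof -
  have "measure_pmf.expectation (Pi_pmf A False (\<lambda>e. bernoulli_pmf (q e))) (\<lambda>f. c * of_bool (f e)) =
      measure_pmf.expectation (map_pmf (\<lambda>f. f e) (Pi_pmf A False (\<lambda>e. bernoulli_pmf (q e))))
        (\<lambda>b. c * of_bool b)"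
    by simp
  also have "map_pmf (\<lambda>f. f e) (Pi_pmf A False (\<lambda>e. bernoulli_pmf (q e))) = bernoulli_pmf (q e)"
    using assms by (simp add: Pi_pmf_component)
  finally show ?thesis using assms by simp
qed

lemma random_subset_sum_concentration:
  fixes w :: "'e \<Rightarrow> real"
  assumes A: "finite A" and q: "\<And>e. e \<in> A \<Longrightarrow> q e \<in> {0..1}"
    and M: "(\<Sum>e\<in>A. (w e)\<^sup>2) \<le> M" and t: "0 < t"
  shows "measure_pmf.prob (random_subset A q)
    {R. t \<le> \<bar>(\<Sum>e\<in>R. w e) - (\<Sum>e\<in>A. q e * w e)\<bar>} \<le> 2 * exp (- 2 * t\<^sup>2 / M)"
proof -
  define D where "D = Pi_pmf A False (\<lambda>e. bernoulli_pmf (q e))"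
  define X where "X = (\<lambda>e f. w e * of_bool (f e) :: real)"
  have "(\<Sum>e\<in>{e \<in> A. f e}. w e) = (\<Sum>e\<in>A. X e f)" for f
    using A by (intro sum.mono_neutral_cong_left) (auto simp: X_def)
  then have prob_eq: "measure_pmf.prob (random_subset A q)
      {R. t \<le> \<bar>(\<Sum>e\<in>R. w e) - (\<Sum>e\<in>A. q e * w e)\<bar>} =
      measure_pmf.prob D {f. t \<le> \<bar>(\<Sum>e\<in>A. X e f) - (\<Sum>e\<in>A. q e * w e)\<bar>}"
    unfolding random_subset_def D_def[symmetric] by (simp add: vimage_def)
  show ?thesis
  proof (cases "(\<Sum>e\<in>A. (w e)\<^sup>2) = 0")
    case True
    then have "w e = 0" if "e \<in> A" for e
      using that A by (subst (asm) sum_nonneg_eq_0_iff) auto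
    then show ?thesis unfolding prob_eq using t by (simp add: X_def)
  next
    case False
    have width: "(\<Sum>e\<in>A. (max 0 (w e) - min 0 (w e))\<^sup>2) = (\<Sum>e\<in>A. (w e)\<^sup>2)"
      by (intro sum.cong) (auto simp: max_def min_def)
    have pos: "(\<Sum>e\<in>A. (w e)\<^sup>2) > 0"
      using False by (simp add: order_less_le sum_nonneg)
    interpret Hoeffding_ineq "measure_pmf D" A X "\<lambda>e. min 0 (w e)" "\<lambda>e. max 0 (w e)"
      "\<Sum>e\<in>A. measure_pmf.expectation D (X e)"
    proof unfold_locales
      show "prob_space.indep_vars (measure_pmf D) (\<lambda>_. borel) X A"
        unfolding D_def X_def using A
        by (intro prob_space.indep_vars_compose2[OF _ indep_vars_Pi_pmf])
           (auto simp: measure_pmf.prob_space_axioms)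
    qed (use A in \<open>auto simp: X_def\<close>)
    have "(\<Sum>e\<in>A. measure_pmf.expectation D (X e)) = (\<Sum>e\<in>A. q e * w e)"
      unfolding D_def X_def using A q by (intro sum.cong expectation_Pi_bernoulli_component) auto
    then have "measure_pmf.prob D {f. t \<le> \<bar>(\<Sum>e\<in>A. X e f) - (\<Sum>e\<in>A. q e * w e)\<bar>}
        \<le> 2 * exp (- 2 * t\<^sup>2 / (\<Sum>e\<in>A. (w e)\<^sup>2))"
      using Hoeffding_ineq_abs_ge[of t] t pos by (simp add: width)
    also have "\<dots> \<le> 2 * exp (- 2 * t\<^sup>2 / M)"
      using pos M by (simp add: divide_left_mono_neg frac_le)
    finally show ?thesis unfolding prob_eq .
  qed
qed

lemma pmf_random_subset_sym_diff:
  assumes A: "finite A" and c: "0 < c" and q: "\<And>e. e \<in> A \<Longrightarrow> q e \<in> {c..1 - c}"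
    and R: "R \<subseteq> A" and D: "D \<subseteq> A"
  shows "c ^ card D * pmf (random_subset A q) R \<le> pmf (random_subset A q) (sym_diff R D)"
proof -
  have q01: "q e \<in> {0..1}" if "e \<in> A" for e using q[OF that] c by auto
  have "c ^ card D = (\<Prod>e\<in>A. if e \<in> D then c else 1)"
    using prod.If_cases[OF A, of "\<lambda>e. e \<in> D" "\<lambda>_. c" "\<lambda>_. 1"] D by (simp add: Int_absorb1)
  then have "c ^ card D * pmf (random_subset A q) R =
      (\<Prod>e\<in>A. (if e \<in> D then c else 1) * (if e \<in> R then q e else 1 - q e))"
    using A q01 R by (simp add: pmf_random_subset prod.distrib)
  also have "\<dots> \<le> (\<Prod>e\<in>A. if e \<in> sym_diff R D then q e else 1 - q e)"
  proof (rule prod_mono)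
    fix e assume "e \<in> A"
    then have e: "c \<le> q e" "q e \<le> 1 - c" using q by auto
    have "c * q e \<le> 1 - q e" "c * (1 - q e) \<le> q e"
      using c e mult_left_mono[of "q e" 1 c] mult_left_mono[of "1 - q e" 1 c] by linarith+
    then show "0 \<le> (if e \<in> D then c else 1) * (if e \<in> R then q e else 1 - q e) \<and>
       (if e \<in> D then c else 1) * (if e \<in> R then q e else 1 - q e) \<le>
         (if e \<in> sym_diff R D then q e else 1 - q e)"
      using c e by auto
  qed
  also have "\<dots> = pmf (random_subset A q) (sym_diff R D)"
    using A q01 R D by (subst pmf_random_subset) auto
  finally show ?thesis .
qed

lemma prob_random_subset_sym_diff:
  assumes A: "finite A" and c: "0 < c" and q: "\<And>e. e \<in> A \<Longrightarrow> q e \<in> {c..1 - c}"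
    and \<G>: "\<G> \<subseteq> Pow A" and D: "D \<subseteq> A"
  shows "c ^ card D * measure_pmf.prob (random_subset A q) {R. sym_diff R D \<in> \<G>}
    \<le> measure_pmf.prob (random_subset A q) \<G>"
proof -
  have invol: "sym_diff (sym_diff R D) D = R" for R by auto
  have fin: "finite \<G>" using A \<G> by (simp add: finite_subset)
  have "R \<in> (\<lambda>H. sym_diff H D) ` \<G>" if "sym_diff R D \<in> \<G>" for R
    using that
    by (rule image_eqI[where f = "\<lambda>H. sym_diff H D" and x = "sym_diff R D", OF invol[symmetric]])
  then have image: "{R. sym_diff R D \<in> \<G>} = (\<lambda>H. sym_diff H D) ` \<G>"
    by (auto simp only: invol)
  have "inj_on (\<lambda>H. sym_diff H D) \<G>"
    by (rule inj_on_inverseI[where g = "\<lambda>H. sym_diff H D"]) (rule invol)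
  then have "c ^ card D * measure_pmf.prob (random_subset A q) {R. sym_diff R D \<in> \<G>} =
      (\<Sum>H\<in>\<G>. c ^ card D * pmf (random_subset A q) (sym_diff H D))"
    unfolding image using fin by (simp add: measure_measure_pmf_finite sum.reindex sum_distrib_left)
  also have "\<dots> \<le> (\<Sum>H\<in>\<G>. pmf (random_subset A q) H)"
  proof (rule sum_mono)
    fix H assume "H \<in> \<G>"
    then have "sym_diff H D \<subseteq> A" using \<G> D by auto
    from pmf_random_subset_sym_diff[OF A c q this D]
    show "c ^ card D * pmf (random_subset A q) (sym_diff H D) \<le> pmf (random_subset A q) H"
      unfolding invol .
  qed
  also have "\<dots> = measure_pmf.prob (random_subset A q) \<G>"
    using fin by (simp add: measure_measure_pmf_finite)
  finally show ?thesis .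
qed

lemma sum_power_card_Pow:
  fixes x :: real
  assumes "finite A"
  shows "(\<Sum>D\<in>Pow A. x ^ card D) = (1 + x) ^ card A"
  using prod_add[OF assms, of "\<lambda>_. x" "\<lambda>_. 1"] by (simp add: add.commute)

text \<open>The factor \<open>c ^ k\<close> pays for changing the probability of a set by \<open>k\<close> edits, and
  \<open>(1 + x) ^ card A / x ^ k\<close> bounds the number of edit sets of size at most \<open>k\<close>.\<close>

lemma prob_random_subset_neighbourhood:
  assumes A: "finite A" and c: "0 < c" "c \<le> 1" and q: "\<And>e. e \<in> A \<Longrightarrow> q e \<in> {c..1 - c}"
    and x: "0 < x" "x \<le> 1" and \<G>: "\<G> \<subseteq> Pow A"
  shows "(c * x) ^ k * measure_pmf.prob (random_subset A q) {R. \<exists>H\<in>\<G>. card (sym_diff R H) \<le> k}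
    \<le> (1 + x) ^ card A * measure_pmf.prob (random_subset A q) \<G>"
proof -
  define M where "M = random_subset A q"
  define \<D> where "\<D> = {D \<in> Pow A. card D \<le> k}"
  have fin: "finite \<D>" using A by (simp add: \<D>_def)
  have "R \<in> (\<Union>D\<in>\<D>. {R. sym_diff R D \<in> \<G>})"
    if "R \<subseteq> A" "H \<in> \<G>" "card (sym_diff R H) \<le> k" for R H
  proof -
    have "sym_diff R (sym_diff R H) = H" by auto
    moreover have "sym_diff R H \<in> \<D>" unfolding \<D>_def using that \<G> by (intro CollectI conjI PowI) auto
    ultimately show ?thesis using that(2) by (intro UN_I[of "sym_diff R H"] CollectI) (simp_all only:)
  qed
  then have "measure_pmf.prob M {R. \<exists>H\<in>\<G>. card (sym_diff R H) \<le> k} \<le>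
      measure_pmf.prob M (\<Union>D\<in>\<D>. {R. sym_diff R D \<in> \<G>})"
    by (intro measure_pmf.finite_measure_mono_AE)
       (auto simp: M_def AE_measure_pmf_iff dest!: set_pmf_random_subset simp del: UN_iff)
  also have "\<dots> \<le> (\<Sum>D\<in>\<D>. measure_pmf.prob M {R. sym_diff R D \<in> \<G>})"
    using fin by (intro measure_pmf.finite_measure_subadditive_finite) auto
  finally have "(c * x) ^ k * measure_pmf.prob M {R. \<exists>H\<in>\<G>. card (sym_diff R H) \<le> k} \<le>
      (c * x) ^ k * (\<Sum>D\<in>\<D>. measure_pmf.prob M {R. sym_diff R D \<in> \<G>})"
    using c x by (intro mult_left_mono) auto
  also have "\<dots> = (\<Sum>D\<in>\<D>. x ^ k * (c ^ k * measure_pmf.prob M {R. sym_diff R D \<in> \<G>}))"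
    by (simp add: sum_distrib_left power_mult_distrib mult_ac)
  also have "\<dots> \<le> (\<Sum>D\<in>\<D>. x ^ card D * measure_pmf.prob M \<G>)"
  proof (intro sum_mono mult_mono)
    fix D assume "D \<in> \<D>"
    then have D: "D \<subseteq> A" "card D \<le> k" by (auto simp: \<D>_def)
    show "x ^ k \<le> x ^ card D" using D x by (intro power_decreasing) auto
    have "c ^ k * measure_pmf.prob M {R. sym_diff R D \<in> \<G>} \<le>
        c ^ card D * measure_pmf.prob M {R. sym_diff R D \<in> \<G>}"
      using D c by (intro mult_right_mono power_decreasing) auto
    also have "\<dots> \<le> measure_pmf.prob M \<G>"
      unfolding M_def by (rule prob_random_subset_sym_diff[OF A c(1) q \<G> D(1)])
    finally show "c ^ k * measure_pmf.prob M {R. sym_diff R D \<in> \<G>} \<le> measure_pmf.prob M \<G>" .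
  qed (use c x in auto)
  also have "\<dots> \<le> (\<Sum>D\<in>Pow A. x ^ card D) * measure_pmf.prob M \<G>"
    using A x unfolding sum_distrib_right[symmetric]
    by (intro mult_right_mono sum_mono2) (auto simp: \<D>_def)
  finally show ?thesis unfolding sum_power_card_Pow[OF A] M_def .
qed

lemma prob_random_subset_ge_if_neighbourhood_ge:
  assumes A: "finite A" and c: "0 < c" "c \<le> 1" and q: "\<And>e. e \<in> A \<Longrightarrow> q e \<in> {c..1 - c}"
    and x: "0 < x" "x \<le> 1" and \<G>: "\<G> \<subseteq> Pow A"
    and s: "0 \<le> s" "s \<le> measure_pmf.prob (random_subset A q) {R. \<exists>H\<in>\<G>. card (sym_diff R H) \<le> k}"
    and t: "t * (1 + x) ^ card A \<le> (c * x) ^ k"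
  shows "t * s \<le> measure_pmf.prob (random_subset A q) \<G>"
proof -
  have "(t * (1 + x) ^ card A) * s \<le>
      (c * x) ^ k * measure_pmf.prob (random_subset A q) {R. \<exists>H\<in>\<G>. card (sym_diff R H) \<le> k}"
    using c x s t by (intro mult_mono) auto
  also have "\<dots> \<le> (1 + x) ^ card A * measure_pmf.prob (random_subset A q) \<G>"
    by (rule prob_random_subset_neighbourhood[OF A c q x \<G>])
  finally have "(1 + x) ^ card A * (t * s) \<le>
      (1 + x) ^ card A * measure_pmf.prob (random_subset A q) \<G>"
    by (simp add: mult_ac)
  then show ?thesis using x by simp
qed

lemma prob_pmf_of_set_conditional:
  assumes "finite \<G>" "\<G> \<noteq> {}" "\<And>G. G \<in> \<G> \<Longrightarrow> pmf M G = v"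
  shows "measure_pmf.prob (pmf_of_set \<G>) S * measure_pmf.prob M \<G> = measure_pmf.prob M (\<G> \<inter> S)"
  using assms by (simp add: measure_measure_pmf_finite measure_pmf_of_set field_simps)

lemma prob_bind_pmf:
  "measure_pmf.prob (bind_pmf M f) S = measure_pmf.expectation M (\<lambda>x. measure_pmf.prob (f x) S)"
proof -
  have "ennreal (measure_pmf.prob (bind_pmf M f) S) = (\<integral>\<^sup>+x. measure_pmf.prob (f x) S \<partial>M)"
    by (simp add: measure_pmf.emeasure_eq_measure[symmetric])
  also have "\<dots> = ennreal (measure_pmf.expectation M (\<lambda>x. measure_pmf.prob (f x) S))"
    by (intro nn_integral_eq_integral measure_pmf.integrable_const_bound[where B = 1]) auto
  finally show ?thesis
    by (simp add: integral_nonneg_AE)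
qed

section \<open>Random labels\<close>

definition uniform_labels :: "'e set \<Rightarrow> nat \<Rightarrow> ('e \<Rightarrow> nat) pmf" where
  "uniform_labels A L = Pi_pmf A 0 (\<lambda>_. pmf_of_set {..<L})"

definition superlevel :: "'e set \<Rightarrow> ('e \<Rightarrow> nat) \<Rightarrow> nat \<Rightarrow> 'e set" where
  "superlevel A lab l = {e \<in> A. l \<le> lab e}"

lemma superlevel_subset: "superlevel A lab l \<subseteq> A"
  by (auto simp: superlevel_def)

lemma bernoulli_pmf_threshold_mixture:
  assumes L: "0 < L" "m \<le> L" and a: "a \<in> {0..1}" and b: "b \<in> {0..1}"
  shows "bind_pmf (pmf_of_set {..<L}) (\<lambda>i. bernoulli_pmf (if i < m then a else b)) =
    bernoulli_pmf (a * (real m / real L) + b * (1 - real m / real L))" (is "?mix = bernoulli_pmf ?p")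
proof (rule pmf_eqI)
  have sum_eq: "(\<Sum>i<L. if i < m then x else y) = x * real m + y * (real L - real m)" for x y :: real
  proof -
    have "{..<L} \<inter> {i. i < m} = {..<m}" "{..<L} \<inter> - {i. i < m} = {m..<L}" using L by auto
    then show ?thesis using L by (simp add: sum.If_cases of_nat_diff mult.commute)
  qed
  have s: "0 \<le> real m / real L" "real m / real L \<le> 1" using L by auto
  have "0 \<le> ?p" using s a b by simp
  moreover have "?p \<le> 1 * (real m / real L) + 1 * (1 - real m / real L)"
    using s a b by (intro add_mono mult_right_mono) auto
  ultimately have p: "0 \<le> ?p" "?p \<le> 1" by simp_all
  have mix: "pmf ?mix x =
      (\<Sum>i<L. if i < m then pmf (bernoulli_pmf a) x else pmf (bernoulli_pmf b) x) / real L" for x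
    using L by (simp add: pmf_bind integral_pmf_of_set lessThan_empty_iff if_distrib[of bernoulli_pmf]
        if_distrib[of "\<lambda>M. pmf M x"])
  show "pmf ?mix x = pmf (bernoulli_pmf ?p) x" for x
    unfolding mix sum_eq using L a b p by (cases x) (simp_all add: field_simps)
qed

lemma random_subset_label_mixture:
  assumes A: "finite A" and L: "0 < L" "m \<le> L" and a: "a \<in> {0..1}" and b: "b \<in> {0..1}"
  shows "bind_pmf (uniform_labels A L) (\<lambda>lab. random_subset A (\<lambda>e. if lab e < m then a else b)) =
    random_subset A (\<lambda>_. a * (real m / real L) + b * (1 - real m / real L))"
proof -
  have "random_subset A (\<lambda>_. a * (real m / real L) + b * (1 - real m / real L)) =
    map_pmf (\<lambda>f. {e \<in> A. f e}) (Pi_pmf A False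
      (\<lambda>_. bind_pmf (pmf_of_set {..<L}) (\<lambda>i. bernoulli_pmf (if i < m then a else b))))"
    unfolding bernoulli_pmf_threshold_mixture[OF L a b] random_subset_def ..
  also have "\<dots> = map_pmf (\<lambda>f. {e \<in> A. f e}) (bind_pmf (uniform_labels A L)
      (\<lambda>lab. Pi_pmf A False (\<lambda>e. bernoulli_pmf (if lab e < m then a else b))))"
    unfolding uniform_labels_def using A by (subst Pi_pmf_bind[where d' = 0]) auto
  finally show ?thesis unfolding map_bind_pmf random_subset_def ..
qed

lemma superlevel_uniform_labels:
  assumes A: "finite A" and L: "0 < L" "l \<le> L"
  shows "map_pmf (\<lambda>lab. superlevel A lab l) (uniform_labels A L) =
      random_subset A (\<lambda>_. 1 - real l / real L)"
proof -
  have "(\<lambda>e. if lab e < l then 0 else 1) = (\<lambda>e. of_bool (l \<le> lab e) :: real)" for lab :: "'a \<Rightarrow> nat"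
    by auto
  then have "return_pmf (superlevel A lab l) = random_subset A (\<lambda>e. if lab e < l then 0 else 1)"
      for lab
    by (simp only: superlevel_def random_subset_of_bool[OF A])
  then show ?thesis
    using random_subset_label_mixture[OF A L, of 0 1] by (simp add: map_pmf_def)
qed

section \<open>Couplings of three random variables\<close>

lemma is_coupling3_pair_pmf: "is_coupling3 (pair_pmf P (pair_pmf Q R)) P Q R"
proof -
  have "map_pmf (\<lambda>(x, y, z). y) (pair_pmf P (pair_pmf Q R)) =
      map_pmf fst (map_pmf snd (pair_pmf P (pair_pmf Q R)))"
    "map_pmf (\<lambda>(x, y, z). z) (pair_pmf P (pair_pmf Q R)) =
      map_pmf snd (map_pmf snd (pair_pmf P (pair_pmf Q R)))"
    "map_pmf (\<lambda>(x, y, z). x) (pair_pmf P (pair_pmf Q R)) = map_pmf fst (pair_pmf P (pair_pmf Q R))"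
    by (simp_all add: pmf.map_comp o_def split_def)
  then show ?thesis
    unfolding is_coupling3_def by (simp add: map_fst_pair_pmf map_snd_pair_pmf)
qed

lemma is_coupling3_support:
  assumes "is_coupling3 J P Q R" "(x, y, z) \<in> set_pmf J"
  shows "x \<in> set_pmf P" "y \<in> set_pmf Q" "z \<in> set_pmf R"
  using assms by (auto simp: is_coupling3_def intro: rev_image_eqI)

lemma is_coupling3_map:
  assumes "is_coupling3 J P Q R"
  shows "is_coupling3 (map_pmf (\<lambda>(x, y, z). (f x, g y, h z)) J)
    (map_pmf f P) (map_pmf g Q) (map_pmf h R)"
  using assms by (auto simp: is_coupling3_def pmf.map_comp o_def split_def)

lemma is_coupling3_mixture:
  assumes "\<And>i. is_coupling3 (J i) (P i) (Q i) (R i)"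
  shows "is_coupling3 (bind_pmf M J) (bind_pmf M P) (bind_pmf M Q) (bind_pmf M R)"
  using assms by (simp add: is_coupling3_def map_bind_pmf)

lemma is_coupling3_bind:
  assumes T: "is_coupling3 T P Q R" and J: "\<And>x y z. is_coupling3 (J x y z) (f x) (g y) (h z)"
  shows "is_coupling3 (bind_pmf T (\<lambda>(x, y, z). J x y z)) (bind_pmf P f) (bind_pmf Q g) (bind_pmf R h)"
proof -
  have marginals: "bind_pmf P f = bind_pmf T (\<lambda>(x, y, z). f x)"
    "bind_pmf Q g = bind_pmf T (\<lambda>(x, y, z). g y)"
    "bind_pmf R h = bind_pmf T (\<lambda>(x, y, z). h z)"
    using T by (auto simp: is_coupling3_def bind_map_pmf split_def)
  show ?thesis
    unfolding marginals using J by (intro is_coupling3_mixture) (simp add: split_def)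
qed

lemma bind_bernoulli_pmf_thinning:
  assumes "0 \<le> q" "q \<le> 1" "0 \<le> s" "s \<le> 1"
  shows "bind_pmf (bernoulli_pmf q) (\<lambda>z. bernoulli_pmf (if z then s else 0)) = bernoulli_pmf (q * s)"
proof (rule pmf_eqI)
  fix b
  show "pmf (bernoulli_pmf q \<bind> (\<lambda>z. bernoulli_pmf (if z then s else 0))) b =
      pmf (bernoulli_pmf (q * s)) b"
    using assms by (cases b) (auto simp: pmf_bind mult_le_one algebra_simps)
qed

lemma monotone_bernoulli_coupling:
  assumes "0 \<le> q1" "q1 \<le> a" "a \<le> q2" "q2 \<le> 1"
  obtains T where "is_coupling3 T (bernoulli_pmf q1) (bernoulli_pmf a) (bernoulli_pmf q2)"
    "\<And>x y z. (x, y, z) \<in> set_pmf T \<Longrightarrow> (x \<longrightarrow> y) \<and> (y \<longrightarrow> z)"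
proof -
  define Y where "Y = (\<lambda>z. bernoulli_pmf (if z then a / q2 else 0))"
  define X where "X = (\<lambda>y. bernoulli_pmf (if y then q1 / a else 0))"
  define T where "T = do {z \<leftarrow> bernoulli_pmf q2; y \<leftarrow> Y z; x \<leftarrow> X y; return_pmf (x, y, z)}"
  have ratios: "q2 * (a / q2) = a" "a * (q1 / a) = q1" "a / q2 \<le> 1" "q1 / a \<le> 1"
    using assms by (auto simp: divide_le_eq_1)
  have bind_Y: "bind_pmf (bernoulli_pmf q2) Y = bernoulli_pmf a"
    unfolding Y_def using assms ratios bind_bernoulli_pmf_thinning[of q2 "a / q2"] by simp
  have bind_X: "bind_pmf (bernoulli_pmf a) X = bernoulli_pmf q1"
    unfolding X_def using assms ratios bind_bernoulli_pmf_thinning[of a "q1 / a"] by simp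
  have "map_pmf (\<lambda>(x, y, z). x) T = bernoulli_pmf q2 \<bind> (\<lambda>z. Y z \<bind> X)"
    by (simp add: T_def map_bind_pmf bind_return_pmf')
  also have "\<dots> = bernoulli_pmf q1"
    by (simp add: bind_assoc_pmf[symmetric] bind_Y bind_X)
  finally have "is_coupling3 T (bernoulli_pmf q1) (bernoulli_pmf a) (bernoulli_pmf q2)"
    unfolding is_coupling3_def by (simp add: T_def map_bind_pmf bind_return_pmf' bind_Y)
  moreover have "(x \<longrightarrow> y) \<and> (y \<longrightarrow> z)" if "(x, y, z) \<in> set_pmf T" for x y z
    using that bernoulli_pmf_of_bool[of False] by (auto simp: T_def X_def Y_def split: if_splits)
  ultimately show thesis using that by blast
qed

lemma bernoulli_coupling_monotone_if_between:
  assumes "0 \<le> q1" "q2 \<le> 1"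
  obtains T where "is_coupling3 T (bernoulli_pmf q1) (bernoulli_pmf a) (bernoulli_pmf q2)"
    "\<And>x y z. a \<in> {q1..q2} \<Longrightarrow> (x, y, z) \<in> set_pmf T \<Longrightarrow> (x \<longrightarrow> y) \<and> (y \<longrightarrow> z)"
proof (cases "a \<in> {q1..q2}")
  case True
  then show thesis
    using monotone_bernoulli_coupling[of q1 a q2] assms that by (metis atLeastAtMost_iff)
qed (use is_coupling3_pair_pmf that in blast)

section \<open>Sequential exposure\<close>

definition history_class :: "'e set set \<Rightarrow> 'e set \<Rightarrow> 'e set \<Rightarrow> 'e set set" where
  "history_class \<G> T g = {G \<in> \<G>. G \<inter> T = g \<inter> T}"

definition member_frequency :: "'e set set \<Rightarrow> 'e \<Rightarrow> real" where
  "member_frequency \<G> e = real (card {G \<in> \<G>. e \<in> G}) / real (card \<G>)"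

definition deviating :: "'e set set \<Rightarrow> ('e \<Rightarrow> real) \<Rightarrow> ('e \<Rightarrow> real) \<Rightarrow> 'e list \<Rightarrow> 'e set set" where
  "deviating \<G> q1 q2 es = {g \<in> \<G>. \<exists>xs e ys. es = xs @ e # ys \<and>
     member_frequency (history_class \<G> (set xs) g) e \<notin> {q1 e..q2 e}}"

definition unsandwiched :: "'e set \<Rightarrow> ('e set \<times> 'e set \<times> 'e set) set" where
  "unsandwiched T = {(X, G, Y). \<not> (X \<subseteq> G \<and> G \<inter> T \<subseteq> Y)}"

lemma member_frequency_in_unit: "finite \<G> \<Longrightarrow> member_frequency \<G> e \<in> {0..1}"
  using card_mono[of \<G> "{G \<in> \<G>. e \<in> G}"]
  by (cases "card \<G> = 0") (auto simp: member_frequency_def divide_le_eq_1)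

lemma member_frequency_mult_card:
  assumes "finite \<G>"
  shows "real (card \<G>) * member_frequency \<G> e = real (card {G \<in> \<G>. e \<in> G})"
    and "real (card \<G>) * (1 - member_frequency \<G> e) = real (card {G \<in> \<G>. e \<notin> G})"
proof -
  show members: "real (card \<G>) * member_frequency \<G> e = real (card {G \<in> \<G>. e \<in> G})"
    using assms by (cases "\<G> = {}") (simp_all add: member_frequency_def)
  have "card {G \<in> \<G>. e \<in> G} + card {G \<in> \<G>. e \<notin> G} = card ({G \<in> \<G>. e \<in> G} \<union> {G \<in> \<G>. e \<notin> G})"
    using assms by (intro card_Un_disjoint[symmetric]) auto
  also have "{G \<in> \<G>. e \<in> G} \<union> {G \<in> \<G>. e \<notin> G} = \<G>" by auto
  finally have "real (card {G \<in> \<G>. e \<in> G}) + real (card {G \<in> \<G>. e \<notin> G}) = real (card \<G>)"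
    by (simp flip: of_nat_add)
  then show "real (card \<G>) * (1 - member_frequency \<G> e) = real (card {G \<in> \<G>. e \<notin> G})"
    using members by (simp add: right_diff_distrib)
qed

lemma pmf_of_set_condition_member:
  assumes fin: "finite \<G>" and "\<G> \<noteq> {}"
  shows "bind_pmf (bernoulli_pmf (member_frequency \<G> e)) (\<lambda>b. pmf_of_set {G \<in> \<G>. (e \<in> G) = b}) =
      pmf_of_set \<G>"
proof (rule pmf_eqI)
  fix g
  define a where "a = member_frequency \<G> e"
  have pos: "real (card \<G>) > 0" using assms by (simp add: card_gt_0_iff)
  have a01: "0 \<le> a" "a \<le> 1" using member_frequency_in_unit[OF fin] by (auto simp: a_def)
  have part: "w * pmf (pmf_of_set \<H>) g = indicator \<H> g / real (card \<G>)"
    if "finite \<H>" "real (card \<G>) * w = real (card \<H>)" for w and \<H> :: "'a set set"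
  proof (cases "\<H> = {}")
    case True
    then show ?thesis using that pos by simp
  next
    case False
    then have "real (card \<H>) > 0" using that by (simp add: card_gt_0_iff)
    then show ?thesis using that pos False by (simp add: field_simps)
  qed
  have "pmf (bind_pmf (bernoulli_pmf a) (\<lambda>b. pmf_of_set {G \<in> \<G>. (e \<in> G) = b})) g =
      a * pmf (pmf_of_set {G \<in> \<G>. e \<in> G}) g + (1 - a) * pmf (pmf_of_set {G \<in> \<G>. e \<notin> G}) g"
    using a01 by (simp add: pmf_bind)
  also have "\<dots> = indicator {G \<in> \<G>. e \<in> G} g / real (card \<G>) +
      indicator {G \<in> \<G>. e \<notin> G} g / real (card \<G>)"
    using fin member_frequency_mult_card[OF fin, of e] unfolding a_def
    by (intro arg_cong2[where f = "(+)"] part) auto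
  also have "\<dots> = pmf (pmf_of_set \<G>) g"
    using assms by (auto simp: indicator_def)
  finally show "pmf (bind_pmf (bernoulli_pmf (member_frequency \<G> e))
      (\<lambda>b. pmf_of_set {G \<in> \<G>. (e \<in> G) = b})) g =
      pmf (pmf_of_set \<G>) g"
    unfolding a_def .
qed

lemma deviating_Cons_eq:
  assumes "member_frequency \<G> e \<notin> {q1 e..q2 e}"
  shows "deviating \<G> q1 q2 (e # es) = \<G>"
  using assms by (fastforce simp: deviating_def history_class_def intro: exI[of _ "[]"])

lemma card_deviating_Cons:
  assumes "finite \<G>"
  shows "card (deviating {G \<in> \<G>. e \<in> G} q1 q2 es) + card (deviating {G \<in> \<G>. e \<notin> G} q1 q2 es)
    \<le> card (deviating \<G> q1 q2 (e # es))"
proof -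
  have "deviating {G \<in> \<G>. (e \<in> G) = b} q1 q2 es \<subseteq> deviating \<G> q1 q2 (e # es)" for b
  proof
    fix g assume "g \<in> deviating {G \<in> \<G>. (e \<in> G) = b} q1 q2 es"
    then obtain xs f ys where g: "g \<in> \<G>" "(e \<in> g) = b" and es: "es = xs @ f # ys"
      and dev: "member_frequency (history_class {G \<in> \<G>. (e \<in> G) = b} (set xs) g) f \<notin> {q1 f..q2 f}"
      unfolding deviating_def by blast
    have "history_class {G \<in> \<G>. (e \<in> G) = b} (set xs) g = history_class \<G> (set (e # xs)) g"
      using g by (auto simp: history_class_def)
    then show "g \<in> deviating \<G> q1 q2 (e # es)"
      unfolding deviating_def using g es dev by (auto intro!: exI[of _ "e # xs"])
  qed
  from this[of True] this[of False]
  have "card (deviating {G \<in> \<G>. e \<in> G} q1 q2 es \<union> deviating {G \<in> \<G>. e \<notin> G} q1 q2 es)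
      \<le> card (deviating \<G> q1 q2 (e # es))"
    using assms by (intro card_mono) (auto simp: deviating_def)
  moreover have "card (deviating {G \<in> \<G>. e \<in> G} q1 q2 es \<union> deviating {G \<in> \<G>. e \<notin> G} q1 q2 es) =
      card (deviating {G \<in> \<G>. e \<in> G} q1 q2 es) + card (deviating {G \<in> \<G>. e \<notin> G} q1 q2 es)"
    using assms by (intro card_Un_disjoint) (auto simp: deviating_def)
  ultimately show ?thesis by simp
qed

definition insert_outer :: "'e \<Rightarrow> bool \<Rightarrow> bool \<Rightarrow> 'e set \<times> 'e set \<times> 'e set \<Rightarrow> 'e set \<times> 'e set \<times> 'e set"
where
  "insert_outer e x y = (\<lambda>(X, G, Y). (if x then insert e X else X, G, if y then insert e Y else Y))"

definition extend_coupling ::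
  "'e \<Rightarrow> (bool \<times> bool \<times> bool) pmf \<Rightarrow> (bool \<Rightarrow> ('e set \<times> 'e set \<times> 'e set) pmf) \<Rightarrow>
      ('e set \<times> 'e set \<times> 'e set) pmf"
where
  "extend_coupling e T J = do {(x, b, y) \<leftarrow> T; map_pmf (insert_outer e x y) (J b)}"

lemma is_coupling3_extend_coupling:
  assumes A: "finite A" "e \<notin> A" and \<G>: "finite \<G>" "\<G> \<noteq> {}"
    and T: "is_coupling3 T (bernoulli_pmf (q1 e)) (bernoulli_pmf (member_frequency \<G> e))
        (bernoulli_pmf (q2 e))"
    and J: "\<And>b. is_coupling3 (J b) (random_subset A q1) (pmf_of_set {G \<in> \<G>. (e \<in> G) = b})
        (random_subset A q2)"
  shows "is_coupling3 (extend_coupling e T J)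
    (random_subset (insert e A) q1) (pmf_of_set \<G>) (random_subset (insert e A) q2)"
proof -
  have "is_coupling3 (map_pmf (insert_outer e x y) (J b))
      (map_pmf (\<lambda>X. if x then insert e X else X) (random_subset A q1))
      (pmf_of_set {G \<in> \<G>. (e \<in> G) = b})
      (map_pmf (\<lambda>Y. if y then insert e Y else Y) (random_subset A q2))" for x b y
    using is_coupling3_map[OF J, where g = "\<lambda>G. G"] by (simp add: insert_outer_def)
  then have "is_coupling3 (extend_coupling e T J)
      (bind_pmf (bernoulli_pmf (q1 e))
        (\<lambda>x. map_pmf (\<lambda>X. if x then insert e X else X) (random_subset A q1)))
      (bind_pmf (bernoulli_pmf (member_frequency \<G> e)) (\<lambda>b. pmf_of_set {G \<in> \<G>. (e \<in> G) = b}))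
      (bind_pmf (bernoulli_pmf (q2 e))
        (\<lambda>y. map_pmf (\<lambda>Y. if y then insert e Y else Y) (random_subset A q2)))"
    unfolding extend_coupling_def by (intro is_coupling3_bind[OF T])
  then show ?thesis
    using A \<G> by (simp add: random_subset_insert pmf_of_set_condition_member)
qed

lemma prob_unsandwiched_insert_le:
  assumes mono: "x \<longrightarrow> b" "b \<longrightarrow> y" and b: "\<And>X G Y. (X, G, Y) \<in> set_pmf J \<Longrightarrow> (e \<in> G) = b"
  shows "measure_pmf.prob (map_pmf (insert_outer e x y) J) (unsandwiched (insert e A))
    \<le> measure_pmf.prob J (unsandwiched A)"
proof -
  have "(X, G, Y) \<in> unsandwiched A"
    if "(X, G, Y) \<in> set_pmf J" "insert_outer e x y (X, G, Y) \<in> unsandwiched (insert e A)" for X G Y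
    using that(2) mono b[OF that(1)]
    by (auto simp: unsandwiched_def insert_outer_def split: if_splits)
  then show ?thesis
    unfolding measure_map_pmf
    by (intro measure_pmf.finite_measure_mono_AE) (auto simp: AE_measure_pmf_iff)
qed

lemma prob_unsandwiched_extend_coupling:
  assumes \<G>: "finite \<G>" "\<G> \<noteq> {}"
    and T: "is_coupling3 T P (bernoulli_pmf (member_frequency \<G> e)) R"
    and mono: "\<And>x b y. (x, b, y) \<in> set_pmf T \<Longrightarrow> (x \<longrightarrow> b) \<and> (b \<longrightarrow> y)"
    and J: "\<And>b. is_coupling3 (J b) (M b) (pmf_of_set {G \<in> \<G>. (e \<in> G) = b}) (N b)"
  shows "real (card \<G>) * measure_pmf.prob (extend_coupling e T J) (unsandwiched (insert e A)) \<le>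
    real (card {G \<in> \<G>. e \<in> G}) * measure_pmf.prob (J True) (unsandwiched A) +
    real (card {G \<in> \<G>. e \<notin> G}) * measure_pmf.prob (J False) (unsandwiched A)"
proof -
  define a where "a = member_frequency \<G> e"
  define h where "h = (\<lambda>b. measure_pmf.prob (J b) (unsandwiched A))"
  have a01: "0 \<le> a" "a \<le> 1" using member_frequency_in_unit[OF \<G>(1)] by (auto simp: a_def)
  have step: "measure_pmf.prob (map_pmf (insert_outer e x y) (J b)) (unsandwiched (insert e A)) \<le> h b"
    if xby: "(x, b, y) \<in> set_pmf T" for x b y
  proof -
    have "pmf (bernoulli_pmf a) b \<noteq> 0"
      using is_coupling3_support(2)[OF T xby] by (simp add: set_pmf_iff a_def)
    moreover have "real (card \<G>) \<noteq> 0"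
      using \<G> by simp
    ultimately have "real (card {G \<in> \<G>. (e \<in> G) = b}) \<noteq> 0"
      using a01 by (cases b) (auto simp: a_def simp flip: member_frequency_mult_card[OF \<G>(1)])
    then have "{G \<in> \<G>. (e \<in> G) = b} \<noteq> {}" by (metis card.empty of_nat_0)
    then have "(e \<in> G) = b" if "(X, G, Y) \<in> set_pmf (J b)" for X G Y
      using is_coupling3_support(2)[OF J that] \<G> by simp
    then show ?thesis
      unfolding h_def using mono[OF xby] by (intro prob_unsandwiched_insert_le) auto
  qed
  have "measure_pmf.prob (extend_coupling e T J) (unsandwiched (insert e A)) =
      measure_pmf.expectation T (\<lambda>(x, b, y).
        measure_pmf.prob (map_pmf (insert_outer e x y) (J b)) (unsandwiched (insert e A)))"
    by (simp add: extend_coupling_def prob_bind_pmf split_def)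
  also have "\<dots> \<le> measure_pmf.expectation T (\<lambda>(x, b, y). h b)"
    using step
    by (intro integral_mono_AE integrable_measure_pmf_finite) (auto simp: AE_measure_pmf_iff)
  also have "\<dots> = measure_pmf.expectation (map_pmf (\<lambda>(x, b, y). b) T) h"
    by (simp add: split_def)
  also have "\<dots> = a * h True + (1 - a) * h False"
    using T a01 by (simp add: is_coupling3_def a_def)
  finally have "real (card \<G>) * measure_pmf.prob (extend_coupling e T J) (unsandwiched (insert e A)) \<le>
      real (card \<G>) * (a * h True + (1 - a) * h False)"
    by (rule mult_left_mono) simp
  also have "\<dots> = (real (card \<G>) * a) * h True + (real (card \<G>) * (1 - a)) * h False"
    by (simp add: algebra_simps)
  finally show ?thesis
    unfolding a_def member_frequency_mult_card[OF \<G>(1)] h_def .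
qed

lemma extend_coupling_deviating:
  assumes \<G>: "finite \<G>" "\<G> \<noteq> {}" and A: "finite A" "e \<notin> A" and rates: "0 \<le> q1 e" "q2 e \<le> 1"
    and J: "\<And>b. is_coupling3 (J b) (random_subset A q1) (pmf_of_set {G \<in> \<G>. (e \<in> G) = b})
        (random_subset A q2)"
    and J_fail: "\<And>b. real (card {G \<in> \<G>. (e \<in> G) = b}) * measure_pmf.prob (J b) (unsandwiched A)
      \<le> real (card (deviating {G \<in> \<G>. (e \<in> G) = b} q1 q2 es))"
  obtains K where "is_coupling3 K (random_subset (insert e A) q1) (pmf_of_set \<G>)
      (random_subset (insert e A) q2)"
    "real (card \<G>) * measure_pmf.prob K (unsandwiched (insert e A)) \<le>
      real (card (deviating \<G> q1 q2 (e # es)))"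
proof -
  obtain T where T: "is_coupling3 T (bernoulli_pmf (q1 e)) (bernoulli_pmf (member_frequency \<G> e))
      (bernoulli_pmf (q2 e))"
    and mono: "\<And>x b y. member_frequency \<G> e \<in> {q1 e..q2 e} \<Longrightarrow> (x, b, y) \<in> set_pmf T \<Longrightarrow>
        (x \<longrightarrow> b) \<and> (b \<longrightarrow> y)"
    using bernoulli_coupling_monotone_if_between[OF rates] by metis
  have "real (card \<G>) * measure_pmf.prob (extend_coupling e T J) (unsandwiched (insert e A))
      \<le> real (card (deviating \<G> q1 q2 (e # es)))"
  proof (cases "member_frequency \<G> e \<in> {q1 e..q2 e}")
    case False
    then show ?thesis by (simp add: deviating_Cons_eq mult_left_le)
  next
    case True
    then show ?thesis
      using prob_unsandwiched_extend_coupling[OF \<G> T mono[OF True] J, of A]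
        J_fail[of True] J_fail[of False] card_deviating_Cons[OF \<G>(1), of e q1 q2 es] by simp
  qed
  then show thesis
    using that is_coupling3_extend_coupling[OF A \<G> T J] by blast
qed

lemma sequential_coupling:
  assumes "finite \<G>" "distinct es" "\<And>e. e \<in> set es \<Longrightarrow> 0 \<le> q1 e \<and> q2 e \<le> 1"
  shows "\<exists>J. is_coupling3 J (random_subset (set es) q1) (pmf_of_set \<G>) (random_subset (set es) q2) \<and>
    real (card \<G>) * measure_pmf.prob J (unsandwiched (set es)) \<le> real (card (deviating \<G> q1 q2 es))"
  using assms
proof (induction es arbitrary: \<G>)
  case Nil
  have "measure_pmf.prob (pair_pmf (return_pmf {}) (pair_pmf (pmf_of_set \<G>) (return_pmf {})))
      (unsandwiched {}) = 0"
    by (subst measure_pmf_zero_iff) (auto simp: unsandwiched_def)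
  then show ?case
    using is_coupling3_pair_pmf[of "return_pmf {}" "pmf_of_set \<G>" "return_pmf {}"]
    by (auto intro!: exI[of _ "pair_pmf (return_pmf {}) (pair_pmf (pmf_of_set \<G>) (return_pmf {}))"])
next
  case (Cons e es)
  show ?case
  proof (cases "\<G> = {}")
    case True
    then show ?thesis using is_coupling3_pair_pmf by fastforce
  next
    case nonempty: False
    define \<G>' where "\<G>' = (\<lambda>b. {G \<in> \<G>. (e \<in> G) = b})"
    have "\<forall>b. \<exists>J.
      is_coupling3 J (random_subset (set es) q1) (pmf_of_set (\<G>' b)) (random_subset (set es) q2) \<and>
      real (card (\<G>' b)) * measure_pmf.prob J (unsandwiched (set es)) \<le>
        real (card (deviating (\<G>' b) q1 q2 es))"
      using Cons.prems by (intro allI Cons.IH) (auto simp: \<G>'_def)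
    from choice[OF this] obtain J where
      "\<And>b. is_coupling3 (J b) (random_subset (set es) q1) (pmf_of_set (\<G>' b))
        (random_subset (set es) q2)"
      "\<And>b. real (card (\<G>' b)) * measure_pmf.prob (J b) (unsandwiched (set es))
        \<le> real (card (deviating (\<G>' b) q1 q2 es))"
      by blast
    then obtain K where "is_coupling3 K (random_subset (insert e (set es)) q1) (pmf_of_set \<G>)
        (random_subset (insert e (set es)) q2)"
      "real (card \<G>) * measure_pmf.prob K (unsandwiched (insert e (set es))) \<le>
        real (card (deviating \<G> q1 q2 (e # es)))"
      using extend_coupling_deviating[OF Cons.prems(1) nonempty, of "set es" e q1 q2 J es]
        Cons.prems(2,3)
      unfolding \<G>'_def by auto
    then show ?thesis by auto
  qed
qed

lemma Markov_inequality_fibres: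
  fixes \<eta> :: real
  assumes A: "finite A" and "bad \<subseteq> A"
  shows "\<eta> * real (card
      {x \<in> A. \<eta> * real (card {y \<in> A. f y = f x}) < real (card {y \<in> bad. f y = f x})})
    \<le> real (card bad)"
proof -
  define D where "D = {x \<in> A. \<eta> * real (card {y \<in> A. f y = f x}) < real (card {y \<in> bad. f y = f x})}"
  have fin: "finite D" "finite bad" using assms by (auto simp: D_def finite_subset)
  have fibre: "{y \<in> D. f y = f x} = {y \<in> A. f y = f x}" if "x \<in> D" for x
    using that by (auto simp: D_def)
  have "D \<subseteq> A" by (auto simp: D_def)
  have "\<eta> * real (card D) = (\<Sum>v\<in>f ` D. \<eta> * real (card {y \<in> D. f y = v}))"
    using sum.image_gen[OF fin(1), of "\<lambda>_. \<eta>" f] by (simp add: mult.commute)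
  also have "\<dots> \<le> (\<Sum>v\<in>f ` D. real (card {y \<in> bad. f y = v}))"
    using fibre by (intro sum_mono) (auto simp: D_def)
  also have "\<dots> = real (card (\<Union>v\<in>f ` D. {y \<in> bad. f y = v}))"
    using fin by (subst card_UN_disjoint) auto
  also have "\<dots> \<le> real (card bad)"
    using fin by (intro of_nat_mono card_mono) auto
  finally show ?thesis unfolding D_def .
qed

lemma card_deviating_le:
  fixes \<eta> :: real
  assumes \<G>: "finite \<G>" and \<eta>: "0 < \<eta>" and bad: "bad \<subseteq> \<G>"
    and frequency: "\<And>xs e ys g. es = xs @ e # ys \<Longrightarrow> g \<in> \<G> \<Longrightarrow>
      real (card (history_class \<G> (set xs) g \<inter> bad)) \<le> \<eta> * real (card (history_class \<G> (set xs) g)) \<Longrightarrow>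
      member_frequency (history_class \<G> (set xs) g) e \<in> {q1 e..q2 e}"
  shows "real (card (deviating \<G> q1 q2 es)) \<le> real (length es) * (real (card bad) / \<eta>)"
proof -
  define D where "D = (\<lambda>i. {g \<in> \<G>.
    \<eta> * real (card {G \<in> \<G>. G \<inter> set (take i es) = g \<inter> set (take i es)}) <
    real (card {G \<in> bad. G \<inter> set (take i es) = g \<inter> set (take i es)})})"
  have class_bad: "{G \<in> \<G>. G \<inter> S = g \<inter> S} \<inter> bad = {G \<in> bad. G \<inter> S = g \<inter> S}" for S g using bad by auto
  have "deviating \<G> q1 q2 es \<subseteq> (\<Union>i<length es. D i)"
  proof
    fix g assume "g \<in> deviating \<G> q1 q2 es"
    then obtain xs e ys where g: "g \<in> \<G>" and es: "es = xs @ e # ys"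
      and dev: "member_frequency (history_class \<G> (set xs) g) e \<notin> {q1 e..q2 e}"
      unfolding deviating_def by blast
    have "g \<in> D (length xs)"
      using frequency[OF es g] dev g class_bad unfolding D_def es history_class_def by force
    then show "g \<in> (\<Union>i<length es. D i)" by (auto simp: es)
  qed
  then have "card (deviating \<G> q1 q2 es) \<le> card (\<Union>i<length es. D i)"
    using \<G> by (intro card_mono) (auto simp: D_def)
  also have "\<dots> \<le> (\<Sum>i<length es. card (D i))" by (rule card_UN_le) simp
  finally have "real (card (deviating \<G> q1 q2 es)) \<le> (\<Sum>i<length es. real (card (D i)))"
    by (simp flip: of_nat_sum)
  also have "\<dots> \<le> (\<Sum>i<length es. real (card bad) / \<eta>)"
    using Markov_inequality_fibres[OF \<G> bad] \<eta> unfolding D_def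
    by (intro sum_mono) (simp add: field_simps)
  finally show ?thesis by simp
qed

section \<open>Degrees and edge counts\<close>

text \<open>Ordered pairs are counted, so an edge inside \<open>A \<inter> B\<close> contributes 2.\<close>

definition ecount :: "graph \<Rightarrow> nat set \<Rightarrow> nat set \<Rightarrow> nat" where
  "ecount W A B = card {(u, v) \<in> A \<times> B. {u, v} \<in> W}"

lemma finite_all_edges [simp]: "finite (all_edges n)"
  by (rule finite_subset[of _ "Pow {1..n}"]) (auto simp: all_edges_def)

lemma finite_graph: "W \<subseteq> all_edges n \<Longrightarrow> finite W"
  using finite_subset finite_all_edges by blast

lemma graphs_with_degrees_subset: "graphs_with_degrees n d \<subseteq> Pow (all_edges n)"
  by (auto simp: graphs_with_degrees_def)

lemma finite_graphs_with_degrees: "finite (graphs_with_degrees n d)"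
  by (rule finite_subset[OF graphs_with_degrees_subset]) simp

lemma doubleton_in_all_edges: "{u, v} \<in> all_edges n \<longleftrightarrow> u \<in> {1..n} \<and> v \<in> {1..n} \<and> u \<noteq> v"
  by (auto simp: all_edges_def card_insert_if)

lemma card_all_edges_le: "card (all_edges n) \<le> n\<^sup>2"
proof -
  have "all_edges n \<subseteq> (\<lambda>(u, v). {u, v}) ` ({1..n} \<times> {1..n})"
    unfolding all_edges_def by (auto simp: card_2_iff)
  then have "card (all_edges n) \<le> card ({1..n} \<times> {1..n})"
    by (rule surj_card_le[rotated]) simp
  then show ?thesis by (simp add: power2_eq_square)
qed

lemma card_vertex_subset_le: "A \<subseteq> {1..n} \<Longrightarrow> card A \<le> n"
  using card_mono[of "{1..n}" A] by simp

lemma finite_ordered_pairs: "finite A \<Longrightarrow> finite B \<Longrightarrow> finite {(u, v) \<in> A \<times> B. P u v}"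
  by (rule finite_subset[of _ "A \<times> B"]) auto

lemma ecount_mono: "finite A \<Longrightarrow> finite B \<Longrightarrow> W \<subseteq> W' \<Longrightarrow> ecount W A B \<le> ecount W' A B"
  unfolding ecount_def by (intro card_mono finite_ordered_pairs) auto

lemma ecount_le: "finite A \<Longrightarrow> finite B \<Longrightarrow> ecount W A B \<le> card A * card B"
  unfolding ecount_def card_cartesian_product[symmetric] by (intro card_mono) auto

lemma ecount_Int_Diff:
  assumes "finite A" "finite B"
  shows "ecount W A B = ecount (W \<inter> E) A B + ecount (W - E) A B"
proof -
  have "{(u, v) \<in> A \<times> B. {u, v} \<in> W} =
      {(u, v) \<in> A \<times> B. {u, v} \<in> W \<inter> E} \<union> {(u, v) \<in> A \<times> B. {u, v} \<in> W - E}"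
    by auto
  then show ?thesis
    unfolding ecount_def using assms
    by (simp only:) (intro card_Un_disjoint finite_ordered_pairs; auto)
qed

lemma ecount_eq_sum_edges:
  assumes "finite W" "finite A" "finite B"
  shows "ecount W A B = (\<Sum>e\<in>W. card {(u, v) \<in> A \<times> B. {u, v} = e})"
proof -
  have "{(u, v) \<in> A \<times> B. {u, v} \<in> W} = (\<Union>e\<in>W. {(u, v) \<in> A \<times> B. {u, v} = e})"
    by auto
  then show ?thesis
    unfolding ecount_def using assms
    by (simp only:) (intro card_UN_disjoint ballI finite_ordered_pairs; auto)
qed

lemma ecount_eq_sum_rows:
  assumes "finite A" "finite B"
  shows "ecount W A B = (\<Sum>a\<in>A. card {b \<in> B. {a, b} \<in> W})"
proof -
  have "{(u, v) \<in> A \<times> B. {u, v} \<in> W} = (SIGMA a:A. {b \<in> B. {a, b} \<in> W})" by auto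
  then show ?thesis unfolding ecount_def using assms by simp
qed

lemma card_orientations_le:
  assumes "card e = 2"
  shows "card {(u, v) \<in> A \<times> B. {u, v} = e} \<le> 2"
proof -
  obtain a b where e: "e = {a, b}" using assms by (meson card_2_iff)
  have "{(u, v) \<in> A \<times> B. {u, v} = e} \<subseteq> set [(a, b), (b, a)]"
    unfolding e by (auto simp: doubleton_eq_iff)
  then have "card {(u, v) \<in> A \<times> B. {u, v} = e} \<le> card (set [(a, b), (b, a)])"
    by (intro card_mono) auto
  also have "\<dots> \<le> 2" using card_length[of "[(a, b), (b, a)]"] by simp
  finally show ?thesis .
qed

lemma card_orientations_eq:
  assumes "e \<in> all_edges n"
  shows "card {(u, v) \<in> {1..n} \<times> {1..n}. {u, v} = e} = 2"
proof -
  obtain a b where e: "e = {a, b}" "a \<noteq> b" using assms by (auto simp: all_edges_def card_2_iff)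
  have "{(u, v) \<in> {1..n} \<times> {1..n}. {u, v} = e} = {(a, b), (b, a)}"
    using assms unfolding e by (auto simp: doubleton_eq_iff all_edges_def)
  then show ?thesis using e by simp
qed

lemma ecount_le_card:
  assumes "W \<subseteq> all_edges n" "finite A" "finite B"
  shows "ecount W A B \<le> 2 * card W"
proof -
  have "ecount W A B \<le> (\<Sum>e\<in>W. 2)"
    unfolding ecount_eq_sum_edges[OF finite_graph[OF assms(1)] assms(2,3)]
    using assms(1) by (intro sum_mono card_orientations_le) (auto simp: all_edges_def)
  then show ?thesis by simp
qed

lemma ecount_full:
  assumes "W \<subseteq> all_edges n"
  shows "ecount W {1..n} {1..n} = 2 * card W"
proof -
  have "ecount W {1..n} {1..n} = (\<Sum>e\<in>W. 2)"
    unfolding ecount_eq_sum_edges[OF finite_graph[OF assms] finite_atLeastAtMost finite_atLeastAtMost]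
    using assms by (intro sum.cong card_orientations_eq) auto
  then show ?thesis by simp
qed

lemma ecount_all_edges:
  assumes "A \<subseteq> {1..n}" "B \<subseteq> {1..n}"
  shows "\<bar>real (ecount (all_edges n) A B) - real (card A) * real (card B)\<bar> \<le> real n"
proof -
  have fin: "finite A" "finite B" using assms finite_subset by auto
  have "A \<times> B \<subseteq> {(u, v) \<in> A \<times> B. {u, v} \<in> all_edges n} \<union> (\<lambda>u. (u, u)) ` {1..n}"
    using assms by (auto simp: doubleton_in_all_edges)
  then have "card (A \<times> B) \<le> card ({(u, v) \<in> A \<times> B. {u, v} \<in> all_edges n} \<union> (\<lambda>u. (u, u)) ` {1..n})"
    using fin by (intro card_mono finite_UnI finite_ordered_pairs) auto
  also have "\<dots> \<le> ecount (all_edges n) A B + card ((\<lambda>u. (u, u)) ` {1..n})"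
    unfolding ecount_def by (rule card_Un_le)
  also have "card ((\<lambda>u. (u, u)) ` {1..n}) \<le> n" using card_image_le[of "{1..n}" "\<lambda>u. (u, u)"] by simp
  finally have "card A * card B \<le> ecount (all_edges n) A B + n" by (simp add: card_cartesian_product)
  then have "real (card A) * real (card B) \<le> real (ecount (all_edges n) A B) + real n"
    by (simp flip: of_nat_mult of_nat_add)
  moreover have "real (ecount (all_edges n) A B) \<le> real (card A) * real (card B)"
    using ecount_le[OF fin, of "all_edges n"] by (simp flip: of_nat_mult)
  ultimately show ?thesis by (simp add: abs_le_iff)
qed

lemma ecount_le_ecount_plus_card_diff:
  assumes "W \<subseteq> all_edges n" "finite A" "finite B"
  shows "ecount W A B \<le> ecount W' A B + 2 * card (W - W')"
proof -
  have "ecount W A B = ecount (W \<inter> W') A B + ecount (W - W') A B"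
    using assms by (intro ecount_Int_Diff)
  also have "\<dots> \<le> ecount W' A B + 2 * card (W - W')"
    using assms by (intro add_mono ecount_mono ecount_le_card[where n = n]) auto
  finally show ?thesis .
qed

definition neighbours :: "graph \<Rightarrow> nat \<Rightarrow> nat set" where
  "neighbours W x = {v. {x, v} \<in> W}"

lemma neighbours_eq: "W \<subseteq> all_edges n \<Longrightarrow> neighbours W x = {v \<in> {1..n}. {x, v} \<in> W}"
  using doubleton_in_all_edges by (auto simp: neighbours_def)

lemma neighbours_subset: "W \<subseteq> all_edges n \<Longrightarrow> neighbours W x \<subseteq> {1..n}"
  by (auto simp: neighbours_eq)

lemma vertex_degree_eq_card_neighbours:
  assumes "W \<subseteq> all_edges n"
  shows "vertex_degree W x = card (neighbours W x)"
proof -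
  have "inj_on (\<lambda>v. {x, v}) (neighbours W x)"
    by (auto simp: inj_on_def doubleton_eq_iff)
  moreover have "e \<in> (\<lambda>v. {x, v}) ` neighbours W x" if "e \<in> W" "x \<in> e" for e
  proof -
    have "card e = 2" using that assms by (auto simp: all_edges_def)
    then obtain v where "e = {x, v}" using \<open>x \<in> e\<close>
      by (metis card_2_iff doubleton_eq_iff insertE singletonD)
    then show ?thesis using that by (auto simp: neighbours_def)
  qed
  then have "{e \<in> W. x \<in> e} = (\<lambda>v. {x, v}) ` neighbours W x"
    by (intro equalityI subsetI) (auto simp: neighbours_def)
  ultimately show ?thesis by (simp add: vertex_degree_def card_image)
qed

lemma sum_vertex_degree:
  assumes "W \<subseteq> all_edges n" "finite A"
  shows "(\<Sum>x\<in>A. vertex_degree W x) = ecount W A {1..n}"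
  using assms by (simp add: ecount_eq_sum_rows vertex_degree_eq_card_neighbours neighbours_eq)

lemma handshake:
  assumes "W \<subseteq> all_edges n"
  shows "(\<Sum>x\<in>{1..n}. vertex_degree W x) = 2 * card W"
  using sum_vertex_degree[OF assms, of "{1..n}"] ecount_full[OF assms] by simp

lemma even_sum_degrees:
  assumes "graphs_with_degrees n d \<noteq> {}"
  shows "even (\<Sum>j\<in>{1..n}. d j)"
proof -
  obtain H where "H \<subseteq> all_edges n" "(\<Sum>j\<in>{1..n}. d j) = (\<Sum>j\<in>{1..n}. vertex_degree H j)"
    using assms by (auto simp: graphs_with_degrees_def)
  then show ?thesis using handshake by simp
qed

lemma vertex_degree_insert:
  assumes "finite W" "e \<notin> W"
  shows "vertex_degree (insert e W) x = vertex_degree W x + of_bool (x \<in> e)"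
proof -
  have "{f \<in> insert e W. x \<in> f} = (if x \<in> e then insert e {f \<in> W. x \<in> f} else {f \<in> W. x \<in> f})"
    by auto
  then show ?thesis unfolding vertex_degree_def using assms by simp
qed

lemma vertex_degree_Int_Diff:
  assumes "finite W"
  shows "vertex_degree W x = vertex_degree (W \<inter> S) x + vertex_degree (W - S) x"
  unfolding vertex_degree_def using assms
  by (subst card_Un_disjoint[symmetric]) (auto intro!: arg_cong[where f = card])

lemma vertex_degree_sym_diff:
  assumes "finite W" "finite S" "vertex_degree (S \<inter> W) x = vertex_degree (S - W) x"
  shows "vertex_degree (sym_diff W S) x = vertex_degree W x"
proof -
  have "sym_diff W S \<inter> S = S - W" "sym_diff W S - S = W - S" by auto
  then show ?thesis
    using assms vertex_degree_Int_Diff[of "sym_diff W S" x S] vertex_degree_Int_Diff[of W x S]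
    by (simp add: Int_commute)
qed

lemma vertex_degree_complement:
  assumes W: "W \<subseteq> all_edges n" and x: "x \<in> {1..n}"
  shows "vertex_degree (all_edges n - W) x + vertex_degree W x = n - 1"
proof -
  have "vertex_degree (all_edges n - W) x + vertex_degree W x = vertex_degree (all_edges n) x"
    using vertex_degree_Int_Diff[of "all_edges n" x W] W by (simp add: Int_absorb1)
  also have "\<dots> = card (neighbours (all_edges n) x)"
    by (rule vertex_degree_eq_card_neighbours[where n = n]) simp
  also have "neighbours (all_edges n) x = {1..n} - {x}"
    using x by (auto simp: neighbours_def doubleton_in_all_edges)
  finally show ?thesis using x by simp
qed

section \<open>Switchings\<close>

text \<open>These are the switchings that remove the edge \<open>{j, k}\<close> from \<open>G\<close> by exchanging alternate edges
  of a 4-cycle in \<open>U\<close>; the switchings that create it are \<open>switchings U (- G) j k\<close>.\<close>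

definition switchings :: "graph \<Rightarrow> graph \<Rightarrow> nat \<Rightarrow> nat \<Rightarrow> (nat \<times> nat) set" where
  "switchings U G j k = {(u, v). {u, v} \<in> U \<inter> G \<and> {j, u} \<in> U - G \<and> {k, v} \<in> U - G}"

definition four_cycle :: "nat \<Rightarrow> nat \<Rightarrow> nat \<times> nat \<Rightarrow> graph" where
  "four_cycle j k = (\<lambda>(u, v). {{j, k}, {u, v}, {j, u}, {k, v}})"

lemma switchings_mono: "U \<subseteq> U' \<Longrightarrow> switchings U G j k \<subseteq> switchings U' G j k"
  by (auto simp: switchings_def)

lemma switchings_subset:
  assumes "U \<subseteq> all_edges n"
  shows "switchings U G j k \<subseteq> {1..n} \<times> {1..n}"
proof -
  have "{u, v} \<in> all_edges n" if "(u, v) \<in> switchings U G j k" for u v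
    using that assms by (auto simp: switchings_def)
  then show ?thesis by (auto simp: doubleton_in_all_edges)
qed

lemma finite_switchings: "U \<subseteq> all_edges n \<Longrightarrow> finite (switchings U G j k)"
  using finite_subset[OF switchings_subset] by blast

lemma card_switchings_le: "U \<subseteq> all_edges n \<Longrightarrow> card (switchings U G j k) \<le> n\<^sup>2"
  using card_mono[OF _ switchings_subset] by (simp add: power2_eq_square)

lemma card_switchings_eq:
  "card (switchings U G j k) = ecount (U \<inter> G) (neighbours (U - G) j) (neighbours (U - G) k)"
  unfolding switchings_def ecount_def neighbours_def by (rule arg_cong[where f = card]) auto

lemma switchings_distinct:
  assumes "(u, v) \<in> switchings U G j k" "{j, k} \<in> U \<inter> G" "U \<subseteq> all_edges n"
  shows "distinct [j, k, u, v]"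
proof -
  have "{u, v} \<in> all_edges n" "{j, u} \<in> all_edges n" "{k, v} \<in> all_edges n" "{j, k} \<in> all_edges n"
    using assms by (auto simp: switchings_def)
  moreover have "u \<noteq> k" "v \<noteq> j"
    using assms by (auto simp: switchings_def insert_commute)
  ultimately show ?thesis by (auto simp: doubleton_in_all_edges)
qed

lemma vertex_degree_disjoint_pair:
  assumes "distinct [a, b, c, d]"
  shows "vertex_degree {{a, b}, {c, d}} x = of_bool (x \<in> {a, b, c, d})"
proof -
  have "{a, b} \<noteq> {c, d}" using assms by (auto simp: doubleton_eq_iff)
  then have "vertex_degree {{a, b}, {c, d}} x = of_bool (x \<in> {a, b}) + of_bool (x \<in> {c, d})"
    using vertex_degree_insert[of "{{c, d}}" "{a, b}" x] vertex_degree_insert[of "{}" "{c, d}" x]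
    by (simp add: vertex_degree_def)
  moreover have "\<not> (x \<in> {a, b} \<and> x \<in> {c, d})" using assms by auto
  ultimately show ?thesis by (cases "x \<in> {a, b}"; cases "x \<in> {c, d}") auto
qed

lemma switch_in_class:
  fixes n d T g
  defines "C \<equiv> history_class (graphs_with_degrees n d) T g"
  assumes G: "G \<in> C" and X: "X = G \<or> X = - G"
    and uv: "(u, v) \<in> switchings (all_edges n - T) X j k" and jk: "{j, k} \<in> (all_edges n - T) \<inter> X"
  shows "sym_diff G (four_cycle j k (u, v)) \<in> C"
proof -
  define S where "S = four_cycle j k (u, v)"
  have dist: "distinct [j, k, u, v]" using switchings_distinct[OF uv jk] by blast
  then have dist': "distinct [j, u, k, v]" "{j, u, k, v} = {j, k, u, v}" by auto
  have GE: "G \<subseteq> all_edges n" using G by (auto simp: C_def history_class_def graphs_with_degrees_def)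
  have S: "S \<subseteq> all_edges n - T" using uv jk by (auto simp: S_def four_cycle_def switchings_def)
  have "S \<inter> X = {{j, k}, {u, v}}" "S - X = {{j, u}, {k, v}}"
    using uv jk by (auto simp: S_def four_cycle_def switchings_def)
  moreover have "vertex_degree {{j, k}, {u, v}} x = vertex_degree {{j, u}, {k, v}} x" for x
    by (simp only: vertex_degree_disjoint_pair[OF dist] vertex_degree_disjoint_pair[OF dist'(1)]
      dist'(2))
  ultimately have "vertex_degree (S \<inter> X) x = vertex_degree (S - X) x" for x by simp
  then have "vertex_degree (S \<inter> G) x = vertex_degree (S - G) x" for x
    using X by (elim disjE) (simp_all add: Diff_eq)
  then have "vertex_degree (sym_diff G S) x = vertex_degree G x" for x
    using GE S by (intro vertex_degree_sym_diff) (auto intro: finite_graph finite_subset)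
  moreover have "sym_diff G S \<inter> T = G \<inter> T" using S by auto
  ultimately show ?thesis
    using G GE S unfolding C_def history_class_def graphs_with_degrees_def S_def[symmetric] by auto
qed

lemma switch_in_switchings:
  assumes "uv \<in> switchings U X j k" "{j, k} \<in> X"
  shows "uv \<in> switchings U (- sym_diff X (four_cycle j k uv)) j k"
    "{j, k} \<notin> sym_diff X (four_cycle j k uv)"
  using assms by (auto simp: switchings_def four_cycle_def)

lemma switching_double_count:
  fixes d g T n
  defines "C \<equiv> history_class (graphs_with_degrees n d) T g" and "U \<equiv> all_edges n - T"
  assumes jk: "{j, k} \<in> U"
  shows "(\<Sum>G | G \<in> C \<and> {j, k} \<in> G. card (switchings U G j k)) =
    (\<Sum>G | G \<in> C \<and> {j, k} \<notin> G. card (switchings U (- G) j k))"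
proof -
  define removing where "removing = (SIGMA G:{G \<in> C. {j, k} \<in> G}. switchings U G j k)"
  define creating where "creating = (SIGMA G:{G \<in> C. {j, k} \<notin> G}. switchings U (- G) j k)"
  define switch where "switch = (\<lambda>(G, uv). (sym_diff G (four_cycle j k uv), uv))"
  have compl: "- sym_diff (- G) S = sym_diff G S" for G S :: graph by auto
  have involution: "switch (switch x) = x" for x
    by (cases x) (auto simp: switch_def)
  have "switch (G, uv) \<in> creating" if "G \<in> C" "{j, k} \<in> G" "uv \<in> switchings U G j k" for G uv
    using that switch_in_class[of G n d T g G "fst uv" "snd uv" j k]
      switch_in_switchings[of uv U G j k] jk
    by (simp add: creating_def switch_def C_def U_def)
  moreover have "switch (G, uv) \<in> removing"
    if "G \<in> C" "{j, k} \<notin> G" "uv \<in> switchings U (- G) j k" for G uv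
    using that switch_in_class[of G n d T g "- G" "fst uv" "snd uv" j k] jk
      switch_in_switchings[of uv U "- G" j k] compl[of G "four_cycle j k uv"]
    by (simp add: removing_def switch_def C_def U_def)
  ultimately have "bij_betw switch removing creating"
    by (intro bij_betwI[where g = switch]) (auto simp: involution removing_def creating_def)
  then have "card removing = card creating" by (rule bij_betw_same_card)
  moreover have "finite C"
    unfolding C_def history_class_def using finite_graphs_with_degrees by simp
  moreover have "finite (switchings U G j k)" for G
    unfolding U_def by (rule finite_switchings[where n = n]) blast
  ultimately show ?thesis unfolding removing_def creating_def by simp
qed

lemma double_count_le:
  fixes f b :: "'a \<Rightarrow> real"
  assumes "finite A" "finite B" "A \<inter> B = {}"
    and eq: "(\<Sum>x\<in>A. f x) = (\<Sum>x\<in>B. b x)"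
    and bad: "real (card ((A \<union> B) \<inter> bad)) \<le> \<eta> * real (card (A \<union> B))"
    and lo: "\<And>x. x \<in> B - bad \<Longrightarrow> lo \<le> b x" and b0: "\<And>x. x \<in> B \<Longrightarrow> 0 \<le> b x"
    and hi: "\<And>x. x \<in> A - bad \<Longrightarrow> f x \<le> hi" and fM: "\<And>x. x \<in> A \<Longrightarrow> f x \<le> M"
    and "0 \<le> hi" "lo \<le> M" "0 \<le> M"
  shows "real (card B) * lo \<le> real (card A) * hi + \<eta> * real (card (A \<union> B)) * M"
proof -
  have "real (card B) * lo = real (card (B - bad)) * lo + real (card (B \<inter> bad)) * lo"
    using assms(2) by (metis Diff_Int_distrib2 card_Int_Diff distrib_right of_nat_add add.commute)
  also have "\<dots> \<le> (\<Sum>x\<in>B - bad. b x) + real (card (B \<inter> bad)) * M"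
    using sum_mono[of "B - bad" "\<lambda>_. lo" b] lo assms by (intro add_mono mult_left_mono) auto
  also have "(\<Sum>x\<in>B - bad. b x) \<le> (\<Sum>x\<in>B. b x)"
    using assms(2) b0 by (intro sum_mono2) auto
  also have "(\<Sum>x\<in>B. b x) = (\<Sum>x\<in>A - bad. f x) + (\<Sum>x\<in>A \<inter> bad. f x)"
    using eq assms(1) by (metis add.commute sum.Int_Diff)
  also have "(\<Sum>x\<in>A - bad. f x) \<le> (\<Sum>x\<in>A - bad. hi)"
    using hi by (intro sum_mono) auto
  also have "\<dots> \<le> real (card A) * hi"
    using assms by (auto intro!: mult_right_mono card_mono)
  also have "(\<Sum>x\<in>A \<inter> bad. f x) \<le> (\<Sum>x\<in>A \<inter> bad. M)"
    using fM by (intro sum_mono) auto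
  finally have "real (card B) * lo \<le> real (card A) * hi +
      (real (card (A \<inter> bad)) + real (card (B \<inter> bad))) * M"
    by (simp add: algebra_simps)
  also have "real (card (A \<inter> bad)) + real (card (B \<inter> bad)) = real (card ((A \<union> B) \<inter> bad))"
    using assms(1-3) by (subst Int_Un_distrib2, subst card_Un_disjoint) auto
  also have "real (card A) * hi + real (card ((A \<union> B) \<inter> bad)) * M \<le>
      real (card A) * hi + \<eta> * real (card (A \<union> B)) * M"
    using bad assms by (intro add_left_mono mult_right_mono) auto
  finally show ?thesis .
qed

lemma fraction_deficit_le_if_balanced:
  fixes a p \<sigma> \<tau> \<epsilon> \<eta> :: real
  assumes balance: "(1 - a) * (p\<^sup>2 * (1 - p) * \<tau> - \<epsilon>) \<le> a * (p * (1 - p)\<^sup>2 * \<sigma> + \<epsilon>) + \<eta>"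
    and "a \<in> {0..1}" "p \<in> {0..1}" "\<tau> \<le> \<sigma>"
  shows "p * (1 - p) * \<sigma> * (p - a) \<le> \<epsilon> + \<eta> + (\<sigma> - \<tau>)"
proof -
  define x where "x = (1 - a) * (p\<^sup>2 * (1 - p) * \<tau> - \<epsilon>)"
  define y where "y = a * (p * (1 - p)\<^sup>2 * \<sigma> + \<epsilon>)"
  define z where "z = (1 - a) * p\<^sup>2 * (1 - p) * (\<sigma> - \<tau>)"
  have "(1 - a) * p\<^sup>2 * (1 - p) \<le> 1"
    using assms by (intro mult_le_one) (auto simp: power_le_one)
  then have "z \<le> \<sigma> - \<tau>"
    using assms mult_right_mono[of "(1 - a) * p\<^sup>2 * (1 - p)" 1 "\<sigma> - \<tau>"] by (simp add: z_def)
  moreover have "p * (1 - p) * \<sigma> * (p - a) = x - y + \<epsilon> + z"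
    by (simp add: x_def y_def z_def algebra_simps power2_eq_square)
  ultimately show ?thesis using balance unfolding x_def[symmetric] y_def[symmetric] by linarith
qed

lemma double_count_fraction_deficit_le:
  fixes f b :: "'a \<Rightarrow> real" and p \<sigma> \<tau> \<epsilon> \<eta> :: real
  assumes fin: "finite A" "finite B" "A \<inter> B = {}" and ne: "A \<union> B \<noteq> {}"
    and eq: "(\<Sum>x\<in>A. f x) = (\<Sum>x\<in>B. b x)"
    and bad: "real (card ((A \<union> B) \<inter> bad)) \<le> \<eta> * real (card (A \<union> B))"
    and b_lo: "\<And>x. x \<in> B - bad \<Longrightarrow> p\<^sup>2 * (1 - p) * \<tau> - \<epsilon> \<le> b x" and b0: "\<And>x. x \<in> B \<Longrightarrow> 0 \<le> b x"
    and f_hi: "\<And>x. x \<in> A - bad \<Longrightarrow> f x \<le> p * (1 - p)\<^sup>2 * \<sigma> + \<epsilon>" and f1: "\<And>x. x \<in> A \<Longrightarrow> f x \<le> 1"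
    and p: "p \<in> {0..1}" and levels: "0 \<le> \<tau>" "\<tau> \<le> \<sigma>" "\<sigma> \<le> 1" and \<epsilon>: "0 \<le> \<epsilon>"
  shows "p * (1 - p) * \<sigma> * (p - real (card A) / real (card (A \<union> B))) \<le> \<epsilon> + \<eta> + (\<sigma> - \<tau>)"
proof -
  define N where "N = real (card (A \<union> B))"
  define a where "a = real (card A) / N"
  have N: "N > 0" using fin ne by (simp add: N_def card_gt_0_iff)
  have "N = real (card A) + real (card B)" using fin by (simp add: N_def card_Un_disjoint)
  then have a: "real (card A) = a * N" "real (card B) = (1 - a) * N" "a \<in> {0..1}"
    using N by (auto simp: a_def field_simps)
  have "p\<^sup>2 * (1 - p) * \<tau> \<le> 1"
    using p levels by (auto intro!: mult_le_one simp: power_le_one)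
  then have "real (card B) * (p\<^sup>2 * (1 - p) * \<tau> - \<epsilon>) \<le>
      real (card A) * (p * (1 - p)\<^sup>2 * \<sigma> + \<epsilon>) + \<eta> * N * 1"
    unfolding N_def using p levels \<epsilon>
    by (intro double_count_le[OF fin eq bad b_lo b0 f_hi f1]) auto
  then have "((1 - a) * (p\<^sup>2 * (1 - p) * \<tau> - \<epsilon>)) * N \<le> (a * (p * (1 - p)\<^sup>2 * \<sigma> + \<epsilon>) + \<eta>) * N"
    unfolding a by (simp add: algebra_simps)
  then have "(1 - a) * (p\<^sup>2 * (1 - p) * \<tau> - \<epsilon>) \<le> a * (p * (1 - p)\<^sup>2 * \<sigma> + \<epsilon>) + \<eta>"
    using N by (simp add: mult_le_cancel_right)
  then show ?thesis
    using fraction_deficit_le_if_balanced a(3) p levels(2) unfolding a_def N_def by blast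
qed

definition switching_regular ::
  "nat \<Rightarrow> real \<Rightarrow> real \<Rightarrow> real \<Rightarrow> graph \<Rightarrow> graph \<Rightarrow> nat \<Rightarrow> nat \<Rightarrow> bool"
where
  "switching_regular n p s \<epsilon> U G j k \<longleftrightarrow>
     \<bar>real (card (switchings U G j k)) - p * (1 - p)\<^sup>2 * s * (real n)\<^sup>2\<bar> \<le> \<epsilon> * (real n)\<^sup>2 \<and>
     \<bar>real (card (switchings U (- G) j k)) - (1 - p) * p\<^sup>2 * s * (real n)\<^sup>2\<bar> \<le> \<epsilon> * (real n)\<^sup>2"

text \<open>The numbers of switchings are monotone in the set \<open>U\<close> of unexposed pairs, so it is enough to
  control them for two sets \<open>Ulo\<close> and \<open>Uhi\<close> around \<open>U\<close>.\<close>

lemma switching_regular_card_between: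
  assumes U: "Ulo \<subseteq> U" "U \<subseteq> Uhi" "Uhi \<subseteq> all_edges n" and n: "0 < n"
    and lo: "switching_regular n p \<tau> \<epsilon> Ulo G j k" and hi: "switching_regular n p \<sigma> \<epsilon> Uhi G j k"
  shows "real (card (switchings U G j k)) / (real n)\<^sup>2 \<in>
      {p * (1 - p)\<^sup>2 * \<tau> - \<epsilon>..p * (1 - p)\<^sup>2 * \<sigma> + \<epsilon>}"
    and "real (card (switchings U (- G) j k)) / (real n)\<^sup>2 \<in>
      {(1 - p) * p\<^sup>2 * \<tau> - \<epsilon>..(1 - p) * p\<^sup>2 * \<sigma> + \<epsilon>}"
proof -
  have mono: "real (card (switchings Ulo X j k)) \<le> real (card (switchings U X j k))"
    "real (card (switchings U X j k)) \<le> real (card (switchings Uhi X j k))" for X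
    using U by (auto intro!: card_mono finite_switchings[of _ n] switchings_mono)
  have between: "real (card (switchings U X j k)) / (real n)\<^sup>2 \<in> {w * \<tau> - \<epsilon>..w * \<sigma> + \<epsilon>}"
    if "\<bar>real (card (switchings Ulo X j k)) - w * \<tau> * (real n)\<^sup>2\<bar> \<le> \<epsilon> * (real n)\<^sup>2"
      "\<bar>real (card (switchings Uhi X j k)) - w * \<sigma> * (real n)\<^sup>2\<bar> \<le> \<epsilon> * (real n)\<^sup>2" for X w
  proof -
    have "(w * \<tau> - \<epsilon>) * (real n)\<^sup>2 \<le> real (card (switchings U X j k))"
      "real (card (switchings U X j k)) \<le> (w * \<sigma> + \<epsilon>) * (real n)\<^sup>2"
      using that mono[of X] unfolding left_diff_distrib distrib_right by linarith+
    then show ?thesis using n by (simp add: pos_le_divide_eq pos_divide_le_eq)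
  qed
  show "real (card (switchings U G j k)) / (real n)\<^sup>2 \<in>
      {p * (1 - p)\<^sup>2 * \<tau> - \<epsilon>..p * (1 - p)\<^sup>2 * \<sigma> + \<epsilon>}"
    "real (card (switchings U (- G) j k)) / (real n)\<^sup>2 \<in>
      {(1 - p) * p\<^sup>2 * \<tau> - \<epsilon>..(1 - p) * p\<^sup>2 * \<sigma> + \<epsilon>}"
    by (rule between; use lo hi in \<open>simp add: switching_regular_def\<close>)+
qed

lemma member_frequency_switching_regular:
  fixes d g T n
  defines "C \<equiv> history_class (graphs_with_degrees n d) T g" and "U \<equiv> all_edges n - T"
  assumes jk: "{j, k} \<in> U" and C: "C \<noteq> {}" and n: "n > 0"
    and U: "Ulo \<subseteq> U" "U \<subseteq> Uhi" "Uhi \<subseteq> all_edges n"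
    and bad: "real (card (C \<inter> bad)) \<le> \<eta> * real (card C)"
    and p: "p \<in> {0..1}" and levels: "0 \<le> \<tau>" "\<tau> \<le> \<sigma>" "\<sigma> \<le> 1" and \<epsilon>: "0 \<le> \<epsilon>"
    and lo: "\<And>G. G \<in> C - bad \<Longrightarrow> switching_regular n p \<tau> \<epsilon> Ulo G j k"
    and hi: "\<And>G. G \<in> C - bad \<Longrightarrow> switching_regular n p \<sigma> \<epsilon> Uhi G j k"
  shows "p * (1 - p) * \<sigma> * \<bar>member_frequency C {j, k} - p\<bar> \<le> \<epsilon> + \<eta> + (\<sigma> - \<tau>)"
proof -
  define A where "A = {G \<in> C. {j, k} \<in> G}"
  define B where "B = {G \<in> C. {j, k} \<notin> G}"
  define f where "f = (\<lambda>G. real (card (switchings U G j k)) / (real n)\<^sup>2)"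
  define b where "b = (\<lambda>G. real (card (switchings U (- G) j k)) / (real n)\<^sup>2)"
  have finC: "finite C"
    unfolding C_def history_class_def using finite_graphs_with_degrees by simp
  then have fin: "finite A" "finite B" "A \<inter> B = {}" and un: "A \<union> B = C" "B \<union> A = C"
    by (auto simp: A_def B_def)
  have eq: "(\<Sum>G\<in>A. f G) = (\<Sum>G\<in>B. b G)"
    using switching_double_count[of j k n T d g] jk
    by (simp add: A_def B_def f_def b_def C_def U_def flip: sum_divide_distrib of_nat_sum)
  have "real (card (switchings U X j k)) \<le> (real n)\<^sup>2" for X
    using card_switchings_le[of U n X j k] by (simp add: U_def flip: of_nat_power)
  then have unit: "0 \<le> f G" "f G \<le> 1" "0 \<le> b G" "b G \<le> 1" for G
    using n by (auto simp: f_def b_def divide_le_eq_1)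
  have range: "f G \<in> {p * (1 - p)\<^sup>2 * \<tau> - \<epsilon>..p * (1 - p)\<^sup>2 * \<sigma> + \<epsilon>}"
    "b G \<in> {(1 - p) * p\<^sup>2 * \<tau> - \<epsilon>..(1 - p) * p\<^sup>2 * \<sigma> + \<epsilon>}" if "G \<in> C - bad" for G
    using switching_regular_card_between[OF U n lo hi, OF that that] by (simp_all add: f_def b_def)
  have freq: "real (card A) / real (card C) = member_frequency C {j, k}"
    by (simp add: A_def member_frequency_def)
  have freq': "real (card B) / real (card C) = 1 - member_frequency C {j, k}"
    using member_frequency_mult_card(2)[OF finC, of "{j, k}"] finC C
    by (simp add: B_def divide_eq_eq mult.commute)
  have "p * (1 - p) * \<sigma> * (p - real (card A) / real (card (A \<union> B))) \<le> \<epsilon> + \<eta> + (\<sigma> - \<tau>)"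
    using C un bad range unit p levels \<epsilon>
    by (intro double_count_fraction_deficit_le[OF fin _ eq, where bad = bad])
       (auto simp: mult.commute)
  moreover have "(1 - p) * (1 - (1 - p)) * \<sigma> * ((1 - p) - real (card B) / real (card (B \<union> A))) \<le>
      \<epsilon> + \<eta> + (\<sigma> - \<tau>)"
    using C un bad range unit p levels \<epsilon> fin
    by (intro double_count_fraction_deficit_le[OF fin(2,1) _ _ eq[symmetric], where bad = bad])
       (auto simp: mult.commute)
  ultimately show ?thesis
    unfolding un freq freq' by (auto simp: abs_if mult.commute)
qed

section \<open>Repairing degree sequences\<close>

definition degree_deficit :: "nat \<Rightarrow> (nat \<Rightarrow> nat) \<Rightarrow> graph \<Rightarrow> nat" where
  "degree_deficit n d W = (\<Sum>j\<in>{1..n}. d j - vertex_degree W j)"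

lemma delete_excess:
  assumes "finite W" "finite V"
  obtains W' where "W' \<subseteq> W" "\<And>j. j \<in> V \<Longrightarrow> vertex_degree W' j \<le> d j"
    "card (W - W') \<le> (\<Sum>j\<in>V. vertex_degree W j - d j)"
proof -
  have "\<exists>F\<subseteq>{e \<in> W. j \<in> e}. card F = vertex_degree W j - d j" for j
    by (metis obtain_subset_with_card_n vertex_degree_def diff_le_self)
  then obtain F where F: "\<And>j. F j \<subseteq> {e \<in> W. j \<in> e}" "\<And>j. card (F j) = vertex_degree W j - d j"
    by metis
  define W' where "W' = W - (\<Union>j\<in>V. F j)"
  have "vertex_degree W' j \<le> d j" if "j \<in> V" for j
  proof -
    have "vertex_degree W' j \<le> card ({e \<in> W. j \<in> e} - F j)"
      unfolding vertex_degree_def W'_def using assms that by (intro card_mono) auto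
    also have "\<dots> = vertex_degree W j - (vertex_degree W j - d j)"
      using F[of j] assms
      by (subst card_Diff_subset) (auto simp: vertex_degree_def intro: finite_subset)
    finally show ?thesis by simp
  qed
  moreover have "card (W - W') \<le> (\<Sum>j\<in>V. vertex_degree W j - d j)"
  proof -
    have "card (W - W') \<le> card (\<Union>j\<in>V. F j)"
      unfolding W'_def using assms F by (intro card_mono) (auto intro: finite_subset[of _ W])
    also have "\<dots> \<le> (\<Sum>j\<in>V. card (F j))" using assms(2) by (rule card_UN_le)
    finally show ?thesis using F by simp
  qed
  ultimately show thesis using that[of W'] by (auto simp: W'_def)
qed

lemma sum_ge_two_obtains_units:
  fixes f :: "'a \<Rightarrow> nat"
  assumes "finite V" "2 \<le> sum f V"
  obtains v v' where "v \<in> V" "v' \<in> V" "0 < f v" "0 < f v'" "v = v' \<Longrightarrow> 2 \<le> f v"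
proof -
  obtain v where v: "v \<in> V" "0 < f v"
    using assms(2) by (metis neq0_conv not_numeral_le_zero sum.neutral)
  show thesis
  proof (cases "2 \<le> f v")
    case True
    then show thesis using that v by blast
  next
    case False
    then have "0 < sum f (V - {v})" using assms v by (simp add: sum.remove)
    then obtain v' where "v' \<in> V - {v}" "0 < f v'"
      by (metis neq0_conv sum.neutral)
    then show thesis using that v by blast
  qed
qed

lemma vertex_degree_rewire:
  assumes W: "finite W" "{w, w'} \<in> W" and "{v, w} \<notin> W" "{v', w'} \<notin> W"
    and ne: "w \<noteq> w'" "v \<noteq> w" "v' \<noteq> w'"
  shows "vertex_degree (insert {v, w} (insert {v', w'} (W - {{w, w'}}))) y =
    vertex_degree W y + of_bool (y = v) + of_bool (y = v')"
proof -
  define W0 where "W0 = W - {{w, w'}}"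
  have "{v, w} \<noteq> {v', w'}"
    using assms by (auto simp: doubleton_eq_iff insert_commute)
  then have fresh: "finite W0" "{v', w'} \<notin> W0" "{v, w} \<notin> insert {v', w'} W0"
    using assms by (auto simp: W0_def)
  have "vertex_degree W y = vertex_degree W0 y + of_bool (y \<in> {w, w'})"
    using vertex_degree_insert[of W0 "{w, w'}" y] W by (simp add: W0_def insert_absorb)
  moreover have "vertex_degree (insert {v, w} (insert {v', w'} W0)) y =
      vertex_degree W0 y + of_bool (y \<in> {v', w'}) + of_bool (y \<in> {v, w})"
    using vertex_degree_insert[of "insert {v', w'} W0" "{v, w}" y]
      vertex_degree_insert[of W0 "{v', w'}" y] fresh
    by (simp only: finite_insert not_False_eq_True)
  ultimately show ?thesis using ne unfolding W0_def by auto
qed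

text \<open>Two units of deficit, at \<open>v\<close> and \<open>v'\<close>, are removed by replacing an edge \<open>{w, w'}\<close> with
  \<open>{v, w}\<close> and \<open>{v', w'}\<close>, where \<open>w\<close> and \<open>w'\<close> are non-neighbours of \<open>v\<close> and \<open>v'\<close>.\<close>

lemma reduce_deficit:
  fixes x :: real
  assumes W: "W \<subseteq> all_edges n" and below: "\<And>j. j \<in> {1..n} \<Longrightarrow> vertex_degree W j \<le> d j"
    and deficit: "2 \<le> degree_deficit n d W"
    and room: "\<And>j. j \<in> {1..n} \<Longrightarrow> x \<le> real n - real (d j)"
    and edge: "\<And>A B. A \<subseteq> {1..n} \<Longrightarrow> B \<subseteq> {1..n} \<Longrightarrow> x \<le> real (card A) \<Longrightarrow> x \<le> real (card B) \<Longrightarrow>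
        0 < ecount W A B"
  obtains W' where "W' \<subseteq> all_edges n" "\<And>j. j \<in> {1..n} \<Longrightarrow> vertex_degree W' j \<le> d j"
    "degree_deficit n d W = degree_deficit n d W' + 2" "card (W - W') \<le> 1" "card (sym_diff W W') \<le> 3"
proof -
  define N where "N = neighbours (all_edges n - W)"
  obtain v v' where v: "v \<in> {1..n}" "v' \<in> {1..n}"
    "0 < d v - vertex_degree W v" "0 < d v' - vertex_degree W v'"
    "v = v' \<Longrightarrow> 2 \<le> d v - vertex_degree W v"
    using sum_ge_two_obtains_units[of "{1..n}" "\<lambda>j. d j - vertex_degree W j"] deficit
    by (auto simp: degree_deficit_def)
  have card_N: "x \<le> real (card (N v))" if "v \<in> {1..n}" "0 < d v - vertex_degree W v" for v
  proof -
    have "card (N v) + vertex_degree W v = n - 1"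
      unfolding N_def using vertex_degree_complement[OF W that(1)]
      by (subst vertex_degree_eq_card_neighbours[where n = n, symmetric]) auto
    then show ?thesis using room[OF that(1)] that by simp
  qed
  have "0 < ecount W (N v) (N v')"
    using card_N v neighbours_subset[of "all_edges n - W" n] by (intro edge) (auto simp: N_def)
  then have "{(w, w') \<in> N v \<times> N v'. {w, w'} \<in> W} \<noteq> {}"
    unfolding ecount_def by (metis card.empty less_irrefl)
  then obtain w w' where w: "{v, w} \<in> all_edges n - W" "{v', w'} \<in> all_edges n - W" "{w, w'} \<in> W"
    by (auto simp: N_def neighbours_def)
  then have "{v, w} \<in> all_edges n" "{v', w'} \<in> all_edges n" by blast+
  moreover have "{w, w'} \<in> all_edges n" using W w(3) by blast
  ultimately have ne: "w \<noteq> w'" "v \<noteq> w" "v' \<noteq> w'" by (auto simp: doubleton_in_all_edges)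
  define W' where "W' = insert {v, w} (insert {v', w'} (W - {{w, w'}}))"
  have degree: "vertex_degree W' y = vertex_degree W y + of_bool (y = v) + of_bool (y = v')" for y
    unfolding W'_def using w finite_graph[OF W] ne by (intro vertex_degree_rewire) auto
  have unit: "d y - vertex_degree W y =
      (d y - vertex_degree W' y) + of_bool (y = v) + of_bool (y = v')"
    and below': "vertex_degree W' y \<le> d y" if "y \<in> {1..n}" for y
    using v below[OF that] unfolding degree by auto
  have "degree_deficit n d W = degree_deficit n d W' + 2"
    unfolding degree_deficit_def using v unit by (simp add: sum.distrib of_bool_def)
  moreover have "W' \<subseteq> all_edges n" using W w by (auto simp: W'_def)
  moreover have "card (W - W') \<le> card {{w, w'}}" by (intro card_mono) (auto simp: W'_def)
  moreover have "card (sym_diff W W') \<le> card (set [{w, w'}, {v, w}, {v', w'}])"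
    by (intro card_mono) (auto simp: W'_def)
  moreover have "card (set [{w, w'}, {v, w}, {v', w'}]) \<le> 3"
    using card_length[of "[{w, w'}, {v, w}, {v', w'}]"] by simp
  ultimately show thesis using that[of W'] below' by simp
qed

lemma card_sym_diff_triangle:
  assumes "finite A" "finite B" "finite C"
  shows "card (sym_diff A C) \<le> card (sym_diff A B) + card (sym_diff B C)"
proof -
  have "card (sym_diff A C) \<le> card (sym_diff A B \<union> sym_diff B C)"
    using assms by (intro card_mono) auto
  also have "\<dots> \<le> card (sym_diff A B) + card (sym_diff B C)" by (rule card_Un_le)
  finally show ?thesis .
qed

lemma repair_deficit:
  fixes x :: real
  assumes "W \<subseteq> all_edges n" "\<And>j. j \<in> {1..n} \<Longrightarrow> vertex_degree W j \<le> d j"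
    "degree_deficit n d W = 2 * k"
    "\<And>j. j \<in> {1..n} \<Longrightarrow> x \<le> real n - real (d j)"
    "\<And>A B. A \<subseteq> {1..n} \<Longrightarrow> B \<subseteq> {1..n} \<Longrightarrow> x \<le> real (card A) \<Longrightarrow> x \<le> real (card B) \<Longrightarrow> 2 * k < ecount W A B"
  shows "\<exists>H\<in>graphs_with_degrees n d. card (sym_diff W H) \<le> 3 * k"
  using assms
proof (induction k arbitrary: W)
  case 0
  then have "W \<in> graphs_with_degrees n d"
    by (fastforce simp: graphs_with_degrees_def degree_deficit_def intro: antisym)
  then show ?case by force
next
  case (Suc k)
  have edge: "0 < ecount W A B"
    if "A \<subseteq> {1..n}" "B \<subseteq> {1..n}" "x \<le> real (card A)" "x \<le> real (card B)" for A B
    using Suc.prems(5)[OF that] by simp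
  obtain W' where W': "W' \<subseteq> all_edges n" "\<And>j. j \<in> {1..n} \<Longrightarrow> vertex_degree W' j \<le> d j"
    "degree_deficit n d W = degree_deficit n d W' + 2" "card (W - W') \<le> 1" "card (sym_diff W W') \<le> 3"
    using reduce_deficit[OF Suc.prems(1,2) _ Suc.prems(4) edge] Suc.prems(3) by auto
  have "\<exists>H\<in>graphs_with_degrees n d. card (sym_diff W' H) \<le> 3 * k"
  proof (rule Suc.IH[OF W'(1,2) _ Suc.prems(4)])
    show "degree_deficit n d W' = 2 * k" using W'(3) Suc.prems(3) by simp
    show "2 * k < ecount W' A B"
      if "A \<subseteq> {1..n}" "B \<subseteq> {1..n}" "x \<le> real (card A)" "x \<le> real (card B)" for A B
    proof -
      have "ecount W A B \<le> ecount W' A B + 2 * card (W - W')"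
        using that Suc.prems(1) by (intro ecount_le_ecount_plus_card_diff) (auto intro: finite_subset)
      then show ?thesis using Suc.prems(5)[OF that] W'(4) by simp
    qed
  qed
  then obtain H where H: "H \<in> graphs_with_degrees n d" "card (sym_diff W' H) \<le> 3 * k" by blast
  then have "card (sym_diff W H) \<le> card (sym_diff W W') + card (sym_diff W' H)"
    using Suc.prems(1) W'(1)
    by (intro card_sym_diff_triangle finite_graph) (auto simp: graphs_with_degrees_def)
  then show ?case using H W'(5) by (intro bexI[of _ H]) auto
qed

section \<open>Cut-regular graphs\<close>

definition cut_regular :: "nat \<Rightarrow> real \<Rightarrow> real \<Rightarrow> graph \<Rightarrow> bool" where
  "cut_regular n p \<epsilon> W \<longleftrightarrow> (\<forall>A\<subseteq>{1..n}. \<forall>B\<subseteq>{1..n}.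
     \<bar>real (ecount W A B) - p * real (card A) * real (card B)\<bar> \<le> \<epsilon> * (real n)\<^sup>2)"

definition degrees_within :: "nat \<Rightarrow> real \<Rightarrow> real \<Rightarrow> (nat \<Rightarrow> nat) \<Rightarrow> bool" where
  "degrees_within n p \<delta> d \<longleftrightarrow> (\<forall>j\<in>{1..n}. (p - \<delta>) * real n \<le> real (d j) \<and> real (d j) \<le> p * real n)"

lemma degrees_within_mono:
  assumes "degrees_within n p \<delta> d" "\<delta> \<le> \<delta>'"
  shows "degrees_within n p \<delta>' d"
proof -
  have "(p - \<delta>') * real n \<le> (p - \<delta>) * real n" using assms(2) by (intro mult_right_mono) auto
  then show ?thesis using assms(1) unfolding degrees_within_def by (meson order_trans)
qed

definition eventually_near_regular :: "real \<Rightarrow> (nat \<Rightarrow> real \<Rightarrow> (nat \<Rightarrow> nat) \<Rightarrow> bool) \<Rightarrow> bool" where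
  "eventually_near_regular c P \<longleftrightarrow> (\<exists>\<delta>>0. \<forall>\<^sub>F n in sequentially. \<forall>p d. p \<in> {c..1 - c} \<longrightarrow>
     degrees_within n p \<delta> d \<longrightarrow> graphs_with_degrees n d \<noteq> {} \<longrightarrow> P n p d)"

lemma eventually_near_regularI:
  assumes "0 < \<delta>" "\<forall>\<^sub>F n in sequentially. R n"
    and "\<And>n p d. R n \<Longrightarrow> p \<in> {c..1 - c} \<Longrightarrow> degrees_within n p \<delta> d \<Longrightarrow>
      graphs_with_degrees n d \<noteq> {} \<Longrightarrow> P n p d"
  shows "eventually_near_regular c P"
  unfolding eventually_near_regular_def
proof (intro exI conjI)
  show "\<forall>\<^sub>F n in sequentially. \<forall>p d. p \<in> {c..1 - c} \<longrightarrow> degrees_within n p \<delta> d \<longrightarrow>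
      graphs_with_degrees n d \<noteq> {} \<longrightarrow> P n p d"
    using assms(2) by (rule eventually_mono) (use assms(3) in simp)
qed (rule assms(1))

lemma eventually_near_regular_mono:
  assumes P: "eventually_near_regular c P" and \<delta>: "0 < \<delta>" and R: "\<forall>\<^sub>F n in sequentially. R n"
    and imp: "\<And>n p d. R n \<Longrightarrow> p \<in> {c..1 - c} \<Longrightarrow> degrees_within n p \<delta> d \<Longrightarrow>
      graphs_with_degrees n d \<noteq> {} \<Longrightarrow> P n p d \<Longrightarrow> Q n p d"
  shows "eventually_near_regular c Q"
proof -
  obtain \<delta>' where \<delta>': "0 < \<delta>'" and ev: "\<forall>\<^sub>F n in sequentially. \<forall>p d. p \<in> {c..1 - c} \<longrightarrow>
      degrees_within n p \<delta>' d \<longrightarrow> graphs_with_degrees n d \<noteq> {} \<longrightarrow> P n p d"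
    using P unfolding eventually_near_regular_def by blast
  show ?thesis
  proof (rule eventually_near_regularI[OF _ eventually_conj[OF R ev]])
    show "0 < min \<delta> \<delta>'" using \<delta> \<delta>' by simp
    show "Q n p d" if "R n \<and> (\<forall>p d. p \<in> {c..1 - c} \<longrightarrow> degrees_within n p \<delta>' d \<longrightarrow>
        graphs_with_degrees n d \<noteq> {} \<longrightarrow> P n p d)" "p \<in> {c..1 - c}"
      "degrees_within n p (min \<delta> \<delta>') d" "graphs_with_degrees n d \<noteq> {}" for n p d
      using that imp degrees_within_mono[OF that(3)] by simp
  qed
qed

lemma cut_regularD:
  "cut_regular n p \<epsilon> W \<Longrightarrow> A \<subseteq> {1..n} \<Longrightarrow> B \<subseteq> {1..n} \<Longrightarrow>
   \<bar>real (ecount W A B) - p * real (card A) * real (card B)\<bar> \<le> \<epsilon> * (real n)\<^sup>2"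
  by (simp add: cut_regular_def)

lemma cut_regular_complement:
  assumes cut: "cut_regular n p \<epsilon> G" and G: "G \<subseteq> all_edges n" and n: "real n \<le> \<epsilon> * (real n)\<^sup>2"
  shows "cut_regular n (1 - p) (2 * \<epsilon>) (all_edges n - G)"
  unfolding cut_regular_def
proof (intro allI impI)
  fix A B assume AB: "A \<subseteq> {1..n}" "B \<subseteq> {1..n}"
  then have "ecount (all_edges n) A B = ecount (all_edges n \<inter> G) A B + ecount (all_edges n - G) A B"
    by (intro ecount_Int_Diff) (auto intro: finite_subset)
  then have "real (ecount (all_edges n - G) A B) =
      real (ecount (all_edges n) A B) - real (ecount G A B)"
    using G by (simp add: Int_absorb1)
  moreover have "(1 - p) * real (card A) * real (card B) =
      real (card A) * real (card B) - p * real (card A) * real (card B)"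
    by (simp add: algebra_simps)
  ultimately show "\<bar>real (ecount (all_edges n - G) A B) - (1 - p) * real (card A) * real (card B)\<bar>
      \<le> 2 * \<epsilon> * (real n)\<^sup>2"
    using ecount_all_edges[OF AB] cut_regularD[OF cut AB] n by linarith
qed

lemma cut_regular_excess_le:
  assumes W: "W \<subseteq> all_edges n" and cut: "cut_regular n p \<epsilon> W" and d: "degrees_within n p \<epsilon> d"
    and \<epsilon>: "0 \<le> \<epsilon>"
  shows "real (\<Sum>j\<in>{1..n}. vertex_degree W j - d j) \<le> 2 * \<epsilon> * (real n)\<^sup>2"
proof -
  define A where "A = {j \<in> {1..n}. d j < vertex_degree W j}"
  have A: "A \<subseteq> {1..n}" by (auto simp: A_def)
  have "real (\<Sum>j\<in>{1..n}. vertex_degree W j - d j) = real (\<Sum>j\<in>A. vertex_degree W j - d j)"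
    by (intro arg_cong[where f = real] sum.mono_neutral_right) (auto simp: A_def)
  also have "\<dots> = (\<Sum>j\<in>A. real (vertex_degree W j)) - (\<Sum>j\<in>A. real (d j))"
    unfolding of_nat_sum sum_subtractf[symmetric] by (rule sum.cong) (auto simp: A_def)
  also have "(\<Sum>j\<in>A. real (vertex_degree W j)) = real (ecount W A {1..n})"
    using sum_vertex_degree[OF W, of A] A by (simp add: finite_subset flip: of_nat_sum)
  also have "real (ecount W A {1..n}) - (\<Sum>j\<in>A. real (d j)) \<le>
      (p * real (card A) * real n + \<epsilon> * (real n)\<^sup>2) - (\<Sum>j\<in>A. (p - \<epsilon>) * real n)"
    using cut_regularD[OF cut A order_refl] d A
    by (intro diff_mono sum_mono) (auto simp: degrees_within_def)
  also have "\<dots> = \<epsilon> * (real n)\<^sup>2 + \<epsilon> * real n * real (card A)"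
    by (simp add: algebra_simps)
  also have "\<epsilon> * real n * real (card A) \<le> \<epsilon> * real n * real n"
    using card_vertex_subset_le[OF A] \<epsilon> by (intro mult_left_mono) auto
  finally show ?thesis by (simp add: power2_eq_square)
qed

lemma degree_deficit_eq:
  assumes W: "W \<subseteq> all_edges n" and below: "\<And>j. j \<in> {1..n} \<Longrightarrow> vertex_degree W j \<le> d j"
  shows "degree_deficit n d W + 2 * card W = (\<Sum>j\<in>{1..n}. d j)"
proof -
  have "degree_deficit n d W + (\<Sum>j\<in>{1..n}. vertex_degree W j) = (\<Sum>j\<in>{1..n}. d j)"
    unfolding degree_deficit_def sum.distrib[symmetric] by (rule sum.cong) (auto simp: below)
  then show ?thesis using handshake[OF W] by simp
qed

lemma cut_regular_deficit_le:
  assumes W: "W \<subseteq> all_edges n" and cut: "cut_regular n p \<epsilon> W" and d: "degrees_within n p \<delta> d"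
    and W': "W' \<subseteq> W" and below: "\<And>j. j \<in> {1..n} \<Longrightarrow> vertex_degree W' j \<le> d j"
  shows "real (degree_deficit n d W') \<le> \<epsilon> * (real n)\<^sup>2 + 2 * real (card (W - W'))"
proof -
  have "W' \<subseteq> all_edges n" using W W' by blast
  note degree_deficit_eq[OF this below]
  moreover have "card W = card W' + card (W - W')"
    using finite_graph[OF W] W'
    by (metis card_Diff_subset card_mono finite_subset le_add_diff_inverse)
  moreover have "real (\<Sum>j\<in>{1..n}. d j) \<le> p * (real n)\<^sup>2"
    using sum_mono[of "{1..n}" "\<lambda>j. real (d j)" "\<lambda>_. p * real n"] d
    by (simp add: degrees_within_def power2_eq_square algebra_simps)
  moreover have "p * (real n)\<^sup>2 - \<epsilon> * (real n)\<^sup>2 \<le> 2 * real (card W)"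
    using cut_regularD[OF cut order_refl order_refl] ecount_full[OF W]
    by (simp add: power2_eq_square algebra_simps)
  ultimately show ?thesis by linarith
qed

lemma cut_regular_ecount_ge:
  assumes cut: "cut_regular n p \<epsilon> W" and AB: "A \<subseteq> {1..n}" "B \<subseteq> {1..n}"
    and c: "0 \<le> c" "c \<le> p" "c * real n \<le> real (card A)" "c * real n \<le> real (card B)"
  shows "(c ^ 3 - \<epsilon>) * (real n)\<^sup>2 \<le> real (ecount W A B)"
proof -
  have "c * (c * real n) * (c * real n) \<le> p * real (card A) * real (card B)"
    using c by (intro mult_mono) auto
  then show ?thesis
    using cut_regularD[OF cut AB] by (simp add: power2_eq_square power3_eq_cube algebra_simps)
qed

lemma cut_regular_near_degree_graph:
  assumes W: "W \<subseteq> all_edges n" and cut: "cut_regular n p \<epsilon> W" and d: "degrees_within n p \<epsilon> d"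
    and ev: "even (\<Sum>j\<in>{1..n}. d j)"
    and p: "p \<in> {c..1 - c}" "0 < c" and \<epsilon>: "0 < \<epsilon>" "10 * \<epsilon> < c ^ 3" and n: "0 < n"
  shows "\<exists>H\<in>graphs_with_degrees n d. real (card (sym_diff W H)) \<le> 10 * \<epsilon> * (real n)\<^sup>2"
proof -
  obtain W' where W': "W' \<subseteq> W" and below: "\<And>j. j \<in> {1..n} \<Longrightarrow> vertex_degree W' j \<le> d j"
    and "card (W - W') \<le> (\<Sum>j\<in>{1..n}. vertex_degree W j - d j)"
    using delete_excess[OF finite_graph[OF W], of "{1..n}" d] by auto
  then have deleted: "real (card (W - W')) \<le> 2 * \<epsilon> * (real n)\<^sup>2"
    using cut_regular_excess_le[OF W cut d] \<epsilon> by (meson less_imp_le of_nat_mono order_trans)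
  have W'E: "W' \<subseteq> all_edges n" using W' W by blast
  have "even (degree_deficit n d W')"
    using degree_deficit_eq[OF W'E below] ev by (metis dvd_triv_left even_add)
  then obtain k where k: "degree_deficit n d W' = 2 * k" by blast
  have k_le: "2 * real k \<le> 5 * \<epsilon> * (real n)\<^sup>2"
    using cut_regular_deficit_le[OF W cut d W' below] deleted by (simp add: k)
  have "\<exists>H\<in>graphs_with_degrees n d. card (sym_diff W' H) \<le> 3 * k"
  proof (rule repair_deficit[OF W'E below k, where x = "c * real n"])
    show "c * real n \<le> real n - real (d j)" if "j \<in> {1..n}" for j
    proof -
      have "p * real n \<le> (1 - c) * real n" using p by (intro mult_right_mono) auto
      moreover have "real (d j) \<le> p * real n" using d that by (simp add: degrees_within_def)
      ultimately show ?thesis by (simp add: algebra_simps)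
    qed
    show "2 * k < ecount W' A B"
      if AB: "A \<subseteq> {1..n}" "B \<subseteq> {1..n}"
        and "c * real n \<le> real (card A)" "c * real n \<le> real (card B)" for A B
    proof -
      have "(c ^ 3 - \<epsilon>) * (real n)\<^sup>2 \<le> real (ecount W A B)"
        using that p by (intro cut_regular_ecount_ge[OF cut AB]) auto
      moreover have "ecount W A B \<le> ecount W' A B + 2 * card (W - W')"
        using AB W by (intro ecount_le_ecount_plus_card_diff) (auto intro: finite_subset)
      moreover have "10 * \<epsilon> * (real n)\<^sup>2 < c ^ 3 * (real n)\<^sup>2"
        using \<epsilon> n by (intro mult_strict_right_mono) auto
      ultimately have "2 * real k < real (ecount W' A B)"
        using deleted k_le unfolding left_diff_distrib by linarith
      then show ?thesis by simp
    qed
  qed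
  then obtain H where H: "H \<in> graphs_with_degrees n d" "card (sym_diff W' H) \<le> 3 * k" by blast
  have "card (sym_diff W H) \<le> card (sym_diff W W') + card (sym_diff W' H)"
    using H finite_graph W W'E by (intro card_sym_diff_triangle) (auto simp: graphs_with_degrees_def)
  also have "sym_diff W W' = W - W'" using W' by blast
  finally have "real (card (sym_diff W H)) \<le> 10 * \<epsilon> * (real n)\<^sup>2"
    using H(2) deleted k_le by linarith
  then show ?thesis using H(1) by blast
qed

section \<open>Concentration of edge counts\<close>

definition sample_regular :: "nat \<Rightarrow> real \<Rightarrow> real \<Rightarrow> graph \<Rightarrow> graph \<Rightarrow> bool" where
  "sample_regular n r \<epsilon> E R \<longleftrightarrow>
     (\<forall>A\<subseteq>{1..n}. \<forall>B\<subseteq>{1..n}. \<bar>real (ecount (E \<inter> R) A B) - r * real (ecount E A B)\<bar> \<le> \<epsilon> * (real n)\<^sup>2) \<and>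
     (\<forall>j\<in>{1..n}. \<bar>real (vertex_degree (E \<inter> R) j) - r * real (vertex_degree E j)\<bar> \<le> \<epsilon> * real n)"

definition cut_error :: "real \<Rightarrow> nat \<Rightarrow> real" where
  "cut_error \<epsilon> n = 2 * 4 ^ n * exp (- \<epsilon>\<^sup>2 * (real n)\<^sup>2)"

lemma ecount_concentration:
  assumes r: "r \<in> {0..1}" and fin: "finite A" "finite B"
    and M: "real (card A * card B) \<le> M" and t: "0 < t" and E: "E \<subseteq> all_edges n"
  shows "measure_pmf.prob (binomial_random_graph n r)
    {R. t \<le> \<bar>real (ecount (E \<inter> R) A B) - r * real (ecount E A B)\<bar>} \<le> 2 * exp (- t\<^sup>2 / M)"
proof -
  define c where "c = (\<lambda>e. card {(u, v) \<in> A \<times> B. {u, v} = e})"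
  define w where "w = (\<lambda>e. of_bool (e \<in> E) * real (c e))"
  have weight: "real (ecount (E \<inter> R) A B) = (\<Sum>e\<in>R. w e)" if "R \<subseteq> all_edges n" for R
  proof -
    have R: "finite R" using that by (rule finite_graph)
    then have "real (ecount (E \<inter> R) A B) = (\<Sum>e\<in>E \<inter> R. real (c e))"
      using fin by (simp add: ecount_eq_sum_edges c_def)
    also have "\<dots> = (\<Sum>e\<in>R. w e)"
      using R by (intro sum.mono_neutral_cong_left) (auto simp: w_def)
    finally show ?thesis .
  qed
  have total: "real (ecount E A B) = (\<Sum>e\<in>all_edges n. w e)"
    using weight[of "all_edges n"] E by (simp add: Int_absorb2)
  have "(\<Sum>e\<in>all_edges n. (w e)\<^sup>2) \<le> (\<Sum>e\<in>all_edges n. 2 * w e)"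
  proof (rule sum_mono)
    fix e assume "e \<in> all_edges n"
    then have "c e \<le> 2" unfolding c_def by (intro card_orientations_le) (auto simp: all_edges_def)
    then show "(w e)\<^sup>2 \<le> 2 * w e"
      by (auto simp: w_def power2_eq_square intro!: mult_right_mono)
  qed
  also have "\<dots> = 2 * real (ecount E A B)"
    by (simp add: total sum_distrib_left)
  also have "\<dots> \<le> 2 * M"
    using ecount_le[OF fin, of E] M by linarith
  finally have squares: "(\<Sum>e\<in>all_edges n. (w e)\<^sup>2) \<le> 2 * M" .
  have "measure_pmf.prob (binomial_random_graph n r)
      {R. t \<le> \<bar>real (ecount (E \<inter> R) A B) - r * real (ecount E A B)\<bar>} =
    measure_pmf.prob (random_subset (all_edges n) (\<lambda>_. r))
      {R. t \<le> \<bar>(\<Sum>e\<in>R. w e) - (\<Sum>e\<in>all_edges n. r * w e)\<bar>}"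
    unfolding binomial_random_graph_eq_random_subset total sum_distrib_left
    by (intro measure_pmf.finite_measure_eq_AE)
       (auto simp: AE_measure_pmf_iff weight dest!: set_pmf_random_subset)
  also have "\<dots> \<le> 2 * exp (- 2 * t\<^sup>2 / (2 * M))"
    using r squares t by (intro random_subset_sum_concentration) auto
  finally show ?thesis by simp
qed

lemma prob_ex_ecount_deviation:
  assumes r: "r \<in> {0..1}" and \<epsilon>: "0 < \<epsilon>" and n: "0 < n" and E: "E \<subseteq> all_edges n"
  shows "measure_pmf.prob (binomial_random_graph n r)
      {R. \<exists>A\<subseteq>{1..n}. \<exists>B\<subseteq>{1..n}.
        \<epsilon> * (real n)\<^sup>2 < \<bar>real (ecount (E \<inter> R) A B) - r * real (ecount E A B)\<bar>}
    \<le> cut_error \<epsilon> n" (is "measure_pmf.prob ?M ?S \<le> _")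
proof -
  define I where "I = Pow {1..n} \<times> Pow {1..n}"
  define F where "F = (\<lambda>(A, B).
      {R. \<epsilon> * (real n)\<^sup>2 \<le> \<bar>real (ecount (E \<inter> R) A B) - r * real (ecount E A B)\<bar>})"
  have "measure_pmf.prob ?M ?S \<le> measure_pmf.prob ?M (\<Union>AB\<in>I. F AB)"
    by (intro measure_pmf.finite_measure_mono) (auto simp: I_def F_def intro: less_imp_le)
  also have "\<dots> \<le> (\<Sum>AB\<in>I. measure_pmf.prob ?M (F AB))"
    by (rule measure_pmf.finite_measure_subadditive_finite) (auto simp: I_def)
  also have "\<dots> \<le> (\<Sum>AB\<in>I. 2 * exp (- \<epsilon>\<^sup>2 * (real n)\<^sup>2))"
  proof (rule sum_mono)
    fix AB assume "AB \<in> I"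
    then obtain A B where AB: "AB = (A, B)" "A \<subseteq> {1..n}" "B \<subseteq> {1..n}" by (auto simp: I_def)
    then have "card A * card B \<le> n * n"
      by (intro mult_le_mono card_vertex_subset_le)
    then have "real (card A * card B) \<le> real (n * n)" by (simp only: of_nat_le_iff)
    then have "measure_pmf.prob ?M (F AB) \<le> 2 * exp (- (\<epsilon> * (real n)\<^sup>2)\<^sup>2 / (real n)\<^sup>2)"
      unfolding F_def AB(1) prod.case using AB r \<epsilon> n E
      by (intro ecount_concentration) (auto intro: finite_subset simp: power2_eq_square)
    also have "- (\<epsilon> * (real n)\<^sup>2)\<^sup>2 / (real n)\<^sup>2 = - \<epsilon>\<^sup>2 * (real n)\<^sup>2"
      using n by (simp add: power2_eq_square)
    finally show "measure_pmf.prob ?M (F AB) \<le> 2 * exp (- \<epsilon>\<^sup>2 * (real n)\<^sup>2)" .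
  qed
  also have "\<dots> = cut_error \<epsilon> n"
    by (simp add: I_def cut_error_def card_cartesian_product card_Pow power_mult_distrib[symmetric])
  finally show ?thesis .
qed

lemma vertex_degree_concentration:
  assumes r: "r \<in> {0..1}" and \<epsilon>: "0 < \<epsilon>" and n: "0 < n" and E: "E \<subseteq> all_edges n"
  shows "measure_pmf.prob (binomial_random_graph n r)
    {R. \<epsilon> * real n \<le> \<bar>real (vertex_degree (E \<inter> R) j) - r * real (vertex_degree E j)\<bar>}
    \<le> 2 * exp (- \<epsilon>\<^sup>2 * real n)"
proof -
  have "vertex_degree W j = ecount W {j} {1..n}" if "W \<subseteq> all_edges n" for W
    using sum_vertex_degree[OF that, of "{j}"] by simp
  then have "measure_pmf.prob (binomial_random_graph n r)
      {R. \<epsilon> * real n \<le> \<bar>real (vertex_degree (E \<inter> R) j) - r * real (vertex_degree E j)\<bar>} =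
    measure_pmf.prob (binomial_random_graph n r)
      {R. \<epsilon> * real n \<le> \<bar>real (ecount (E \<inter> R) {j} {1..n}) - r * real (ecount E {j} {1..n})\<bar>}"
    using E by (simp add: le_infI1)
  also have "\<dots> \<le> 2 * exp (- (\<epsilon> * real n)\<^sup>2 / real n)"
    using r \<epsilon> n E by (intro ecount_concentration) auto
  also have "- (\<epsilon> * real n)\<^sup>2 / real n = - \<epsilon>\<^sup>2 * real n" using n by (simp add: power2_eq_square)
  finally show ?thesis .
qed

lemma sample_regular_whp:
  assumes r: "r \<in> {0..1}" and \<epsilon>: "0 < \<epsilon>" and n: "0 < n" and E: "E \<subseteq> all_edges n"
  shows "measure_pmf.prob (binomial_random_graph n r) {R. \<not> sample_regular n r \<epsilon> E R}
    \<le> cut_error \<epsilon> n + 2 * real n * exp (- \<epsilon>\<^sup>2 * real n)"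
proof -
  define M where "M = binomial_random_graph n r"
  define S where "S = {R. \<exists>A\<subseteq>{1..n}. \<exists>B\<subseteq>{1..n}.
    \<epsilon> * (real n)\<^sup>2 < \<bar>real (ecount (E \<inter> R) A B) - r * real (ecount E A B)\<bar>}"
  define D where "D = (\<lambda>j. {R. \<epsilon> * real n \<le>
      \<bar>real (vertex_degree (E \<inter> R) j) - r * real (vertex_degree E j)\<bar>})"
  have "R \<in> S \<union> (\<Union>j\<in>{1..n}. D j)" if "\<not> sample_regular n r \<epsilon> E R" for R
    using that unfolding sample_regular_def S_def D_def Un_iff UN_iff mem_Collect_eq
    by (meson not_le less_imp_le)
  then have "measure_pmf.prob M {R. \<not> sample_regular n r \<epsilon> E R} \<le>
      measure_pmf.prob M (S \<union> (\<Union>j\<in>{1..n}. D j))"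
    by (intro measure_pmf.finite_measure_mono) auto
  also have "\<dots> \<le> measure_pmf.prob M S + measure_pmf.prob M (\<Union>j\<in>{1..n}. D j)"
    by (rule measure_Un_le) auto
  also have "measure_pmf.prob M (\<Union>j\<in>{1..n}. D j) \<le> (\<Sum>j\<in>{1..n}. measure_pmf.prob M (D j))"
    by (rule measure_pmf.finite_measure_subadditive_finite) auto
  also have "\<dots> \<le> (\<Sum>j\<in>{1..n}. 2 * exp (- \<epsilon>\<^sup>2 * real n))"
    unfolding M_def D_def using r \<epsilon> n E by (intro sum_mono vertex_degree_concentration)
  also have "measure_pmf.prob M S \<le> cut_error \<epsilon> n"
    unfolding M_def S_def by (rule prob_ex_ecount_deviation[OF r \<epsilon> n E])
  finally show ?thesis by (simp add: M_def mult.commute)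
qed

lemma cut_regular_whp:
  assumes p: "p \<in> {0..1}" and \<epsilon>: "0 < \<epsilon>" and n: "2 / \<epsilon> \<le> real n" "0 < n"
  shows "measure_pmf.prob (binomial_random_graph n p) {W. \<not> cut_regular n p \<epsilon> W} \<le>
      cut_error (\<epsilon> / 2) n"
proof -
  have "\<exists>A\<subseteq>{1..n}. \<exists>B\<subseteq>{1..n}.
      \<epsilon> / 2 * (real n)\<^sup>2 <
        \<bar>real (ecount (all_edges n \<inter> W) A B) - p * real (ecount (all_edges n) A B)\<bar>"
    if W: "W \<subseteq> all_edges n" and irregular: "\<not> cut_regular n p \<epsilon> W" for W
  proof -
    obtain A B where AB: "A \<subseteq> {1..n}" "B \<subseteq> {1..n}"
      and cut: "\<epsilon> * (real n)\<^sup>2 < \<bar>real (ecount W A B) - p * real (card A) * real (card B)\<bar>"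
      using irregular unfolding cut_regular_def by (meson not_le)
    define x where "x = real (ecount (all_edges n) A B) - real (card A) * real (card B)"
    have "\<bar>p * x\<bar> \<le> 1 * real n"
      unfolding abs_mult using p ecount_all_edges[OF AB] by (intro mult_mono) (auto simp: x_def)
    moreover have "real n \<le> \<epsilon> / 2 * (real n)\<^sup>2"
      using n \<epsilon> mult_right_mono[of "2 / \<epsilon>" "real n" "real n"]
      by (simp add: field_simps power2_eq_square)
    moreover have "real (ecount W A B) - p * real (card A) * real (card B) =
        (real (ecount W A B) - p * real (ecount (all_edges n) A B)) + p * x"
      by (simp add: x_def algebra_simps)
    ultimately have "\<epsilon> / 2 * (real n)\<^sup>2 < \<bar>real (ecount W A B) - p * real (ecount (all_edges n) A B)\<bar>"
      using cut by linarith
    then show ?thesis using W AB by (intro exI[of _ A] exI[of _ B] conjI) (simp_all only: Int_absorb1)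
  qed
  then have "measure_pmf.prob (binomial_random_graph n p) {W. \<not> cut_regular n p \<epsilon> W} \<le>
    measure_pmf.prob (binomial_random_graph n p) {W. \<exists>A\<subseteq>{1..n}. \<exists>B\<subseteq>{1..n}.
      \<epsilon> / 2 * (real n)\<^sup>2 <
        \<bar>real (ecount (all_edges n \<inter> W) A B) - p * real (ecount (all_edges n) A B)\<bar>}"
    unfolding binomial_random_graph_eq_random_subset
    by (intro measure_pmf.finite_measure_mono_AE)
       (simp_all add: AE_measure_pmf_iff set_pmf_random_subset)
  also have "\<dots> \<le> cut_error (\<epsilon> / 2) n"
    using p \<epsilon> n by (intro prob_ex_ecount_deviation) auto
  finally show ?thesis .
qed

section \<open>Cut regularity of graphs with given degrees\<close>

lemma exp_times_power_le_power:
  fixes c \<zeta> :: real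
  assumes c: "0 < c" "c \<le> 1" and \<zeta>: "0 < \<zeta>"
  obtains x \<delta> where "0 < x" "x \<le> 1" "0 < \<delta>"
    "\<And>k N t. real k \<le> \<delta> * t \<Longrightarrow> real N \<le> t \<Longrightarrow> exp (- \<zeta> * t) * (1 + x) ^ N \<le> (c * x) ^ k"
proof -
  define x where "x = min 1 (\<zeta> / 2)"
  define L where "L = ln (1 / (c * x))"
  define \<delta> where "\<delta> = \<zeta> / (2 * (L + 1))"
  have x: "0 < x" "x \<le> 1" "x \<le> \<zeta> / 2" using \<zeta> by (auto simp: x_def)
  have cx: "0 < c * x" "c * x \<le> 1" using x c by (auto intro: mult_le_one)
  then have L: "0 \<le> L" by (simp add: L_def)
  then have \<delta>: "0 < \<delta>" "\<delta> * L \<le> \<zeta> / 2" using \<zeta> by (auto simp: \<delta>_def field_simps)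
  have "exp (- \<zeta> * t) * (1 + x) ^ N \<le> (c * x) ^ k"
    if k: "real k \<le> \<delta> * t" and N: "real N \<le> t" for k N t
  proof -
    have t: "0 \<le> t" using N by linarith
    have "(1 + x) ^ N \<le> exp x ^ N" using x by (intro power_mono) auto
    also have "\<dots> = exp (real N * x)" by (simp add: exp_of_nat_mult)
    finally have "exp (- \<zeta> * t) * (1 + x) ^ N \<le> exp (- \<zeta> * t) * exp (real N * x)" by simp
    also have "\<dots> = exp (real N * x - \<zeta> * t)" by (simp add: exp_add[symmetric] exp_diff[symmetric])
    also have "\<dots> \<le> exp (- (real k * L))"
    proof -
      have "real N * x \<le> t * (\<zeta> / 2)" using N x t by (intro mult_mono) auto
      moreover have "real k * L \<le> (\<delta> * t) * L" using k L by (intro mult_right_mono)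
      moreover have "(\<delta> * L) * t \<le> \<zeta> / 2 * t" using \<delta>(2) t by (rule mult_right_mono)
      ultimately show ?thesis by (simp add: mult_ac)
    qed
    also have "\<dots> = (c * x) ^ k"
      using cx c x by (simp add: L_def ln_div exp_of_nat_mult)
    finally show ?thesis .
  qed
  then show thesis using that x \<delta>(1) by blast
qed

lemma prob_near_graphs_with_degrees_ge_half:
  assumes c: "0 < c" and p: "p \<in> {c..1 - c}" and \<delta>: "0 < \<delta>" "10 * \<delta> < c ^ 3"
    and n: "cut_error (\<delta> / 2) n \<le> 1 / 2" "2 / \<delta> \<le> real n" "0 < n"
    and d: "degrees_within n p \<delta> d" and ev: "even (\<Sum>j\<in>{1..n}. d j)"
  shows "1 / 2 \<le> measure_pmf.prob (binomial_random_graph n p)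
    {W. \<exists>H\<in>graphs_with_degrees n d. card (sym_diff W H) \<le> nat \<lfloor>10 * \<delta> * (real n)\<^sup>2\<rfloor>}"
proof -
  define M where "M = binomial_random_graph n p"
  have "\<exists>H\<in>graphs_with_degrees n d. card (sym_diff W H) \<le> nat \<lfloor>10 * \<delta> * (real n)\<^sup>2\<rfloor>"
    if "W \<subseteq> all_edges n" "cut_regular n p \<delta> W" for W
    using cut_regular_near_degree_graph[OF that d ev p c \<delta> n(3)] by (meson le_nat_floor)
  then have "measure_pmf.prob M {W. cut_regular n p \<delta> W} \<le> measure_pmf.prob M
      {W. \<exists>H\<in>graphs_with_degrees n d. card (sym_diff W H) \<le> nat \<lfloor>10 * \<delta> * (real n)\<^sup>2\<rfloor>}"
    unfolding M_def binomial_random_graph_eq_random_subset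
    by (intro measure_pmf.finite_measure_mono_AE)
       (simp_all add: AE_measure_pmf_iff set_pmf_random_subset)
  moreover have "1 / 2 \<le> measure_pmf.prob M {W. cut_regular n p \<delta> W}"
    using cut_regular_whp[of p \<delta> n] n p c \<delta> measure_pmf.prob_compl[of "{W. cut_regular n p \<delta> W}" M]
    by (simp add: M_def Compl_eq_Diff_UNIV[symmetric] Collect_neg_eq)
  ultimately show ?thesis unfolding M_def by linarith
qed

lemma prob_graphs_with_degrees_ge:
  fixes c \<zeta> :: real
  assumes c: "0 < c" "c \<le> 1" and \<zeta>: "0 < \<zeta>"
  shows "eventually_near_regular c (\<lambda>n p d. exp (- \<zeta> * (real n)\<^sup>2) / 2 \<le>
    measure_pmf.prob (binomial_random_graph n p) (graphs_with_degrees n d))"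
proof -
  obtain x \<delta>0 where x: "0 < x" "x \<le> 1" and \<delta>0: "0 < \<delta>0"
    and power: "\<And>k N t. real k \<le> \<delta>0 * t \<Longrightarrow> real N \<le> t \<Longrightarrow> exp (- \<zeta> * t) * (1 + x) ^ N \<le> (c * x) ^ k"
    using exp_times_power_le_power[OF c \<zeta>] by metis
  define \<delta> where "\<delta> = min (c ^ 3 / 20) (\<delta>0 / 10)"
  have \<delta>: "0 < \<delta>" using c \<delta>0 by (simp add: \<delta>_def)
  have "\<delta> \<le> c ^ 3 / 20" "\<delta> \<le> \<delta>0 / 10" "0 < c ^ 3" using c by (auto simp: \<delta>_def)
  then have \<delta>_small: "10 * \<delta> < c ^ 3" "10 * \<delta> \<le> \<delta>0" by linarith+
  have "(\<lambda>n. cut_error (\<delta> / 2) n) \<longlonglongrightarrow> 0"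
    unfolding cut_error_def using \<delta> by real_asymp
  then have "\<forall>\<^sub>F n in sequentially. cut_error (\<delta> / 2) n < 1 / 2"
    by (rule order_tendstoD) simp
  moreover have "\<forall>\<^sub>F n in sequentially. 2 / \<delta> \<le> real n" by real_asymp
  ultimately have "\<forall>\<^sub>F n in sequentially. cut_error (\<delta> / 2) n \<le> 1 / 2 \<and> 2 / \<delta> \<le> real n \<and> 0 < n"
    using eventually_gt_at_top[of "0::nat"] by eventually_elim simp
  then show ?thesis
  proof (rule eventually_near_regularI[OF \<delta>])
    fix n p d
    assume n: "cut_error (\<delta> / 2) n \<le> 1 / 2 \<and> 2 / \<delta> \<le> real n \<and> 0 < n"
      and p: "p \<in> {c..1 - c}" and d: "degrees_within n p \<delta> d" and ne: "graphs_with_degrees n d \<noteq> {}"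
    define k where "k = nat \<lfloor>10 * \<delta> * (real n)\<^sup>2\<rfloor>"
    have "real k \<le> 10 * \<delta> * (real n)\<^sup>2" unfolding k_def using \<delta> by simp
    also have "\<dots> \<le> \<delta>0 * (real n)\<^sup>2" using \<delta>_small by (intro mult_right_mono) auto
    finally have k_le: "real k \<le> \<delta>0 * (real n)\<^sup>2" .
    have half: "1 / 2 \<le> measure_pmf.prob (binomial_random_graph n p)
        {W. \<exists>H\<in>graphs_with_degrees n d. card (sym_diff W H) \<le> k}"
      unfolding k_def using n d
      by (intro prob_near_graphs_with_degrees_ge_half[OF c(1) p \<delta> \<delta>_small(1)] even_sum_degrees[OF ne]) auto
    have "real (card (all_edges n)) \<le> (real n)\<^sup>2"
      using card_all_edges_le[of n] by (simp flip: of_nat_power)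
    from power[OF k_le this] have "exp (- \<zeta> * (real n)\<^sup>2) * (1 / 2) \<le>
        measure_pmf.prob (binomial_random_graph n p) (graphs_with_degrees n d)"
      using half p unfolding binomial_random_graph_eq_random_subset
      by (intro prob_random_subset_ge_if_neighbourhood_ge[OF finite_all_edges c _ x
            graphs_with_degrees_subset]) auto
    then show "exp (- \<zeta> * (real n)\<^sup>2) / 2 \<le>
        measure_pmf.prob (binomial_random_graph n p) (graphs_with_degrees n d)" by simp
  qed
qed

lemma prob_degree_random_graph_le:
  assumes p: "p \<in> {0..1}" and ne: "graphs_with_degrees n d \<noteq> {}"
  shows "measure_pmf.prob (degree_random_graph n d) S *
      measure_pmf.prob (binomial_random_graph n p) (graphs_with_degrees n d)
    \<le> measure_pmf.prob (binomial_random_graph n p) S"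
proof -
  define m where "m = (\<Sum>j\<in>{1..n}. d j) div 2"
  have "pmf (binomial_random_graph n p) H = p ^ m * (1 - p) ^ (card (all_edges n) - m)"
    if "H \<in> graphs_with_degrees n d" for H
  proof -
    have H: "H \<subseteq> all_edges n" and "\<And>j. j \<in> {1..n} \<Longrightarrow> vertex_degree H j = d j"
      using that by (auto simp: graphs_with_degrees_def)
    then have "card H = m" using handshake[OF H] by (simp add: m_def)
    then show ?thesis
      using p H by (simp add: binomial_random_graph_eq_random_subset pmf_random_subset_const)
  qed
  then have "measure_pmf.prob (degree_random_graph n d) S *
      measure_pmf.prob (binomial_random_graph n p) (graphs_with_degrees n d) =
    measure_pmf.prob (binomial_random_graph n p) (graphs_with_degrees n d \<inter> S)"
    unfolding degree_random_graph_def
    by (intro prob_pmf_of_set_conditional finite_graphs_with_degrees ne)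
  also have "\<dots> \<le> measure_pmf.prob (binomial_random_graph n p) S"
    by (intro measure_pmf.finite_measure_mono) auto
  finally show ?thesis .
qed

lemma degree_random_graph_cut_regular_whp:
  fixes c \<epsilon> :: real
  assumes c: "0 < c" "c \<le> 1" and \<epsilon>: "0 < \<epsilon>"
  shows "eventually_near_regular c (\<lambda>n p d.
    measure_pmf.prob (degree_random_graph n d) {G. \<not> cut_regular n p \<epsilon> G} \<le>
      4 * 4 ^ n * exp (- (\<epsilon>\<^sup>2 / 8) * (real n)\<^sup>2))"
proof -
  have "\<forall>\<^sub>F n in sequentially. 2 / \<epsilon> \<le> real n" by real_asymp
  then have large: "\<forall>\<^sub>F n in sequentially. 2 / \<epsilon> \<le> real n \<and> 0 < n"
    using eventually_gt_at_top[of "0::nat"] by eventually_elim simp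
  have "eventually_near_regular c (\<lambda>n p d. exp (- (\<epsilon>\<^sup>2 / 8) * (real n)\<^sup>2) / 2 \<le>
      measure_pmf.prob (binomial_random_graph n p) (graphs_with_degrees n d))"
    using \<epsilon> by (intro prob_graphs_with_degrees_ge[OF c]) simp
  then show ?thesis
  proof (rule eventually_near_regular_mono[OF _ zero_less_one large])
    fix n p d
    assume n: "2 / \<epsilon> \<le> real n \<and> 0 < n" and p: "p \<in> {c..1 - c}"
      and ne: "graphs_with_degrees n d \<noteq> {}"
      and ge: "exp (- (\<epsilon>\<^sup>2 / 8) * (real n)\<^sup>2) / 2 \<le>
        measure_pmf.prob (binomial_random_graph n p) (graphs_with_degrees n d)"
    define \<zeta> where "\<zeta> = \<epsilon>\<^sup>2 / 8"
    define r where "r = measure_pmf.prob (degree_random_graph n d) {G. \<not> cut_regular n p \<epsilon> G}"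
    have p01: "p \<in> {0..1}" using p c by auto
    have "r * (exp (- \<zeta> * (real n)\<^sup>2) / 2) \<le>
        r * measure_pmf.prob (binomial_random_graph n p) (graphs_with_degrees n d)"
      using ge by (intro mult_left_mono) (auto simp: r_def \<zeta>_def)
    also have "\<dots> \<le> measure_pmf.prob (binomial_random_graph n p) {G. \<not> cut_regular n p \<epsilon> G}"
      unfolding r_def by (rule prob_degree_random_graph_le[OF p01 ne])
    also have "\<dots> \<le> cut_error (\<epsilon> / 2) n"
      using n by (intro cut_regular_whp[OF p01 \<epsilon>]) auto
    also have "\<dots> = 4 * 4 ^ n * exp (- \<zeta> * (real n)\<^sup>2) * (exp (- \<zeta> * (real n)\<^sup>2) / 2)"
      by (simp add: cut_error_def \<zeta>_def power2_eq_square exp_add[symmetric])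
    finally show "measure_pmf.prob (degree_random_graph n d) {G. \<not> cut_regular n p \<epsilon> G} \<le>
        4 * 4 ^ n * exp (- (\<epsilon>\<^sup>2 / 8) * (real n)\<^sup>2)"
      by (simp add: r_def \<zeta>_def)
  qed
qed

section \<open>Counting switchings\<close>

lemma ecount_sample_cut_regular:
  assumes r: "r \<in> {0..1}" and sample: "sample_regular n r \<epsilon> E R" and cut: "cut_regular n q \<epsilon>' E"
    and AB: "A \<subseteq> {1..n}" "B \<subseteq> {1..n}"
  shows "\<bar>real (ecount (E \<inter> R) A B) - q * r * (real (card A) * real (card B))\<bar> \<le>
      (\<epsilon> + \<epsilon>') * (real n)\<^sup>2"
proof -
  have "\<bar>r * (real (ecount E A B) - q * real (card A) * real (card B))\<bar> \<le> 1 * (\<epsilon>' * (real n)\<^sup>2)"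
    unfolding abs_mult using r cut_regularD[OF cut AB] by (intro mult_mono) auto
  moreover have "\<bar>real (ecount (E \<inter> R) A B) - r * real (ecount E A B)\<bar> \<le> \<epsilon> * (real n)\<^sup>2"
    using sample AB by (simp add: sample_regular_def)
  moreover have "real (ecount (E \<inter> R) A B) - q * r * (real (card A) * real (card B)) =
      (real (ecount (E \<inter> R) A B) - r * real (ecount E A B)) +
      r * (real (ecount E A B) - q * real (card A) * real (card B))"
    by (simp add: algebra_simps)
  ultimately show ?thesis unfolding distrib_right by linarith
qed

lemma card_neighbours_sample:
  assumes r: "r \<in> {0..1}" and sample: "sample_regular n r \<epsilon> E R" and E: "E \<subseteq> all_edges n"
    and j: "j \<in> {1..n}"
    and degree: "\<bar>real (vertex_degree E j) - q * real n\<bar> \<le> \<epsilon>' * real n"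
  shows "\<bar>real (card (neighbours (E \<inter> R) j)) - r * q * real n\<bar> \<le> (\<epsilon> + \<epsilon>') * real n"
proof -
  have "card (neighbours (E \<inter> R) j) = vertex_degree (E \<inter> R) j"
    using E by (intro vertex_degree_eq_card_neighbours[where n = n, symmetric]) auto
  then have "\<bar>real (card (neighbours (E \<inter> R) j)) - r * real (vertex_degree E j)\<bar> \<le> \<epsilon> * real n"
    using sample j by (simp add: sample_regular_def)
  moreover have "\<bar>r * (real (vertex_degree E j) - q * real n)\<bar> \<le> 1 * (\<epsilon>' * real n)"
    unfolding abs_mult using r degree by (intro mult_mono) auto
  ultimately show ?thesis by (simp add: algebra_simps)
qed

lemma abs_mult_diff_le:
  fixes a b a' b' :: real
  assumes "\<bar>a - a'\<bar> \<le> s" "\<bar>b - b'\<bar> \<le> t" "\<bar>b\<bar> \<le> m" "\<bar>a'\<bar> \<le> m"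
  shows "\<bar>a * b - a' * b'\<bar> \<le> s * m + m * t"
proof -
  have "\<bar>a * b - a' * b'\<bar> = \<bar>(a - a') * b + a' * (b - b')\<bar>" by (simp add: algebra_simps)
  also have "\<dots> \<le> \<bar>a - a'\<bar> * \<bar>b\<bar> + \<bar>a'\<bar> * \<bar>b - b'\<bar>" using abs_triangle_ineq by (metis abs_mult)
  also have "\<dots> \<le> s * m + m * t" using assms by (intro add_mono mult_mono) auto
  finally show ?thesis .
qed

lemma ecount_neighbours_sample:
  assumes r: "r \<in> {0..1}" and q: "q \<in> {0..1}" "q' \<in> {0..1}"
    and sample: "sample_regular n r \<epsilon> E R" "sample_regular n r \<epsilon> E' R" and cut: "cut_regular n q \<epsilon>1 E"
    and E': "E' \<subseteq> all_edges n"
    and degree: "\<And>i. i \<in> {1..n} \<Longrightarrow> \<bar>real (vertex_degree E' i) - q' * real n\<bar> \<le> \<epsilon>2 * real n"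
    and jk: "j \<in> {1..n}" "k \<in> {1..n}"
  shows "\<bar>real (ecount (E \<inter> R) (neighbours (E' \<inter> R) j) (neighbours (E' \<inter> R) k)) -
      q * q'\<^sup>2 * r ^ 3 * (real n)\<^sup>2\<bar>
    \<le> (\<epsilon> + \<epsilon>1 + 2 * (\<epsilon> + \<epsilon>2)) * (real n)\<^sup>2"
proof -
  define S where "S = neighbours (E' \<inter> R)"
  define s where "s = (\<lambda>i. real (card (S i)))"
  have S: "S i \<subseteq> {1..n}" for i
    unfolding S_def using E' by (intro neighbours_subset) auto
  have s_le: "\<bar>s i\<bar> \<le> real n" for i using card_vertex_subset_le[OF S] by (simp add: s_def)
  have s_near: "\<bar>s i - r * q' * real n\<bar> \<le> (\<epsilon> + \<epsilon>2) * real n" if "i \<in> {1..n}" for i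
    unfolding s_def S_def by (rule card_neighbours_sample[OF r sample(2) E' that degree[OF that]])
  have "\<bar>r * q' * real n\<bar> \<le> real n"
    using r q by (auto simp: abs_mult mult_left_le_one_le mult_le_one)
  then have "\<bar>s j * s k - (r * q' * real n) * (r * q' * real n)\<bar>
      \<le> ((\<epsilon> + \<epsilon>2) * real n) * real n + real n * ((\<epsilon> + \<epsilon>2) * real n)"
    using s_near jk s_le by (intro abs_mult_diff_le) auto
  then have product: "\<bar>s j * s k - r\<^sup>2 * q'\<^sup>2 * (real n)\<^sup>2\<bar> \<le> 2 * (\<epsilon> + \<epsilon>2) * (real n)\<^sup>2"
    by (simp add: power2_eq_square algebra_simps)
  have "\<bar>q * r * (s j * s k - r\<^sup>2 * q'\<^sup>2 * (real n)\<^sup>2)\<bar> \<le> 1 * (2 * (\<epsilon> + \<epsilon>2) * (real n)\<^sup>2)"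
    unfolding abs_mult[of "q * r"] using r q product by (intro mult_mono) (auto simp: mult_le_one)
  moreover have "\<bar>real (ecount (E \<inter> R) (S j) (S k)) - q * r * (s j * s k)\<bar> \<le> (\<epsilon> + \<epsilon>1) * (real n)\<^sup>2"
    unfolding s_def by (rule ecount_sample_cut_regular[OF r sample(1) cut S S])
  moreover have "q * r * (s j * s k - r\<^sup>2 * q'\<^sup>2 * (real n)\<^sup>2) =
      q * r * (s j * s k) - q * q'\<^sup>2 * r ^ 3 * (real n)\<^sup>2"
    by (simp add: algebra_simps power2_eq_square power3_eq_cube)
  ultimately show ?thesis
    unfolding S_def distrib_right by linarith
qed

section \<open>Typical labellings\<close>

definition label_regular :: "nat \<Rightarrow> nat \<Rightarrow> real \<Rightarrow> graph \<Rightarrow> (nat set \<Rightarrow> nat) \<Rightarrow> bool" where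
  "label_regular n L \<epsilon> E lab \<longleftrightarrow>
     (\<forall>l\<le>L. sample_regular n (1 - real l / real L) \<epsilon> E (superlevel (all_edges n) lab l))"

definition label_error :: "nat \<Rightarrow> real \<Rightarrow> nat \<Rightarrow> real" where
  "label_error L \<epsilon> n = (real L + 1) * (cut_error \<epsilon> n + 2 * real n * exp (- \<epsilon>\<^sup>2 * real n))"

definition typical :: "nat \<Rightarrow> nat \<Rightarrow> real \<Rightarrow> real \<Rightarrow> (nat set \<Rightarrow> nat) \<Rightarrow> graph \<Rightarrow> bool" where
  "typical n L p \<epsilon> lab G \<longleftrightarrow> cut_regular n p \<epsilon> G \<and> label_regular n L \<epsilon> G lab \<and>
     label_regular n L \<epsilon> (all_edges n - G) lab"

lemma label_regular_whp:
  assumes L: "0 < L" and \<epsilon>: "0 < \<epsilon>" and n: "0 < n" and E: "E \<subseteq> all_edges n"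
  shows "measure_pmf.prob (uniform_labels (all_edges n) L) {lab. \<not> label_regular n L \<epsilon> E lab} \<le>
      label_error L \<epsilon> n"
proof -
  define M where "M = uniform_labels (all_edges n) L"
  define irregular where
    "irregular = (\<lambda>l. {lab.
      \<not> sample_regular n (1 - real l / real L) \<epsilon> E (superlevel (all_edges n) lab l)})"
  have "measure_pmf.prob M {lab. \<not> label_regular n L \<epsilon> E lab} =
      measure_pmf.prob M (\<Union>l\<le>L. irregular l)"
    by (intro arg_cong[where f = "measure_pmf.prob M"]) (auto simp: label_regular_def irregular_def)
  also have "\<dots> \<le> (\<Sum>l\<le>L. measure_pmf.prob M (irregular l))"
    by (rule measure_pmf.finite_measure_subadditive_finite) auto
  also have "\<dots> \<le> (\<Sum>l\<le>L. cut_error \<epsilon> n + 2 * real n * exp (- \<epsilon>\<^sup>2 * real n))"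
  proof (rule sum_mono)
    fix l assume "l \<in> {..L}"
    then have l: "l \<le> L" by simp
    then have "1 - real l / real L \<in> {0..1}" using L by simp
    from sample_regular_whp[OF this \<epsilon> n E]
    show "measure_pmf.prob M (irregular l) \<le> cut_error \<epsilon> n + 2 * real n * exp (- \<epsilon>\<^sup>2 * real n)"
      unfolding binomial_random_graph_eq_random_subset
        superlevel_uniform_labels[OF finite_all_edges L l, symmetric]
      by (simp add: M_def irregular_def vimage_def)
  qed
  finally show ?thesis by (simp add: M_def label_error_def algebra_simps)
qed

lemma expectation_prob_swap:
  "measure_pmf.expectation M (\<lambda>x. measure_pmf.prob N {y. P x y}) =
   measure_pmf.expectation N (\<lambda>y. measure_pmf.prob M {x. P x y})"
proof -
  have "measure_pmf.prob (bind_pmf M (\<lambda>x. bind_pmf N (\<lambda>y. return_pmf (P x y)))) {True} =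
      measure_pmf.prob (bind_pmf N (\<lambda>y. bind_pmf M (\<lambda>x. return_pmf (P x y)))) {True}"
    by (simp only: bind_commute_pmf[of M N])
  moreover have "measure_pmf.prob (bind_pmf K (\<lambda>z. return_pmf (Q z))) {True} =
      measure_pmf.prob K {z. Q z}"
    for K :: "'c pmf" and Q
    by (simp add: map_pmf_def[symmetric] vimage_def)
  ultimately show ?thesis by (simp add: prob_bind_pmf map_pmf_def[symmetric] vimage_def)
qed

lemma expectation_atypical_le:
  assumes L: "0 < L" and \<epsilon>: "0 < \<epsilon>" and n: "0 < n" and D: "set_pmf D \<subseteq> Pow (all_edges n)"
  shows "measure_pmf.expectation (uniform_labels (all_edges n) L)
      (\<lambda>lab. measure_pmf.prob D {G. \<not> typical n L p \<epsilon> lab G})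
    \<le> measure_pmf.prob D {G. \<not> cut_regular n p \<epsilon> G} + 2 * label_error L \<epsilon> n"
proof -
  define M where "M = uniform_labels (all_edges n) L"
  define irregular where "irregular = (\<lambda>E. {lab. \<not> label_regular n L \<epsilon> E lab})"
  have error: "0 \<le> label_error L \<epsilon> n" by (simp add: label_error_def cut_error_def)
  have "measure_pmf.prob M {lab. \<not> typical n L p \<epsilon> lab G} \<le>
      indicator {G. \<not> cut_regular n p \<epsilon> G} G + 2 * label_error L \<epsilon> n" if "G \<in> set_pmf D" for G
  proof (cases "cut_regular n p \<epsilon> G")
    case False
    have "measure_pmf.prob M {lab. \<not> typical n L p \<epsilon> lab G} \<le> 1" by (rule measure_pmf.prob_le_1)
    also have "1 \<le> indicator {G. \<not> cut_regular n p \<epsilon> G} G + 2 * label_error L \<epsilon> n"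
      using False error by simp
    finally show ?thesis .
  next
    case True
    then have "{lab. \<not> typical n L p \<epsilon> lab G} = irregular G \<union> irregular (all_edges n - G)"
      by (auto simp: typical_def irregular_def)
    then have "measure_pmf.prob M {lab. \<not> typical n L p \<epsilon> lab G} \<le>
        measure_pmf.prob M (irregular G) + measure_pmf.prob M (irregular (all_edges n - G))"
      using measure_Un_le[of "irregular G" M] by simp
    also have "\<dots> \<le> label_error L \<epsilon> n + label_error L \<epsilon> n"
      unfolding M_def irregular_def using that D by (intro add_mono label_regular_whp L \<epsilon> n) auto
    finally show ?thesis using True by simp
  qed
  moreover have integrable: "integrable D (indicator {G. \<not> cut_regular n p \<epsilon> G} :: graph \<Rightarrow> real)"
    by (intro measure_pmf.integrable_const_bound[where B = 1]) (auto simp: indicator_def)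
  ultimately have "measure_pmf.expectation D (\<lambda>G. measure_pmf.prob M {lab. \<not> typical n L p \<epsilon> lab G}) \<le>
      measure_pmf.expectation D (\<lambda>G. indicator {G. \<not> cut_regular n p \<epsilon> G} G + 2 * label_error L \<epsilon> n)"
    by (intro integral_mono_AE)
       (auto simp: AE_measure_pmf_iff intro: measure_pmf.integrable_const_bound[where B = 1])
  also have "\<dots> = measure_pmf.prob D {G. \<not> cut_regular n p \<epsilon> G} + 2 * label_error L \<epsilon> n"
    using integrable by simp
  finally show ?thesis unfolding M_def expectation_prob_swap[of "uniform_labels (all_edges n) L"] .
qed

lemma typical_switching_regular:
  assumes typical: "typical n L p \<epsilon> lab G" and G: "G \<in> graphs_with_degrees n d"
    and d: "degrees_within n p \<epsilon> d"
    and p: "p \<in> {0..1}" and \<epsilon>: "0 \<le> \<epsilon>" and n: "0 < n" "1 \<le> \<epsilon> * real n" and L: "0 < L" "l \<le> L"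
    and jk: "j \<in> {1..n}" "k \<in> {1..n}"
  shows "switching_regular n p ((1 - real l / real L) ^ 3) (9 * \<epsilon>)
    (superlevel (all_edges n) lab l) G j k"
proof -
  define r where "r = 1 - real l / real L"
  define U where "U = superlevel (all_edges n) lab l"
  define H where "H = all_edges n - G"
  have GE: "G \<subseteq> all_edges n" and HE: "H \<subseteq> all_edges n"
    and Gd: "\<And>i. i \<in> {1..n} \<Longrightarrow> vertex_degree G i = d i"
    using G by (auto simp: graphs_with_degrees_def H_def)
  have r: "r \<in> {0..1}" and p': "1 - p \<in> {0..1}" using L p by (auto simp: r_def)
  have degree_G: "\<bar>real (vertex_degree G i) - p * real n\<bar> \<le> \<epsilon> * real n" if "i \<in> {1..n}" for i
    using d Gd[OF that] that by (simp add: degrees_within_def algebra_simps)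
  have degree_H: "\<bar>real (vertex_degree H i) - (1 - p) * real n\<bar> \<le> 2 * \<epsilon> * real n"
    if "i \<in> {1..n}" for i
  proof -
    have "vertex_degree H i + vertex_degree G i + 1 = n"
      using vertex_degree_complement[OF GE that] n by (simp add: H_def)
    then have "real (vertex_degree H i) = real n - 1 - real (vertex_degree G i)" by linarith
    then show ?thesis using degree_G[OF that] n by (simp add: algebra_simps abs_le_iff)
  qed
  have "real n \<le> \<epsilon> * (real n)\<^sup>2"
    using mult_right_mono[OF n(2), of "real n"] by (simp add: power2_eq_square mult_ac)
  then have cut: "cut_regular n p \<epsilon> G" "cut_regular n (1 - p) (2 * \<epsilon>) H"
    using typical cut_regular_complement[OF _ GE] by (auto simp: typical_def H_def)
  have sample: "sample_regular n r \<epsilon> G U" "sample_regular n r \<epsilon> H U"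
    using typical L by (auto simp: typical_def label_regular_def H_def r_def U_def)
  have "U \<inter> G = G \<inter> U" "U - G = H \<inter> U" "U \<inter> - G = H \<inter> U" "U - - G = G \<inter> U"
    by (auto simp: U_def H_def superlevel_def)
  then have counts: "card (switchings U G j k) =
      ecount (G \<inter> U) (neighbours (H \<inter> U) j) (neighbours (H \<inter> U) k)"
    "card (switchings U (- G) j k) = ecount (H \<inter> U) (neighbours (G \<inter> U) j) (neighbours (G \<inter> U) k)"
    by (simp_all only: card_switchings_eq)
  have "(\<epsilon> + \<epsilon> + 2 * (\<epsilon> + 2 * \<epsilon>)) * (real n)\<^sup>2 \<le> 9 * \<epsilon> * (real n)\<^sup>2"
    "(\<epsilon> + 2 * \<epsilon> + 2 * (\<epsilon> + \<epsilon>)) * (real n)\<^sup>2 \<le> 9 * \<epsilon> * (real n)\<^sup>2"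
    using \<epsilon> by (intro mult_right_mono; simp)+
  then show ?thesis
    using ecount_neighbours_sample[OF r p p' sample cut(1) HE degree_H jk]
      ecount_neighbours_sample[OF r p' p sample(2,1) cut(2) GE degree_G jk]
    unfolding switching_regular_def r_def[symmetric] U_def[symmetric] counts by linarith
qed

lemma superlevels_around_unexposed:
  assumes es: "es = xs @ e # ys" "set es = A" "distinct es" "sorted (map lab es)"
  shows "e \<in> A - set xs" "superlevel A lab (Suc (lab e)) \<subseteq> A - set xs"
    "A - set xs \<subseteq> superlevel A lab (lab e)"
  using es by (auto simp: superlevel_def sorted_append not_less_eq_eq[symmetric])

section \<open>Exposure in random order\<close>

lemma cube_diff_le:
  fixes r h :: real
  assumes "0 \<le> h" "h \<le> r"
  shows "r ^ 3 - (r - h) ^ 3 \<le> 3 * r\<^sup>2 * h"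
proof -
  have "h * h\<^sup>2 \<le> 3 * r * h\<^sup>2" using assms by (intro mult_right_mono) auto
  moreover have "r ^ 3 - (r - h) ^ 3 = 3 * r\<^sup>2 * h - 3 * r * h\<^sup>2 + h * h\<^sup>2"
    by (simp add: power2_eq_square power3_eq_cube algebra_simps)
  ultimately show ?thesis by linarith
qed

text \<open>The pairs receive labels below \<open>K * K\<close> and those with labels below \<open>K * K - K\<close> are exposed,
  so that a proportion of about \<open>1 / K\<close> of the pairs is always left for the switchings.\<close>

locale exposure =
  fixes n K :: nat and d :: "nat \<Rightarrow> nat" and c p \<theta> \<epsilon> \<eta> :: real
  assumes density: "0 < c" "p \<in> {c..1 - c}"
    and tolerance: "0 < \<theta>" "\<theta> \<le> c"
    and levels: "0 < K" "3 / real K \<le> c\<^sup>2 * \<theta> / 2"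
    and errors: "0 < \<epsilon>" "0 < \<eta>" "9 * \<epsilon> + \<eta> \<le> c\<^sup>2 * \<theta> / 2 / real K ^ 3"
    and size: "0 < n" "1 \<le> \<epsilon> * real n"
    and degrees: "degrees_within n p \<epsilon> d"
    and realisable: "graphs_with_degrees n d \<noteq> {}"
begin

definition lower_rate :: "(nat set \<Rightarrow> nat) \<Rightarrow> nat set \<Rightarrow> real" where
  "lower_rate lab e = (if lab e < K * K - K then p - \<theta> else 0)"

definition upper_rate :: "(nat set \<Rightarrow> nat) \<Rightarrow> nat set \<Rightarrow> real" where
  "upper_rate lab e = (if lab e < K * K - K then p + \<theta> else 1)"

abbreviation \<G> :: "graph set" where
  "\<G> \<equiv> graphs_with_degrees n d"

abbreviation atypical :: "(nat set \<Rightarrow> nat) \<Rightarrow> graph set" where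
  "atypical lab \<equiv> {G. \<not> typical n (K * K) p \<epsilon> lab G}"

lemma p_in_unit: "p \<in> {0..1}"
  using density by auto

lemma level_errors_le:
  assumes l: "l + K < K * K"
  defines "\<sigma> \<equiv> (1 - real l / real (K * K)) ^ 3" and "\<tau> \<equiv> (1 - real (Suc l) / real (K * K)) ^ 3"
  shows "0 < \<sigma>" "\<sigma> - \<tau> \<le> \<sigma> * (c\<^sup>2 * \<theta> / 2)" "9 * \<epsilon> + \<eta> \<le> \<sigma> * (c\<^sup>2 * \<theta> / 2)"
proof -
  define r where "r = 1 - real l / real (K * K)"
  define h where "h = 1 / real K * (1 / real K)"
  have K: "0 < 1 / real K" "1 / real K \<le> 1" using levels by auto
  have "real (l + K) < real (K * K)" using l by (rule of_nat_less_iff[THEN iffD2])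
  then have r: "1 / real K \<le> r" using levels by (simp add: r_def field_simps)
  then have r0: "0 < r" using K by linarith
  have "h \<le> 1 * (1 / real K)" unfolding h_def using K by (intro mult_right_mono) auto
  then have h: "0 \<le> h" "h \<le> r" using r K by (auto simp: h_def)
  have \<sigma>: "\<sigma> = r ^ 3" by (simp add: \<sigma>_def r_def)
  have \<tau>: "\<tau> = (r - h) ^ 3" by (simp add: \<tau>_def r_def h_def add_divide_distrib algebra_simps)
  show "0 < \<sigma>" using r0 by (simp add: \<sigma>)
  have "\<sigma> - \<tau> \<le> 3 * r\<^sup>2 * (1 / real K * (1 / real K))"
    unfolding \<sigma> \<tau> using cube_diff_le[OF h] by (simp add: h_def)
  also have "\<dots> \<le> 3 * r\<^sup>2 * (1 / real K * r)" using r K by (intro mult_left_mono) auto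
  also have "\<dots> = \<sigma> * (3 / real K)" by (simp add: \<sigma> power2_eq_square power3_eq_cube)
  also have "\<dots> \<le> \<sigma> * (c\<^sup>2 * \<theta> / 2)" using levels r0 by (intro mult_left_mono) (auto simp: \<sigma>)
  finally show "\<sigma> - \<tau> \<le> \<sigma> * (c\<^sup>2 * \<theta> / 2)" .
  have "(1 / real K) ^ 3 \<le> \<sigma>" unfolding \<sigma> using r K by (intro power_mono) auto
  then have "(1 / real K) ^ 3 * (c\<^sup>2 * \<theta> / 2) \<le> \<sigma> * (c\<^sup>2 * \<theta> / 2)"
    using tolerance by (intro mult_right_mono) auto
  moreover have "(1 / real K) ^ 3 * (c\<^sup>2 * \<theta> / 2) = c\<^sup>2 * \<theta> / 2 / real K ^ 3"
    by (simp add: power_one_over)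
  ultimately show "9 * \<epsilon> + \<eta> \<le> \<sigma> * (c\<^sup>2 * \<theta> / 2)" using errors(3) by linarith
qed

lemma deviation_le_tolerance:
  assumes l: "l + K < K * K" and x: "0 \<le> x"
  defines "\<sigma> \<equiv> (1 - real l / real (K * K)) ^ 3" and "\<tau> \<equiv> (1 - real (Suc l) / real (K * K)) ^ 3"
  assumes bound: "p * (1 - p) * \<sigma> * x \<le> 9 * \<epsilon> + \<eta> + (\<sigma> - \<tau>)"
  shows "x \<le> \<theta>"
proof -
  note level = level_errors_le[OF l, folded \<sigma>_def \<tau>_def]
  have "c * c \<le> p * (1 - p)" using density by (intro mult_mono) auto
  then have "c\<^sup>2 * (\<sigma> * x) \<le> p * (1 - p) * (\<sigma> * x)"
    unfolding power2_eq_square using level(1) x by (intro mult_right_mono) auto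
  also have "\<dots> \<le> \<sigma> * (c\<^sup>2 * \<theta> / 2) + \<sigma> * (c\<^sup>2 * \<theta> / 2)"
    using bound level(2,3) by (simp only: mult.assoc)
  also have "\<dots> = c\<^sup>2 * (\<sigma> * \<theta>)" by simp
  finally show ?thesis using density(1) level(1) by (simp add: mult_le_cancel_left_pos)
qed

lemma member_frequency_within_tolerance:
  fixes g
  assumes es: "es = xs @ e # ys" "set es = all_edges n" "distinct es" "sorted (map lab es)"
  defines "C \<equiv> history_class \<G> (set xs) g"
  assumes g: "g \<in> \<G>" and few: "real (card (C \<inter> atypical lab)) \<le> \<eta> * real (card C)"
    and l: "lab e + K < K * K"
  shows "\<bar>member_frequency C e - p\<bar> \<le> \<theta>"
proof -
  note exposed = superlevels_around_unexposed[OF es]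
  obtain j k where jk: "e = {j, k}" "j \<in> {1..n}" "k \<in> {1..n}"
    using exposed(1) by (auto simp: all_edges_def card_2_iff)
  have "0 \<le> 1 - real (Suc (lab e)) / real (K * K)"
    "1 - real (Suc (lab e)) / real (K * K) \<le> 1 - real (lab e) / real (K * K)"
    "1 - real (lab e) / real (K * K) \<le> 1"
    using l levels by (auto simp: divide_right_mono simp flip: of_nat_mult)
  then have level: "0 \<le> (1 - real (Suc (lab e)) / real (K * K)) ^ 3"
    "(1 - real (Suc (lab e)) / real (K * K)) ^ 3 \<le> (1 - real (lab e) / real (K * K)) ^ 3"
    "(1 - real (lab e) / real (K * K)) ^ 3 \<le> 1"
    by (auto intro!: power_mono power_le_one)
  have regular: "switching_regular n p ((1 - real m / real (K * K)) ^ 3) (9 * \<epsilon>)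
      (superlevel (all_edges n) lab m) G j k"
    if "G \<in> C - atypical lab" "m \<le> K * K" for G m
    using that jk p_in_unit errors levels size degrees
    by (intro typical_switching_regular[of n "K * K" p \<epsilon> lab G d])
       (auto simp: C_def history_class_def)
  have "p * (1 - p) * (1 - real (lab e) / real (K * K)) ^ 3 * \<bar>member_frequency C {j, k} - p\<bar> \<le>
      9 * \<epsilon> + \<eta> + ((1 - real (lab e) / real (K * K)) ^ 3 -
        (1 - real (Suc (lab e)) / real (K * K)) ^ 3)"
    unfolding C_def
  proof (rule member_frequency_switching_regular[OF _ _ size(1) exposed(2,3) superlevel_subset _
    p_in_unit level])
    show "{j, k} \<in> all_edges n - set xs" using exposed(1) by (simp add: jk)
    show "history_class \<G> (set xs) g \<noteq> {}" using g by (auto simp: history_class_def)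
    show "real (card (history_class \<G> (set xs) g \<inter> atypical lab)) \<le>
      \<eta> * real (card (history_class \<G> (set xs) g))" using few by (simp add: C_def)
    fix G assume G: "G \<in> history_class \<G> (set xs) g - atypical lab"
    show "switching_regular n p ((1 - real (Suc (lab e)) / real (K * K)) ^ 3) (9 * \<epsilon>)
        (superlevel (all_edges n) lab (Suc (lab e))) G j k"
      by (rule regular) (use G l in \<open>simp_all add: C_def\<close>)
    show "switching_regular n p ((1 - real (lab e) / real (K * K)) ^ 3) (9 * \<epsilon>)
        (superlevel (all_edges n) lab (lab e)) G j k"
      by (rule regular) (use G l in \<open>simp_all add: C_def\<close>)
  qed (use errors in simp)
  then show ?thesis
    using deviation_le_tolerance[OF l abs_ge_zero] by (simp only: jk(1))
qed

lemma card_deviating_le_atypical: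
  assumes es: "set es = all_edges n" "distinct es" "sorted (map lab es)"
  shows "real (card (deviating \<G> (lower_rate lab) (upper_rate lab) es)) \<le>
    real (length es) * (real (card (\<G> \<inter> atypical lab)) / \<eta>)"
proof (rule card_deviating_le[OF finite_graphs_with_degrees errors(2)])
  fix xs e ys g
  define C where "C = history_class \<G> (set xs) g"
  assume split: "es = xs @ e # ys" and g: "g \<in> \<G>"
    and "real (card (history_class \<G> (set xs) g \<inter> (\<G> \<inter> atypical lab)))
      \<le> \<eta> * real (card (history_class \<G> (set xs) g))"
  moreover have "C \<inter> (\<G> \<inter> atypical lab) = C \<inter> atypical lab"
    by (auto simp: C_def history_class_def)
  ultimately have few: "real (card (C \<inter> atypical lab)) \<le> \<eta> * real (card C)" by (simp add: C_def)
  show "member_frequency (history_class \<G> (set xs) g) e \<in> {lower_rate lab e..upper_rate lab e}"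
  proof (cases "lab e < K * K - K")
    case True
    then have "\<bar>member_frequency C e - p\<bar> \<le> \<theta>"
      unfolding C_def
      by (intro member_frequency_within_tolerance[OF split es g few[unfolded C_def]]) simp
    then show ?thesis using True by (auto simp: lower_rate_def upper_rate_def C_def)
  next
    case False
    have "finite C" using finite_graphs_with_degrees by (simp add: C_def history_class_def)
    then show ?thesis
      using False member_frequency_in_unit[of C e] by (simp add: lower_rate_def upper_rate_def C_def)
  qed
qed blast

lemma set_pmf_degree_random_graph: "set_pmf (degree_random_graph n d) = \<G>"
  using realisable finite_graphs_with_degrees by (simp add: degree_random_graph_def)

lemma labelled_coupling:
  "\<exists>J. is_coupling3 J (random_subset (all_edges n) (lower_rate lab)) (degree_random_graph n d)
      (random_subset (all_edges n) (upper_rate lab)) \<and>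
    measure_pmf.prob J (unsandwiched UNIV) \<le>
      (real n)\<^sup>2 / \<eta> * measure_pmf.prob (degree_random_graph n d) (atypical lab)"
proof -
  have \<G>: "finite \<G>" "\<G> \<noteq> {}" using finite_graphs_with_degrees realisable by auto
  obtain xs where "set xs = all_edges n" "distinct xs"
    using finite_distinct_list[OF finite_all_edges] by blast
  then obtain es where es: "set es = all_edges n" "distinct es" "sorted (map lab es)"
    by (metis distinct_sort set_sort sorted_sort_key)
  have rates: "0 \<le> lower_rate lab e \<and> upper_rate lab e \<le> 1" for e
    using density tolerance by (auto simp: lower_rate_def upper_rate_def)
  obtain J where J: "is_coupling3 J (random_subset (set es) (lower_rate lab)) (pmf_of_set \<G>)
      (random_subset (set es) (upper_rate lab))"
    and fail: "real (card \<G>) * measure_pmf.prob J (unsandwiched (set es)) \<le>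
      real (card (deviating \<G> (lower_rate lab) (upper_rate lab) es))"
    using sequential_coupling[OF \<G>(1) es(2), of "lower_rate lab" "upper_rate lab"] rates by blast
  have "(X, G, Y) \<in> unsandwiched (set es)"
    if "(X, G, Y) \<in> set_pmf J" "(X, G, Y) \<in> unsandwiched UNIV" for X G Y
  proof -
    have "G \<subseteq> set es"
      using is_coupling3_support(2)[OF J that(1)] \<G> graphs_with_degrees_subset by (auto simp: es(1))
    then show ?thesis using that(2) by (auto simp: unsandwiched_def)
  qed
  then have "measure_pmf.prob J (unsandwiched UNIV) \<le> measure_pmf.prob J (unsandwiched (set es))"
    by (intro measure_pmf.finite_measure_mono_AE) (auto simp: AE_measure_pmf_iff)
  also have "\<dots> \<le> real (card (deviating \<G> (lower_rate lab) (upper_rate lab) es)) / real (card \<G>)"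
    using fail \<G> by (simp add: card_gt_0_iff pos_le_divide_eq mult.commute)
  also have "\<dots> \<le> (real (length es) * (real (card (\<G> \<inter> atypical lab)) / \<eta>)) / real (card \<G>)"
    by (intro divide_right_mono card_deviating_le_atypical es) simp
  also have "\<dots> = real (length es) / \<eta> * measure_pmf.prob (pmf_of_set \<G>) (atypical lab)"
    using \<G> by (simp add: measure_pmf_of_set)
  also have "real (length es) \<le> (real n)\<^sup>2"
    using card_all_edges_le[of n] distinct_card[OF es(2)] es(1) by (simp flip: of_nat_power)
  finally show ?thesis
    using J errors by (auto simp: es(1) degree_random_graph_def divide_right_mono mult_right_mono)
qed

definition sandwich_error :: real where
  "sandwich_error = (real n)\<^sup>2 / \<eta> *
     (measure_pmf.prob (degree_random_graph n d) {G. \<not> cut_regular n p \<epsilon> G} +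
      2 * label_error (K * K) \<epsilon> n)"

lemma sandwich_coupling:
  obtains C where "is_coupling3 C (binomial_random_graph n ((p - \<theta>) * (1 - 1 / real K)))
      (degree_random_graph n d)
      (binomial_random_graph n ((p + \<theta>) * (1 - 1 / real K) + 1 / real K))"
    "measure_pmf.prob C (unsandwiched UNIV) \<le> sandwich_error"
proof -
  define M where "M = uniform_labels (all_edges n) (K * K)"
  define D where "D = degree_random_graph n d"
  obtain J where J: "\<And>lab. is_coupling3 (J lab) (random_subset (all_edges n) (lower_rate lab)) D
      (random_subset (all_edges n) (upper_rate lab))"
    and fail: "\<And>lab. measure_pmf.prob (J lab) (unsandwiched UNIV) \<le>
      (real n)\<^sup>2 / \<eta> * measure_pmf.prob D (atypical lab)"
    using labelled_coupling unfolding D_def by metis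
  have L: "0 < K * K" "K * K - K \<le> K * K" using levels by auto
  have exposed: "real (K * K - K) / real (K * K) = 1 - 1 / real K"
    using levels by (simp add: of_nat_diff field_simps)
  have rates: "p - \<theta> \<in> {0..1}" "p + \<theta> \<in> {0..1}" using density tolerance by auto
  have "is_coupling3 (bind_pmf M J) (bind_pmf M (\<lambda>lab. random_subset (all_edges n) (lower_rate lab)))
      (bind_pmf M (\<lambda>_. D)) (bind_pmf M (\<lambda>lab. random_subset (all_edges n) (upper_rate lab)))"
    by (rule is_coupling3_mixture) (rule J)
  moreover have "bind_pmf M (\<lambda>lab. random_subset (all_edges n) (lower_rate lab)) =
      binomial_random_graph n ((p - \<theta>) * (1 - 1 / real K))"
    using random_subset_label_mixture[OF finite_all_edges L rates(1), of 0 n, unfolded exposed]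
    by (simp add: M_def lower_rate_def[abs_def] binomial_random_graph_eq_random_subset)
  moreover have "bind_pmf M (\<lambda>lab. random_subset (all_edges n) (upper_rate lab)) =
      binomial_random_graph n ((p + \<theta>) * (1 - 1 / real K) + 1 / real K)"
    using random_subset_label_mixture[OF finite_all_edges L rates(2), of 1 n, unfolded exposed]
    by (simp add: M_def upper_rate_def[abs_def] binomial_random_graph_eq_random_subset)
  ultimately have "is_coupling3 (bind_pmf M J)
      (binomial_random_graph n ((p - \<theta>) * (1 - 1 / real K))) D
      (binomial_random_graph n ((p + \<theta>) * (1 - 1 / real K) + 1 / real K))"
    by simp
  moreover have "measure_pmf.prob (bind_pmf M J) (unsandwiched UNIV) \<le>
      measure_pmf.expectation M (\<lambda>lab. (real n)\<^sup>2 / \<eta> * measure_pmf.prob D (atypical lab))"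
    unfolding prob_bind_pmf using fail
    by (intro integral_mono integrable_mult_right measure_pmf.integrable_const_bound[where B = 1]) auto
  moreover have "\<dots> = (real n)\<^sup>2 / \<eta> *
      measure_pmf.expectation M (\<lambda>lab. measure_pmf.prob D (atypical lab))"
    by (rule integral_mult_right_zero)
  moreover have "\<dots> \<le> sandwich_error"
    unfolding M_def D_def sandwich_error_def using errors size L graphs_with_degrees_subset
    by (intro mult_left_mono expectation_atypical_le) (auto simp: set_pmf_degree_random_graph)
  ultimately show thesis using that[of "bind_pmf M J"] unfolding D_def by linarith
qed

end

section \<open>The sandwich\<close>

definition sandwichable :: "nat \<Rightarrow> (nat \<Rightarrow> nat) \<Rightarrow> real \<Rightarrow> real \<Rightarrow> bool" where
  "sandwichable n d p \<gamma> \<longleftrightarrow> (\<exists>\<epsilon>1 \<epsilon>2 C. \<bar>\<epsilon>1\<bar> \<le> \<gamma> \<and> \<bar>\<epsilon>2\<bar> \<le> \<gamma> \<and>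
     (1 - \<epsilon>1) * p \<in> {0..1} \<and> (1 + \<epsilon>2) * p \<in> {0..1} \<and>
     is_coupling3 C (binomial_random_graph n ((1 - \<epsilon>1) * p)) (degree_random_graph n d)
       (binomial_random_graph n ((1 + \<epsilon>2) * p)) \<and>
     1 - measure_pmf.prob C {(GL, G, GU). GL \<subseteq> G \<and> G \<subseteq> GU} \<le> \<gamma>)"

lemma sandwichable_trivial:
  assumes "p \<in> {0..1}"
  shows "sandwichable n d p 1"
  unfolding sandwichable_def using assms is_coupling3_pair_pmf by (intro exI[of _ 0]) auto

lemma sandwichableI:
  assumes p: "0 < p" and rates: "p1 \<in> {0..1}" "p2 \<in> {0..1}" "\<bar>p1 - p\<bar> \<le> \<gamma> * p" "\<bar>p2 - p\<bar> \<le> \<gamma> * p"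
    and C: "is_coupling3 C (binomial_random_graph n p1) (degree_random_graph n d)
        (binomial_random_graph n p2)"
    and fail: "measure_pmf.prob C (unsandwiched UNIV) \<le> \<gamma>"
  shows "sandwichable n d p \<gamma>"
proof -
  have "\<bar>1 - p1 / p\<bar> \<le> \<gamma>" "\<bar>p2 / p - 1\<bar> \<le> \<gamma>"
    using p rates(3,4) by (auto simp: abs_le_iff field_simps)
  moreover have "(1 - (1 - p1 / p)) * p = p1" "(1 + (p2 / p - 1)) * p = p2" using p by auto
  moreover have "{(GL, G, GU). GL \<subseteq> G \<and> G \<subseteq> GU} = space (measure_pmf C) - unsandwiched UNIV"
    by (auto simp: unsandwiched_def)
  then have "1 - measure_pmf.prob C {(GL, G, GU). GL \<subseteq> G \<and> G \<subseteq> GU} \<le> \<gamma>"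
    using measure_pmf.prob_compl[of "unsandwiched UNIV" C] fail by simp
  ultimately show ?thesis
    unfolding sandwichable_def using rates(1,2) C
    by (intro exI[of _ "1 - p1 / p"] exI[of _ "p2 / p - 1"] exI[of _ C]) (simp only:)
qed

lemma (in exposure) sandwichable_if_error_le:
  assumes \<gamma>: "\<theta> + 1 / real K \<le> \<gamma> * c"
    and fail: "sandwich_error \<le> \<gamma>"
  shows "sandwichable n d p \<gamma>"
proof -
  define s where "s = 1 / real K"
  have s: "0 \<le> s" "s \<le> 1" using levels by (auto simp: s_def)
  have "0 \<le> \<gamma> * c" using \<gamma> tolerance s unfolding s_def by linarith
  then have "\<gamma> \<ge> 0" using density(1) by (simp add: zero_le_mult_iff)
  then have \<gamma>p: "\<theta> + s \<le> \<gamma> * p" using \<gamma> density mult_left_mono[of c p \<gamma>] by (simp add: s_def)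
  define p1 where "p1 = (p - \<theta>) * (1 - s)"
  define p2 where "p2 = (p + \<theta>) * (1 - s) + s"
  have p\<theta>: "0 \<le> p - \<theta>" "p - \<theta> \<le> 1" "0 \<le> p + \<theta>" "p + \<theta> \<le> 1" using density tolerance by auto
  have "0 \<le> (p - \<theta>) * s" "(p - \<theta>) * s \<le> s" "0 \<le> (p + \<theta>) * s" "(p + \<theta>) * s \<le> s"
    using p\<theta> s by (auto intro: mult_left_le_one_le)
  moreover have "0 \<le> p1" "0 \<le> (1 - (p + \<theta>)) * (1 - s)"
    unfolding p1_def using p\<theta> s by (intro mult_nonneg_nonneg; simp)+
  moreover have "p1 = p - \<theta> - (p - \<theta>) * s" "p2 = p + \<theta> - (p + \<theta>) * s + s"
    "(1 - (p + \<theta>)) * (1 - s) = 1 - p2"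
    by (simp_all add: p1_def p2_def algebra_simps)
  ultimately have "0 \<le> p1" "p1 \<le> 1" "0 \<le> p2" "p2 \<le> 1" "\<bar>p1 - p\<bar> \<le> \<theta> + s" "\<bar>p2 - p\<bar> \<le> \<theta> + s"
    using p\<theta> s tolerance by linarith+
  then have rates: "p1 \<in> {0..1}" "p2 \<in> {0..1}" "\<bar>p1 - p\<bar> \<le> \<gamma> * p" "\<bar>p2 - p\<bar> \<le> \<gamma> * p"
    using \<gamma>p by auto
  obtain C where "is_coupling3 C (binomial_random_graph n p1) (degree_random_graph n d)
      (binomial_random_graph n p2)"
    and "measure_pmf.prob C (unsandwiched UNIV) \<le> sandwich_error"
    unfolding p1_def p2_def s_def by (rule sandwich_coupling)
  then show ?thesis
    using fail density by (intro sandwichableI[OF _ rates]) auto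
qed

lemma exposure_constants:
  fixes c \<gamma> :: real
  assumes "0 < c" "0 < \<gamma>"
  obtains K :: nat and \<theta> \<epsilon> \<eta> :: real where "0 < \<theta>" "\<theta> \<le> c" "0 < K" "3 / real K \<le> c\<^sup>2 * \<theta> / 2"
    "\<theta> + 1 / real K \<le> \<gamma> * c" "0 < \<epsilon>" "0 < \<eta>" "9 * \<epsilon> + \<eta> \<le> c\<^sup>2 * \<theta> / 2 / real K ^ 3"
proof -
  define \<theta> where "\<theta> = min c (\<gamma> * c / 2)"
  have \<theta>: "0 < \<theta>" "\<theta> \<le> c" "\<theta> \<le> \<gamma> * c / 2" using assms by (auto simp: \<theta>_def)
  define K where "K = nat \<lceil>max (6 / (c\<^sup>2 * \<theta>)) (2 / (\<gamma> * c))\<rceil> + 1"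
  have K: "0 < K" "max (6 / (c\<^sup>2 * \<theta>)) (2 / (\<gamma> * c)) \<le> real K" unfolding K_def by linarith+
  then have "6 / (c\<^sup>2 * \<theta>) \<le> real K" "2 / (\<gamma> * c) \<le> real K" by auto
  then have "3 / real K \<le> c\<^sup>2 * \<theta> / 2" "1 / real K \<le> \<gamma> * c / 2"
    using K(1) assms \<theta>(1) by (simp_all add: field_simps)
  moreover define \<eta> where "\<eta> = c\<^sup>2 * \<theta> / 2 / real K ^ 3 / 2"
  moreover have "0 < \<eta>" using assms \<theta> K by (simp add: \<eta>_def)
  moreover have "9 * (\<eta> / 9) + \<eta> \<le> c\<^sup>2 * \<theta> / 2 / real K ^ 3" by (simp add: \<eta>_def mult.commute)
  ultimately show thesis using that[of \<theta> K "\<eta> / 9" \<eta>] \<theta> K(1) by simp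
qed

lemma eventually_sandwichable:
  fixes c \<gamma> :: real
  assumes c: "0 < c" "c \<le> 1" and \<gamma>: "0 < \<gamma>"
  shows "eventually_near_regular c (\<lambda>n p d. sandwichable n d p \<gamma>)"
proof -
  obtain K :: nat and \<theta> \<epsilon> \<eta> :: real where constants:
    "0 < \<theta>" "\<theta> \<le> c" "0 < K" "3 / real K \<le> c\<^sup>2 * \<theta> / 2"
    "\<theta> + 1 / real K \<le> \<gamma> * c" "0 < \<epsilon>" "0 < \<eta>" "9 * \<epsilon> + \<eta> \<le> c\<^sup>2 * \<theta> / 2 / real K ^ 3"
    by (rule exposure_constants[OF c(1) \<gamma>])
  define \<alpha> where "\<alpha> = (\<lambda>n. 4 * 4 ^ n * exp (- (\<epsilon>\<^sup>2 / 8) * (real n)\<^sup>2))"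
  define \<beta> where "\<beta> = (\<lambda>n. (real n)\<^sup>2 / \<eta> * (\<alpha> n + 2 * label_error (K * K) \<epsilon> n))"
  have "\<beta> \<longlonglongrightarrow> 0"
    unfolding \<alpha>_def \<beta>_def label_error_def cut_error_def using constants by real_asymp
  then have "\<forall>\<^sub>F n in sequentially. \<beta> n < \<gamma>"
    using \<gamma> by (rule order_tendstoD)
  moreover have "\<forall>\<^sub>F n in sequentially. 1 / \<epsilon> \<le> real n" by real_asymp
  ultimately have large: "\<forall>\<^sub>F n in sequentially. \<beta> n < \<gamma> \<and> 1 \<le> \<epsilon> * real n \<and> 0 < n"
    using eventually_gt_at_top[of "0::nat"] by eventually_elim (use constants in \<open>simp add: field_simps\<close>)
  show ?thesis
  proof (rule eventually_near_regular_mono[OF degree_random_graph_cut_regular_whp[OF c] _ large])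
    fix n p d
    assume n: "\<beta> n < \<gamma> \<and> 1 \<le> \<epsilon> * real n \<and> 0 < n" and p: "p \<in> {c..1 - c}"
      and d: "degrees_within n p \<epsilon> d" and ne: "graphs_with_degrees n d \<noteq> {}"
      and cut: "measure_pmf.prob (degree_random_graph n d) {G. \<not> cut_regular n p \<epsilon> G} \<le>
        4 * 4 ^ n * exp (- (\<epsilon>\<^sup>2 / 8) * (real n)\<^sup>2)"
    interpret exposure n K d c p \<theta> \<epsilon> \<eta>
      using c(1) constants n p d ne by unfold_locales simp_all
    have "sandwich_error \<le> \<beta> n"
      unfolding sandwich_error_def \<beta>_def \<alpha>_def using cut constants by (intro mult_left_mono) auto
    then show "sandwichable n d p \<gamma>"
      using n constants by (intro sandwichable_if_error_le) auto
  qed (use constants in auto)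
qed

lemma diagonal_tolerance:
  fixes Q :: "real \<Rightarrow> nat \<Rightarrow> bool"
  assumes eventually: "\<And>\<gamma>. 0 < \<gamma> \<Longrightarrow> eventually (Q \<gamma>) sequentially" and fallback: "\<And>n. Q \<gamma>0 n"
  obtains g :: "nat \<Rightarrow> real" where "g \<longlonglongrightarrow> 0" "\<And>n. Q (g n) n"
proof -
  have "\<exists>N. \<forall>n\<ge>N. Q (1 / real (Suc k)) n" for k
    using eventually[of "1 / real (Suc k)"] by (simp add: eventually_sequentially)
  then obtain N where N: "\<And>k n. n \<ge> N k \<Longrightarrow> Q (1 / real (Suc k)) n" by metis
  define S where "S = (\<lambda>n. {k. k \<le> n \<and> N k \<le> n})"
  define g where "g = (\<lambda>n. if S n = {} then \<gamma>0 else 1 / real (Suc (Max (S n))))"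
  have fin: "finite (S n)" for n by (rule finite_subset[of _ "{..n}"]) (auto simp: S_def)
  have "Q (g n) n" for n
  proof (cases "S n = {}")
    case False
    then have "Max (S n) \<in> S n" using fin by (intro Max_in)
    then have "Q (1 / real (Suc (Max (S n)))) n" using N by (simp only: S_def mem_Collect_eq)
    then show ?thesis using False by (simp add: g_def)
  qed (simp add: g_def fallback)
  moreover have "g \<longlonglongrightarrow> 0"
  proof (rule LIMSEQ_I)
    fix r :: real assume "0 < r"
    then obtain k where k: "1 / real (Suc k) < r" using nat_approx_posE by blast
    have "norm (g n - 0) < r" if "max k (N k) \<le> n" for n
    proof -
      have "k \<in> S n" using that by (simp add: S_def)
      then have "g n = 1 / real (Suc (Max (S n)))" "k \<le> Max (S n)" using fin by (auto simp: g_def)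
      moreover from this have "1 / real (Suc (Max (S n))) \<le> 1 / real (Suc k)"
        by (intro divide_left_mono) auto
      ultimately show ?thesis using k by simp
    qed
    then show "\<exists>no. \<forall>n\<ge>no. norm (g n - 0) < r" by blast
  qed
  ultimately show thesis using that by blast
qed

lemma max_degree_le:
  assumes "\<And>j. j \<in> {1..n} \<Longrightarrow> d j \<le> n" "0 < n"
  shows "max_degree n d \<le> n"
  using assms by (auto simp: max_degree_def Max_le_iff)

lemma degrees_within_range:
  assumes "degree_range n d \<le> \<delta> * real n" "0 < n"
  shows "degrees_within n (real (max_degree n d) / real n) \<delta> d"
proof -
  have "d j \<le> max_degree n d" "min_degree n d \<le> d j" if "j \<in> {1..n}" for j
    using that by (auto simp: max_degree_def min_degree_def intro: Max_ge Min_le)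
  then show ?thesis
    using assms by (force simp: degrees_within_def degree_range_def left_diff_distrib)
qed

lemma dense_degrees_density:
  assumes dense: "dense_degrees d" and le: "\<And>n j. j \<in> {1..n} \<Longrightarrow> d n j \<le> n"
  obtains c where "0 < c" "c \<le> 1"
    "\<forall>\<^sub>F n in sequentially. real (max_degree n (d n)) / real n \<in> {c..1 - c}"
proof -
  have "(\<lambda>n. min (real (max_degree n (d n))) (real n - real (max_degree n (d n)))) \<in> \<Omega>(\<lambda>n. real n)"
    using dense unfolding dense_degrees_def by (rule bigthetaD2)
  then obtain c where c: "0 < c" and ge: "\<forall>\<^sub>F n in sequentially.
      c * norm (real n) \<le> norm (min (real (max_degree n (d n))) (real n - real (max_degree n (d n))))"
    by (elim landau_omega.bigE) blast
  from ge eventually_gt_at_top[of 0]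
  have "\<forall>\<^sub>F n in sequentially. real (max_degree n (d n)) / real n \<in> {min c 1..1 - min c 1}"
  proof eventually_elim
    case (elim n)
    then have "c * real n \<le> real (max_degree n (d n))"
      "c * real n \<le> real n - real (max_degree n (d n))"
      using max_degree_le[of n "d n"] le by auto
    moreover have "min c 1 * real n \<le> c * real n" by (intro mult_right_mono) auto
    ultimately have "min c 1 * real n \<le> real (max_degree n (d n))"
      "real (max_degree n (d n)) \<le> (1 - min c 1) * real n"
      unfolding left_diff_distrib by linarith+
    then show ?case using elim by (simp add: pos_le_divide_eq pos_divide_le_eq)
  qed
  then show thesis using that[of "min c 1"] c by simp
qed

lemma near_regular_degrees_within:
  assumes near: "near_regular d" and le: "\<And>n j. j \<in> {1..n} \<Longrightarrow> d n j \<le> n" and \<delta>: "0 < \<delta>"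
  shows "\<forall>\<^sub>F n in sequentially. degrees_within n (real (max_degree n (d n)) / real n) \<delta> (d n)"
proof -
  have "\<forall>\<^sub>F n in sequentially. norm (degree_range n (d n)) \<le> \<delta> * norm (real (max_degree n (d n)))"
    using near \<delta> unfolding near_regular_def by (intro landau_o.smallD) auto
  then show ?thesis using eventually_gt_at_top[of 0]
  proof eventually_elim
    case (elim n)
    have "\<delta> * real (max_degree n (d n)) \<le> \<delta> * real n"
      using max_degree_le[of n "d n"] le elim \<delta> by (intro mult_left_mono) auto
    then show ?case using elim by (intro degrees_within_range) auto
  qed
qed

lemma near_regular_dense_sandwichable:
  assumes near: "near_regular d" and dense: "dense_degrees d" and le: "\<And>n j. j \<in> {1..n} \<Longrightarrow> d n j \<le> n"
    and ne: "\<And>n. graphs_with_degrees n (d n) \<noteq> {}" and \<gamma>: "0 < \<gamma>"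
  shows "\<forall>\<^sub>F n in sequentially. sandwichable n (d n) (real (max_degree n (d n)) / real n) \<gamma>"
proof -
  obtain c where c: "0 < c" "c \<le> 1"
    and density: "\<forall>\<^sub>F n in sequentially. real (max_degree n (d n)) / real n \<in> {c..1 - c}"
    using dense_degrees_density[OF dense le] by blast
  have "eventually_near_regular c (\<lambda>n p d. sandwichable n d p \<gamma>)"
    by (rule eventually_sandwichable[OF c \<gamma>])
  then obtain \<delta> where "0 < \<delta>" and sandwich: "\<forall>\<^sub>F n in sequentially. \<forall>p d. p \<in> {c..1 - c} \<longrightarrow>
      degrees_within n p \<delta> d \<longrightarrow> graphs_with_degrees n d \<noteq> {} \<longrightarrow> sandwichable n d p \<gamma>"
    unfolding eventually_near_regular_def by blast
  have "\<forall>\<^sub>F n in sequentially. degrees_within n (real (max_degree n (d n)) / real n) \<delta> (d n)"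
    using near le \<open>0 < \<delta>\<close> by (rule near_regular_degrees_within)
  with density sandwich show ?thesis by eventually_elim (use ne in blast)
qed

theorem theorem2p1:
  fixes d :: "nat \<Rightarrow> nat \<Rightarrow> nat"
  assumes "\<And>n j. j \<in> {1..n} \<Longrightarrow> d n j \<in> {0..n - 1}"
    and "\<And>n. graphs_with_degrees n (d n) \<noteq> {}"
    and "near_regular d"
    and "dense_degrees d"
  shows "\<exists>(p1 :: nat \<Rightarrow> real) (p2 :: nat \<Rightarrow> real)
            (\<epsilon>1 :: nat \<Rightarrow> real) (\<epsilon>2 :: nat \<Rightarrow> real)
            (C :: nat \<Rightarrow> (graph \<times> graph \<times> graph) pmf).
           \<epsilon>1 \<in> o(\<lambda>_. 1) \<and> \<epsilon>2 \<in> o(\<lambda>_. 1) \<and>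
           (\<forall>n. p1 n \<in> {0..1} \<and> p1 n = (1 - \<epsilon>1 n) * real (max_degree n (d n)) / real n) \<and>
           (\<forall>n. p2 n \<in> {0..1} \<and> p2 n = (1 + \<epsilon>2 n) * real (max_degree n (d n)) / real n) \<and>
           (\<forall>n. is_coupling3 (C n)
                  (binomial_random_graph n (p1 n))
                  (degree_random_graph n (d n))
                  (binomial_random_graph n (p2 n))) \<and>
           (\<lambda>n. 1 - measure_pmf.prob (C n) {(GL, G, GU). GL \<subseteq> G \<and> G \<subseteq> GU}) \<in> o(\<lambda>_. 1)"
proof -
  define p where "p = (\<lambda>n. real (max_degree n (d n)) / real n)"
  have le: "d n j \<le> n" if "j \<in> {1..n}" for n j using assms(1)[OF that] by simp
  then have "p n \<in> {0..1}" for n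
    using max_degree_le[of n "d n"] by (cases "n = 0") (auto simp: p_def)
  moreover have "\<forall>\<^sub>F n in sequentially. sandwichable n (d n) (p n) \<gamma>" if "0 < \<gamma>" for \<gamma>
    unfolding p_def using assms(3,4) le assms(2) that by (rule near_regular_dense_sandwichable)
  ultimately obtain g where g: "g \<longlonglongrightarrow> 0" and "\<And>n. sandwichable n (d n) (p n) (g n)"
    using diagonal_tolerance[of "\<lambda>\<gamma> n. sandwichable n (d n) (p n) \<gamma>" 1] sandwichable_trivial by blast
  then have "\<forall>n. sandwichable n (d n) (p n) (g n)" by blast
  then obtain \<epsilon>1 \<epsilon>2 C where "\<forall>n. \<bar>\<epsilon>1 n\<bar> \<le> g n \<and> \<bar>\<epsilon>2 n\<bar> \<le> g n \<and>
      (1 - \<epsilon>1 n) * p n \<in> {0..1} \<and> (1 + \<epsilon>2 n) * p n \<in> {0..1} \<and>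
      is_coupling3 (C n) (binomial_random_graph n ((1 - \<epsilon>1 n) * p n))
        (degree_random_graph n (d n)) (binomial_random_graph n ((1 + \<epsilon>2 n) * p n)) \<and>
      1 - measure_pmf.prob (C n) {(GL, G, GU). GL \<subseteq> G \<and> G \<subseteq> GU} \<le> g n"
    unfolding sandwichable_def choice_iff by blast
  moreover have "f \<in> o(\<lambda>_. 1)" if "\<And>n. \<bar>f n\<bar> \<le> g n" for f :: "nat \<Rightarrow> real"
    using Lim_null_comparison[OF always_eventually g, of f] that by (intro smalloI_tendsto) auto
  ultimately show ?thesis
    by (intro exI[of _ "\<lambda>n. (1 - \<epsilon>1 n) * p n"] exI[of _ "\<lambda>n. (1 + \<epsilon>2 n) * p n"]
        exI[of _ \<epsilon>1] exI[of _ \<epsilon>2] exI[of _ C])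
       (simp add: p_def)
qed

end
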